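(* Let $q$ be a prime power, $k\geq 2$ an integer, $F/\mathbb{F}_q$ an algebraic function field, $Q$ a place of $F/\mathbb{F}_q$ of degree $n$, $\mathcal{D}$ a divisor of $F/\mathbb{F}_q$, and $\mathcal{P}=\{P_{1,1},\dots,P_{1,N_1},\dots,P_{d,1},\dots,P_{d,N_d}\}$ a set of $N=\sum_{i=1}^d N_i$ places of $F$, where $P_{i,j}$ has degree $i$ and $N_i\geq 0$ is the number of chosen places of degree $i$. Suppose $Q$ and all places of $\mathcal{P}$ lie outside the support of $\mathcal{D}$, and that: (1) the map $Ev_Q:\mathcal{L}(\mathcal{D})\to F_Q\simeq\mathbb{F}_{q^n}$, $f\mapsto f(Q)$, is onto; (2) the map $Ev_{\mathcal{P}}:\mathcal{L}(k\mathcal{D})\to \mathbb{F}_q^{N_1}\times\mathbb{F}_{q^2}^{N_2}\times\cdots\times\mathbb{F}_{q^d}^{N_d}$, $f\mapsto (f(P_{1,1}),\dots,f(P_{1,N_1}),\dots,f(P_{d,1}),\dots,f(P_{d,N_d}))$, is injective. Then for any $x_1,\dots,x_k\in\mathbb{F}_{q^n}$, $$m_k(x_1,\dots,x_k)=Ev_Q\Big(Ev_{\mathcal{P}}^{-1}\Big(\bigodot_{i=1}^k Ev_{\mathcal{P}}\big(Ev_Q^{-1}(x_i)\big)\Big)\Big),$$ (where $Ev_Q^{-1}(x_i)$ denotes any preimage of $x_i$ in $\mathcal{L}(\mathcal{D})$ and $Ev_Q$ on the outside is evaluation at $Q$ of an element of $\mathcal{L}(k\mathcal{D})$), and $$\mu_{q,k}(n)\leq\sum_{i=1}^d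 N_i\,\mu_{q,k}(i),\qquad \nu_{q,k}(n)\leq (k-1)\sum_{i=1}^d N_i\,\mu_q(i).$$
   Context: For a divisor $D$, $\mathcal{L}(D)$ is its Riemann–Roch space. For a place $P$, $\mathcal{O}_P$ is its valuation ring and $F_P=\mathcal{O}_P/P\simeq\mathbb{F}_{q^{\deg P}}$ its residue field; for $g\in\mathcal{O}_P$, $g(P)$ is its class in $F_P$. $m_k(x_1,\dots,x_k)=\prod_i x_i$. The Hadamard product on $\mathbb{F}_q^{N_1}\times\cdots\times\mathbb{F}_{q^d}^{N_d}$ is componentwise: $\bigodot_{i=1}^k(u^i_{1,1},\dots,u^i_{d,N_d})=(\prod_i u^i_{1,1},\dots,\prod_i u^i_{d,N_d})$. $\mu_{q,k}(n)$ is the minimal number $s$ of summands in an expression $\prod_{j=1}^k x_j=\sum_{i=1}^s\big(\prod_{j=1}^k a^*_{i,j}(x_j)\big)c_i$ valid for all $x_j\in\mathbb{F}_{q^n}$, with $a^*_{i,j}$ $\mathbb{F}_q$-linear forms on $\mathbb{F}_{q^n}$ and $c_i\in\mathbb{F}_{q^n}$ (tensor rank of $k$-multiplication); $\mu_q=\mu_{q,2}$. $\nu_{q,k}(n)$ is the minimal number of bilinear (non-scalar) multiplications in $\mathbb{F}_q$ needed to compute the product of $k$ elements of $\mathbb{F}_{q^n}$. *)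

theory Defs
  imports "HOL-Algebra.Algebra" "HOL-Number_Theory.Prime_Powers"
begin

section \<open>Algebraic function fields, places, evaluation\<close>

text \<open>
  Conventions follow Stichtenoth, Algebraic Function Fields and Codes, Chapter 1. The function
  field is a HOL-Algebra field \<open>F\<close> and its base field is a subset \<open>K\<close> of the carrier. As in
  Stichtenoth's definition, \<open>K\<close> is not required to be algebraically closed in \<open>F\<close>.
\<close>

definition function_field :: "('a, 'b) ring_scheme \<Rightarrow> 'a set \<Rightarrow> bool" where
  "function_field F K \<longleftrightarrow> field F \<and> subfield K F \<and>
     (\<exists>x \<in> carrier F. ring.transcendental F K x \<and>
        ring.finite_dimension F (generate_field F (insert x K)) (carrier F))"

definition valuation_ring :: "('a, 'b) ring_scheme \<Rightarrow> 'a set \<Rightarrow> 'a set \<Rightarrow> bool" where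
  "valuation_ring F K V \<longleftrightarrow> subring V F \<and> K \<subset> V \<and> V \<subset> carrier F \<and>
     (\<forall>z \<in> carrier F - {\<zero>\<^bsub>F\<^esub>}. z \<in> V \<or> inv\<^bsub>F\<^esub> z \<in> V)"

definition places :: "('a, 'b) ring_scheme \<Rightarrow> 'a set \<Rightarrow> 'a set set" where
  "places F K = {P. \<exists>V. valuation_ring F K V \<and> maximalideal P (F\<lparr>carrier := V\<rparr>)}"

text \<open>
  The valuation ring is recovered from the place \<open>P\<close> as the set of \<open>z\<close> with \<open>1/z \<notin> P\<close>; see
  \<open>place_ring_eq\<close> below.
\<close>

definition place_ring :: "('a, 'b) ring_scheme \<Rightarrow> 'a set \<Rightarrow> ('a, 'b) ring_scheme" where
  "place_ring F P =
     F\<lparr>carrier := {z \<in> carrier F. z = \<zero>\<^bsub>F\<^esub> \<or> inv\<^bsub>F\<^esub> z \<notin> P}\<rparr>"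

definition residue_field :: "('a, 'b) ring_scheme \<Rightarrow> 'a set \<Rightarrow> 'a set ring" where
  "residue_field F P = place_ring F P Quot P"

text \<open>The value \<open>f(P)\<close>, meaningful for \<open>f\<close> in the valuation ring of \<open>P\<close>.\<close>

definition ev :: "('a, 'b) ring_scheme \<Rightarrow> 'a set \<Rightarrow> 'a \<Rightarrow> 'a set" where
  "ev F P f = P +>\<^bsub>place_ring F P\<^esub> f"

definition has_degree :: "('a, 'b) ring_scheme \<Rightarrow> 'a set \<Rightarrow> 'a set \<Rightarrow> nat \<Rightarrow> bool" where
  "has_degree F K P m \<longleftrightarrow>
     ring.dimension (residue_field F P) m (ev F P ` K) (carrier (residue_field F P))"

text \<open>
  For \<open>z \<noteq> 0\<close>: write \<open>z = t\<^sup>m u\<close> with \<open>t\<close> a generator of the ideal \<open>P\<close> and \<open>u\<close> a unit of the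
  valuation ring. The value at \<open>z = 0\<close> is irrelevant.
\<close>

definition valuation :: "('a, 'b) ring_scheme \<Rightarrow> 'a set \<Rightarrow> 'a \<Rightarrow> int" where
  "valuation F P z = (THE m. \<exists>t \<in> P. P = PIdl\<^bsub>place_ring F P\<^esub> t \<and>
     (\<exists>u \<in> Units (place_ring F P). z = (t [^]\<^bsub>F\<^esub> (m::int)) \<otimes>\<^bsub>F\<^esub> u))"

abbreviation divisors :: "('a, 'b) ring_scheme \<Rightarrow> 'a set \<Rightarrow> ('a set \<Rightarrow>\<^sub>0 int) set" where
  "divisors F K \<equiv> carrier (free_Abelian_group (places F K))"

definition riemann_roch_space ::
  "('a, 'b) ring_scheme \<Rightarrow> 'a set \<Rightarrow> ('a set \<Rightarrow>\<^sub>0 int) \<Rightarrow> 'a set" where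
  "riemann_roch_space F K D =
     {f \<in> carrier F. f = \<zero>\<^bsub>F\<^esub> \<or>
        (\<forall>P \<in> places F K. valuation F P f \<ge> - Poly_Mapping.lookup D P)}"

lemma place_ring_eq:
  assumes F: "field F" and V: "valuation_ring F K V"
    and P: "maximalideal P (F\<lparr>carrier := V\<rparr>)"
  shows "place_ring F P = F\<lparr>carrier := V\<rparr>"
proof -
  interpret F: field F by (rule F)
  define R where "R = F\<lparr>carrier := V\<rparr>"
  have sub: "subring V F" and VF: "V \<subseteq> carrier F"
    and inv: "\<And>z. z \<in> carrier F \<Longrightarrow> z \<noteq> \<zero>\<^bsub>F\<^esub> \<Longrightarrow> z \<in> V \<or> inv\<^bsub>F\<^esub> z \<in> V"
    using V by (auto simp: valuation_ring_def)
  have cR: "cring R"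
    unfolding R_def using F.subring_is_domain[OF sub] by (simp add: domain_def)
  interpret R: cring R by (rule cR)
  interpret M: maximalideal P R using P by (simp add: R_def)
  have ops: "carrier R = V" "monoid.mult R = monoid.mult F" "ring.add R = ring.add F" "\<one>\<^bsub>R\<^esub> = \<one>\<^bsub>F\<^esub>" "\<zero>\<^bsub>R\<^esub> = \<zero>\<^bsub>F\<^esub>"
    by (simp_all add: R_def)
  have PV: "P \<subseteq> V" using M.Icarr ops by auto
  have one_notin: "\<one>\<^bsub>F\<^esub> \<notin> P" using M.one_imp_carrier M.I_notcarr ops by auto
  have "z \<in> V" if z: "z \<in> carrier F" "z \<noteq> \<zero>\<^bsub>F\<^esub>" and zP: "inv\<^bsub>F\<^esub> z \<notin> P" for z
  proof (rule ccontr)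
    assume zV: "z \<notin> V"
    define x where "x = inv\<^bsub>F\<^esub> z"
    have zU: "z \<in> Units F" using z by (simp add: F.field_Units)
    have xz: "z \<otimes>\<^bsub>F\<^esub> x = \<one>\<^bsub>F\<^esub>" unfolding x_def using zU by simp
    have xV: "x \<in> V" and xP: "x \<notin> P" using inv z zV zP by (auto simp: x_def)
    have x: "x \<in> carrier F" using xV VF by auto
    have xR: "x \<in> carrier R" using xV ops by simp
    have id: "ideal (P <+>\<^bsub>R\<^esub> PIdl\<^bsub>R\<^esub> x) R"
      by (intro R.add_ideals M.is_ideal R.cgenideal_ideal) (use xV ops in auto)
    have inP: "a \<in> P <+>\<^bsub>R\<^esub> PIdl\<^bsub>R\<^esub> x" if "a \<in> P" for a
    proof -
      have "a = a \<oplus>\<^bsub>R\<^esub> \<zero>\<^bsub>R\<^esub> \<otimes>\<^bsub>R\<^esub> x" using that M.Icarr xR by simp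
      then show ?thesis
        unfolding set_add_def' cgenideal_def using that R.zero_closed by blast
    qed
    have "x = \<zero>\<^bsub>R\<^esub> \<oplus>\<^bsub>R\<^esub> \<one>\<^bsub>R\<^esub> \<otimes>\<^bsub>R\<^esub> x" using xR by simp
    then have "x \<in> P <+>\<^bsub>R\<^esub> PIdl\<^bsub>R\<^esub> x"
      unfolding set_add_def' cgenideal_def using M.zero_closed R.one_closed by blast
    then have "P <+>\<^bsub>R\<^esub> PIdl\<^bsub>R\<^esub> x = carrier R"
      using M.I_maximal[OF id] inP xP ideal.Icarr[OF id] by blast
    then have "\<one>\<^bsub>R\<^esub> \<in> P <+>\<^bsub>R\<^esub> PIdl\<^bsub>R\<^esub> x" by simp
    then obtain p y where p: "p \<in> P" and y: "y \<in> V" and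
      eq: "\<one>\<^bsub>F\<^esub> = p \<oplus>\<^bsub>F\<^esub> y \<otimes>\<^bsub>F\<^esub> x"
      unfolding set_add_def' cgenideal_def using ops by auto
    have pF: "p \<in> carrier F" and yF: "y \<in> carrier F" using p PV VF y by auto
    define b where "b = y \<otimes>\<^bsub>F\<^esub> x"
    have b: "b \<in> carrier F" using yF x by (simp add: b_def)
    have bz: "b \<otimes>\<^bsub>F\<^esub> z = y"
      using xz yF x z(1) by (simp add: b_def F.m_assoc F.m_comm[of x z])
    have b0: "b \<noteq> \<zero>\<^bsub>F\<^esub>" using eq one_notin p pF by (auto simp: b_def[symmetric])
    have p0: "p \<noteq> \<zero>\<^bsub>F\<^esub>"
    proof
      assume "p = \<zero>\<^bsub>F\<^esub>"
      then have "b = \<one>\<^bsub>F\<^esub>" using eq b by (simp add: b_def)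
      then have "y = z" using bz z by simp
      then show False using y zV by simp
    qed
    have pU: "p \<in> Units F" and bU: "b \<in> Units F" using p0 b0 pF b by (auto simp: F.field_Units)
    define w where "w = p \<otimes>\<^bsub>F\<^esub> inv\<^bsub>F\<^esub> b"
    have wU: "w \<in> Units F" unfolding w_def using pU bU by (intro F.Units_m_closed) auto
    have wF: "w \<in> carrier F" and iwF: "inv\<^bsub>F\<^esub> w \<in> carrier F" using wU by auto
    have wb: "w \<otimes>\<^bsub>F\<^esub> b = p" unfolding w_def using bU pF b by (simp add: F.m_assoc)
    have wp: "inv\<^bsub>F\<^esub> w \<otimes>\<^bsub>F\<^esub> p = b"
      using wb[symmetric] wU wF iwF b by (simp add: F.m_assoc[symmetric])
    have "w \<noteq> \<zero>\<^bsub>F\<^esub>" using wU F.field_Units by auto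
    then consider "w \<in> V" | "inv\<^bsub>F\<^esub> w \<in> V" using inv wF by blast
    then show False
    proof cases
      case 1
      have "z = (p \<oplus>\<^bsub>F\<^esub> b) \<otimes>\<^bsub>F\<^esub> z" using z by (simp add: eq[symmetric] b_def)
      also have "\<dots> = w \<otimes>\<^bsub>F\<^esub> (b \<otimes>\<^bsub>F\<^esub> z) \<oplus>\<^bsub>F\<^esub> b \<otimes>\<^bsub>F\<^esub> z"
        using wF b z pF by (simp add: wb[symmetric] F.l_distr F.m_assoc)
      also have "\<dots> = w \<otimes>\<^bsub>F\<^esub> y \<oplus>\<^bsub>F\<^esub> y" by (simp add: bz)
      also have "\<dots> \<in> V" using R.a_closed[of "w \<otimes>\<^bsub>F\<^esub> y" y] R.m_closed[of w y] 1 y ops by simp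
      finally show False using zV by simp
    next
      case 2
      have "\<one>\<^bsub>F\<^esub> = p \<oplus>\<^bsub>F\<^esub> inv\<^bsub>F\<^esub> w \<otimes>\<^bsub>F\<^esub> p" using eq wp by (simp add: b_def)
      moreover have "inv\<^bsub>F\<^esub> w \<otimes>\<^bsub>F\<^esub> p \<in> P" using M.I_l_closed[OF p, of "inv\<^bsub>F\<^esub> w"] 2 ops by simp
      ultimately show False using one_notin M.a_closed[OF p, of "inv\<^bsub>F\<^esub> w \<otimes>\<^bsub>F\<^esub> p"] ops by simp
    qed
  qed
  moreover have "inv\<^bsub>F\<^esub> z \<notin> P" if "z \<in> V" "z \<noteq> \<zero>\<^bsub>F\<^esub>" for z
  proof
    assume "inv\<^bsub>F\<^esub> z \<in> P"
    moreover have "z \<in> Units F" using that VF by (auto simp: F.field_Units)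
    ultimately show False
      using M.I_l_closed[of "inv\<^bsub>F\<^esub> z" z] that one_notin ops by simp
  qed
  moreover have "\<zero>\<^bsub>F\<^esub> \<in> V" using R.zero_closed ops by simp
  ultimately have "{z \<in> carrier F. z = \<zero>\<^bsub>F\<^esub> \<or> inv\<^bsub>F\<^esub> z \<notin> P} = V" using VF by auto
  then show ?thesis by (simp add: place_ring_def)
qed

text \<open>
  Evaluation at a family of places \<open>P\<^sub>i\<^sub>,\<^sub>j\<close> indexed by a set \<open>I\<close> of pairs, with values in the
  product of the residue fields, and the componentwise product of \<open>k\<close> elements of that product.
\<close>

definition ev_family ::
  "('a, 'b) ring_scheme \<Rightarrow> (nat \<times> nat) set \<Rightarrow> (nat \<Rightarrow> nat \<Rightarrow> 'a set) \<Rightarrow> 'a \<Rightarrow> nat \<times> nat \<Rightarrow> 'a set"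
  where
  "ev_family F I P f = (\<lambda>(i, j) \<in> I. ev F (P i j) f)"

definition hadamard ::
  "('a, 'b) ring_scheme \<Rightarrow> (nat \<times> nat) set \<Rightarrow> (nat \<Rightarrow> nat \<Rightarrow> 'a set) \<Rightarrow> nat \<Rightarrow>
     (nat \<Rightarrow> nat \<times> nat \<Rightarrow> 'a set) \<Rightarrow> nat \<times> nat \<Rightarrow> 'a set" where
  "hadamard F I P k u =
     (\<lambda>(i, j) \<in> I. finprod (residue_field F (P i j)) (\<lambda>l. u l (i, j)) {1..k})"


section \<open>Complexity of \<open>k\<close>-fold multiplication in a field extension\<close>

definition linear_form :: "('a, 'b) ring_scheme \<Rightarrow> 'a set \<Rightarrow> ('a \<Rightarrow> 'a) \<Rightarrow> bool" where
  "linear_form L K a \<longleftrightarrow> a \<in> carrier L \<rightarrow> K \<and>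
     (\<forall>x \<in> carrier L. \<forall>y \<in> carrier L. a (x \<oplus>\<^bsub>L\<^esub> y) = a x \<oplus>\<^bsub>L\<^esub> a y) \<and>
     (\<forall>c \<in> K. \<forall>x \<in> carrier L. a (c \<otimes>\<^bsub>L\<^esub> x) = c \<otimes>\<^bsub>L\<^esub> a x)"

definition tensor_decomposition ::
  "('a, 'b) ring_scheme \<Rightarrow> 'a set \<Rightarrow> nat \<Rightarrow> nat \<Rightarrow> bool" where
  "tensor_decomposition L K k s \<longleftrightarrow> (\<exists>a c.
     (\<forall>i \<in> {1..s}. \<forall>j \<in> {1..k}. linear_form L K (a i j)) \<and> (\<forall>i \<in> {1..s}. c i \<in> carrier L) \<and>
     (\<forall>x \<in> {1..k} \<rightarrow> carrier L.
        finprod L x {1..k} =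
        finsum L (\<lambda>i. finprod L (\<lambda>j. a i j (x j)) {1..k} \<otimes>\<^bsub>L\<^esub> c i) {1..s}))"

text \<open>
  Bilinear algorithms. A value computed from the inputs \<open>x\<^sub>1, \<dots>, x\<^sub>k \<in> L\<close> is a pair \<open>(S, u)\<close>: \<open>u\<close> is
  a \<open>K\<close>-valued function of the inputs that is multilinear in the \<open>x\<^sub>j\<close> with \<open>j \<in> S\<close> and independent
  of the others. \<open>K\<close>-linear operations are free (\<open>free_values\<close>). A bilinear multiplication
  multiplies two values that depend on disjoint sets of inputs. For \<open>k = 2\<close> the products are
  exactly those of the form \<open>a(x\<^sub>1) b(x\<^sub>2)\<close> (up to order) with linear forms \<open>a\<close>, \<open>b\<close>.
\<close>

inductive_set free_values ::
  "('a, 'b) ring_scheme \<Rightarrow> 'a set \<Rightarrow> nat \<Rightarrow> (nat set \<times> ((nat \<Rightarrow> 'a) \<Rightarrow> 'a)) list \<Rightarrow>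
     (nat set \<times> ((nat \<Rightarrow> 'a) \<Rightarrow> 'a)) set"
  for L K k ps where
  input: "j \<in> {1..k} \<Longrightarrow> linear_form L K a \<Longrightarrow> ({j}, \<lambda>x. a (x j)) \<in> free_values L K k ps"
| product: "(S, u) \<in> set ps \<Longrightarrow> (S, u) \<in> free_values L K k ps"
| add: "(S, u) \<in> free_values L K k ps \<Longrightarrow> (S, v) \<in> free_values L K k ps \<Longrightarrow>
     (S, \<lambda>x. u x \<oplus>\<^bsub>L\<^esub> v x) \<in> free_values L K k ps"
| smult: "c \<in> K \<Longrightarrow> (S, u) \<in> free_values L K k ps \<Longrightarrow>
     (S, \<lambda>x. c \<otimes>\<^bsub>L\<^esub> u x) \<in> free_values L K k ps"

text \<open>The list collects the results of the multiplications, the latest one first.\<close>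

inductive bilinear_program ::
  "('a, 'b) ring_scheme \<Rightarrow> 'a set \<Rightarrow> nat \<Rightarrow> (nat set \<times> ((nat \<Rightarrow> 'a) \<Rightarrow> 'a)) list \<Rightarrow> bool"
  for L K k where
  start: "bilinear_program L K k []"
| multiply: "bilinear_program L K k ps \<Longrightarrow>
     (S, u) \<in> free_values L K k ps \<Longrightarrow> (T, v) \<in> free_values L K k ps \<Longrightarrow> S \<inter> T = {} \<Longrightarrow>
     bilinear_program L K k ((S \<union> T, \<lambda>x. u x \<otimes>\<^bsub>L\<^esub> v x) # ps)"

text \<open>
  The product is obtained from \<open>s\<close> multiplications if it is a fixed \<open>L\<close>-linear combination of the
  full multilinear results, that is, if its coordinates in a \<open>K\<close>-basis of \<open>L\<close> are \<open>K\<close>-linear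
  combinations of them.
\<close>

definition bilinear_computable ::
  "('a, 'b) ring_scheme \<Rightarrow> 'a set \<Rightarrow> nat \<Rightarrow> nat \<Rightarrow> bool" where
  "bilinear_computable L K k s \<longleftrightarrow> (\<exists>ps c.
     bilinear_program L K k ps \<and> length ps = s \<and> (\<forall>t < s. c t \<in> carrier L) \<and>
     (\<forall>x \<in> {1..k} \<rightarrow> carrier L.
        finprod L x {1..k} =
        finsum L (\<lambda>t. snd (ps ! t) x \<otimes>\<^bsub>L\<^esub> c t) {t. t < s \<and> fst (ps ! t) = {1..k}}))"

text \<open>
  A fixed field with \<open>m\<close> elements (\<open>m\<close> a prime power). Its subfield with \<open>q\<close> elements, when
  \<open>m = q\<^sup>n\<close>, consists of the roots of \<open>X\<^sup>q - X\<close>. Finite fields being unique up to isomorphism,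
  \<open>mu\<close> and \<open>nu\<close> below do not depend on this choice.
\<close>

definition GF :: "nat \<Rightarrow> nat ring" where
  "GF m = (SOME L. field L \<and> card (carrier L) = m)"

definition GF_sub :: "nat \<Rightarrow> nat \<Rightarrow> nat set" where
  "GF_sub q n = {x \<in> carrier (GF (q ^ n)). x [^]\<^bsub>GF (q ^ n)\<^esub> q = x}"

definition mu :: "nat \<Rightarrow> nat \<Rightarrow> nat \<Rightarrow> nat" where
  "mu q k n = (LEAST s. tensor_decomposition (GF (q ^ n)) (GF_sub q n) k s)"

definition nu :: "nat \<Rightarrow> nat \<Rightarrow> nat \<Rightarrow> nat" where
  "nu q k n = (LEAST s. bilinear_computable (GF (q ^ n)) (GF_sub q n) k s)"

end

theory Submission
  imports Defs "HOL-Computational_Algebra.Polynomial"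
begin

text \<open>
  Evaluation at a place is a ring homomorphism, and \<open>L(D) \<cdot> L(E) \<subseteq> L(D + E)\<close>; hence, for preimages
  \<open>f\<^sub>l \<in> L(D)\<close> of the \<open>x\<^sub>l\<close>, the product of the \<open>f\<^sub>l\<close> lies in \<open>L(kD)\<close>, takes the value \<open>x\<^sub>1 \<cdots> x\<^sub>k\<close> at
  \<open>Q\<close>, and is determined by its values at the \<open>P\<^sub>i\<^sub>,\<^sub>j\<close>, which are the products of the values of the
  \<open>f\<^sub>l\<close>. All of this rests on places being discrete valuations: for a suitable \<open>x \<in> P\<close> the field
  \<open>F\<close> is finite over \<open>K(x)\<close>, and elements of decreasing value between \<open>x\<close> and \<open>1\<close> are independent
  over \<open>K(x)\<close>.

  For the complexity bounds, choose the preimages through a \<open>K\<close>-linear section. The products in the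
  residue fields of the \<open>P\<^sub>i\<^sub>,\<^sub>j\<close> are then computed by the given decompositions from \<open>K\<close>-valued
  (multi)linear functions of the inputs, and these functions determine \<open>x\<^sub>1 \<cdots> x\<^sub>k\<close> through a linear
  relation, which extends to a linear map. Residue fields are identified with the fields \<open>GF\<close> by the
  uniqueness of finite fields.
\<close>

section \<open>Subfields of finite index\<close>

text \<open>\<open>valuation\<close> is a definite description over the generators of
  \<open>P\<close>, and \<open>places\<close> speaks only of valuation rings. Hence no closure
  property of \<open>riemann_roch_space\<close> can be proved before \<open>P\<close> is known to be
  principal, with every nonzero element a power of a generator times a unit. The second obstacle is
  that evaluation at the chosen places need not be onto, so its inverse is only partial. Everything
  is therefore expressed by coefficient vectors in \<open>K^T\<close>: a vector whose combination is
  the tuple of values of some \<open>f\<close> in \<open>L(kD)\<close> is related to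
  \<open>f(Q)\<close>. Injectivity makes this relation single valued, and a linear map on a subspace
  of \<open>K^T\<close> extends to \<open>K^T\<close>; its values at the unit vectors are the
  constants of the final formula. Both bounds use this extension, with \<open>T\<close> numbering
  the summands of the decompositions or the multiplications of a program. The factor
  \<open>k - 1\<close> arises because at each place the first factor is available for free and every
  later one costs one round of multiplications: the forms that a round applies to a partial product
  are \<open>K\<close>-combinations of results already obtained.\<close>

context field
begin

section \<open>Arithmetic of nonzero elements and integer powers\<close>

lemma nonzero_inv:
  assumes "x \<in> carrier R" "x \<noteq> \<zero>"
  shows "inv x \<in> carrier R" "inv x \<noteq> \<zero>" "x \<otimes> inv x = \<one>" "inv x \<otimes> x = \<one>" "inv (inv x) = x"
proof -
  have U: "x \<in> Units R" using assms by (simp add: field_Units)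
  show "inv x \<in> carrier R" "x \<otimes> inv x = \<one>" "inv x \<otimes> x = \<one>" "inv (inv x) = x"
    using U by simp_all
  show "inv x \<noteq> \<zero>" using Units_inv_Units[OF U] by (simp add: field_Units)
qed

lemma nonzero_mult:
  assumes "x \<in> carrier R" "x \<noteq> \<zero>" "y \<in> carrier R" "y \<noteq> \<zero>"
  shows "x \<otimes> y \<noteq> \<zero>"
  using assms integral by blast

lemma nonzero_inv_mult:
  assumes "x \<in> carrier R" "x \<noteq> \<zero>" "y \<in> carrier R" "y \<noteq> \<zero>"
  shows "inv (x \<otimes> y) = inv x \<otimes> inv y"
proof (rule comm_inv_char)
  have "x \<otimes> y \<otimes> (inv x \<otimes> inv y) = (x \<otimes> inv x) \<otimes> (y \<otimes> inv y)"
    using assms nonzero_inv(1) by (simp add: m_ac)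
  then show "x \<otimes> y \<otimes> (inv x \<otimes> inv y) = \<one>" using assms nonzero_inv(3) by simp
qed (use assms nonzero_inv(1) in auto)

lemma nonzero_cancel:
  assumes "x \<in> carrier R" "x \<noteq> \<zero>" "a \<in> carrier R"
  shows "x \<otimes> (inv x \<otimes> a) = a" "inv x \<otimes> (x \<otimes> a) = a"
  using assms by (simp_all add: m_assoc[symmetric] nonzero_inv)

text \<open>Multiplication on the whole field is only a monoid; the laws for negative exponents come
  from the multiplicative group, and this equality carries them back to the field.\<close>

lemma int_pow_eq:
  assumes "x \<in> carrier R" "x \<noteq> \<zero>"
  shows "x [^]\<^bsub>Multiplicative_Group.mult_of R\<^esub> (m::int) = x [^] m"
proof -
  interpret M: group "Multiplicative_Group.mult_of R" by (rule field_mult_group)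
  have n: "x [^]\<^bsub>Multiplicative_Group.mult_of R\<^esub> k = x [^] k" for k :: nat
    by (simp add: Multiplicative_Group.nat_pow_mult_of)
  have "x [^]\<^bsub>Multiplicative_Group.mult_of R\<^esub> k \<in> carrier (Multiplicative_Group.mult_of R)" for k :: nat
    using assms by (intro M.nat_pow_closed) auto
  then have "inv\<^bsub>Multiplicative_Group.mult_of R\<^esub> (x [^] k) = inv (x [^] k)" for k :: nat
    unfolding n by (rule m_inv_mult_of)
  then show ?thesis unfolding int_pow_def2 n by presburger
qed

lemma int_pow_props:
  assumes "x \<in> carrier R" "x \<noteq> \<zero>"
  shows "x [^] (m::int) \<in> carrier R" "x [^] m \<noteq> \<zero>"
    "x [^] (m + n :: int) = x [^] m \<otimes> x [^] n"
    "x [^] (- m) = inv (x [^] m)" "x [^] (1::int) = x"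
proof -
  interpret M: group "Multiplicative_Group.mult_of R" by (rule field_mult_group)
  have x: "x \<in> carrier (Multiplicative_Group.mult_of R)" using assms by simp
  note eq = int_pow_eq[OF assms, symmetric]
  have c: "x [^] m \<in> carrier (Multiplicative_Group.mult_of R)" for m :: int
    unfolding eq using M.int_pow_closed[OF x] .
  show "x [^] m \<in> carrier R" "x [^] m \<noteq> \<zero>" using c[of m] by auto
  show "x [^] (m + n) = x [^] m \<otimes> x [^] n" unfolding eq using M.int_pow_mult[OF x] by simp
  show "x [^] (- m) = inv (x [^] m)"
    unfolding eq using M.int_pow_neg[OF x] m_inv_mult_of M.int_pow_closed[OF x] by simp
  show "x [^] (1::int) = x" unfolding eq using M.int_pow_1[OF x] .
qed

lemma int_pow_distrib:
  assumes "x \<in> carrier R" "x \<noteq> \<zero>" "y \<in> carrier R" "y \<noteq> \<zero>"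
  shows "(x \<otimes> y) [^] (m::int) = x [^] m \<otimes> y [^] m"
proof -
  interpret M: group "Multiplicative_Group.mult_of R" by (rule field_mult_group)
  interpret M: comm_group "Multiplicative_Group.mult_of R"
    by (rule M.group_comm_groupI) (auto simp: m_comm)
  show ?thesis
    using M.int_pow_mult_distrib[of x y m] assms m_comm
    by (simp add: int_pow_eq[symmetric] nonzero_mult)
qed

text \<open>Fractions are stable under every rule that generates the field. \<open>S\<close> is any
  subring around \<open>H\<close>, so that with \<open>S = K[x]\<close> each element of
  \<open>K(x)\<close> becomes a quotient of two elements accessible to Horner induction.\<close>

lemma fraction_closure:
  assumes S: "subring S R" and z: "z \<in> generate_field R H" and H: "H \<subseteq> S"
  shows "\<exists>p\<in>S. \<exists>q\<in>S. q \<noteq> \<zero> \<and> z = p \<otimes> inv q"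
  using z
proof induction
  have SR: "S \<subseteq> carrier R" by (rule subringE(1)[OF S])
  note SE = subringE[OF S]
  {
    case one
    show ?case using SE(3) by (intro bexI[of _ \<one>]) auto
  next
    case (incl h)
    then show ?case using SE(3) H SR by (intro bexI[of _ h] bexI[of _ \<one>]) auto
  next
    case (a_inv h)
    then obtain p q where "p \<in> S" "q \<in> S" "q \<noteq> \<zero>" "h = p \<otimes> inv q" by blast
    then show ?case using SE(5) SR nonzero_inv(1)
      by (intro bexI[of _ "\<ominus> p"] bexI[of _ q]) (auto simp: l_minus subset_iff)
  next
    case (m_inv h)
    then obtain p q where h: "p \<in> S" "q \<in> S" "q \<noteq> \<zero>" "h = p \<otimes> inv q" by blast
    then have c: "p \<in> carrier R" "q \<in> carrier R" "inv q \<in> carrier R" "inv q \<noteq> \<zero>"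
      using SR nonzero_inv by auto
    have "p \<noteq> \<zero>" using h m_inv c by auto
    moreover have "inv h = q \<otimes> inv p"
      using c h \<open>p \<noteq> \<zero>\<close> by (simp add: nonzero_inv_mult nonzero_inv m_comm)
    ultimately show ?case using h by blast
  next
    case (eng_add h h')
    then obtain p q p' q' where h: "p \<in> S" "q \<in> S" "q \<noteq> \<zero>" "h = p \<otimes> inv q"
      "p' \<in> S" "q' \<in> S" "q' \<noteq> \<zero>" "h' = p' \<otimes> inv q'" by blast
    then have c: "p \<in> carrier R" "q \<in> carrier R" "inv q \<in> carrier R"
        "p' \<in> carrier R" "q' \<in> carrier R" "inv q' \<in> carrier R"
      using SR nonzero_inv by auto
    have "(p \<otimes> q' \<oplus> p' \<otimes> q) \<otimes> inv (q \<otimes> q') =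
        (p \<otimes> inv q) \<otimes> (q' \<otimes> inv q') \<oplus> (p' \<otimes> inv q') \<otimes> (q \<otimes> inv q)"
      using c h by (simp add: nonzero_inv_mult l_distr r_distr m_ac)
    also have "\<dots> = h \<oplus> h'" using c h by (simp add: nonzero_inv)
    finally show ?case
      using h c SE(6,7) by (intro bexI[of _ "p \<otimes> q' \<oplus> p' \<otimes> q"] bexI[of _ "q \<otimes> q'"]) (auto simp: nonzero_mult)
  next
    case (eng_mult h h')
    then obtain p q p' q' where h: "p \<in> S" "q \<in> S" "q \<noteq> \<zero>" "h = p \<otimes> inv q"
      "p' \<in> S" "q' \<in> S" "q' \<noteq> \<zero>" "h' = p' \<otimes> inv q'" by blast
    then have c: "p \<in> carrier R" "q \<in> carrier R" "inv q \<in> carrier R"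
        "p' \<in> carrier R" "q' \<in> carrier R" "inv q' \<in> carrier R"
      using SR nonzero_inv by auto
    have "(p \<otimes> p') \<otimes> inv (q \<otimes> q') = h \<otimes> h'"
      using c h by (simp add: nonzero_inv_mult m_ac)
    then show ?case
      using h c SE(6) by (intro bexI[of _ "p \<otimes> p'"] bexI[of _ "q \<otimes> q'"]) (auto simp: nonzero_mult)
  }
qed

text \<open>\<open>y\<close> is a root of \<open>f(Y) - x\<close> whenever \<open>x = f(y)\<close>.\<close>

lemma algebraic_over_polynomial_value:
  assumes K: "subfield K R" and y: "y \<in> carrier R"
    and x: "x \<in> simple_extension K y" "x \<notin> K"
    and E: "subfield E R" "K \<subseteq> E" "x \<in> E"
  shows "(algebraic over E) y"
proof -
  have KR: "K \<subseteq> carrier R" and ER: "E \<subseteq> carrier R" using subfieldE(3) K E by auto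
  obtain f where f: "f \<in> carrier (K[X])" "x = eval f y"
    using x(1) simple_extension_as_eval_img[OF KR y] by auto
  have pf: "polynomial K f" using f(1) by (simp add: univ_poly_carrier)
  have fK: "set f \<subseteq> K" using pf by (rule polynomial_incl)
  have "f \<noteq> []" using f x(2) subringE(2)[OF subfieldE(1)[OF K]] by auto
  then obtain a p where ap: "f = a # p" by (cases f) auto
  \<comment> \<open>With the leading coefficient alone, \<open>x\<close> would be a constant. Since
    the two ends of the list differ, subtracting \<open>x\<close> from the last entry leaves the
    leading coefficient nonzero.\<close>
  have "p \<noteq> []" using x(2) f ap fK KR by auto
  then obtain p' c where p: "p = p' @ [c]" by (cases p rule: rev_cases) auto
  have a: "a \<in> K" "a \<noteq> \<zero>" using pf ap by (auto simp: polynomial_def)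
  have xR: "x \<in> carrier R" using ER E(3) by (rule subsetD)
  have c: "c \<in> carrier R" and p'R: "set (a # p') \<subseteq> carrier R" using fK ap p KR by auto
  have cx: "c \<ominus> x \<in> E"
    using fK ap p E subringE(5,7)[OF subfieldE(1)[OF E(1)]] by (auto simp: a_minus_def subset_iff)
  define g where "g = (a # p') @ [c \<ominus> x]"
  have "polynomial E g" using fK ap p E a cx by (auto simp: g_def polynomial_def)
  then have gE: "g \<in> carrier (E[X])" by (simp add: univ_poly_carrier)
  have e: "eval (a # p') y \<in> carrier R" using p'R y by (rule eval_in_carrier)
  have "eval g y = eval (a # p') y \<otimes> y \<oplus> (c \<ominus> x)"
    unfolding g_def using eval_append_aux[OF p'R _ y] c xR by simp
  also have "\<dots> = (eval (a # p') y \<otimes> y \<oplus> c) \<ominus> x"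
    using e y c xR by (simp add: a_minus_def a_assoc)
  also have "eval (a # p') y \<otimes> y \<oplus> c = x"
    using eval_append_aux[OF p'R c y] f(2) ap p by simp
  finally have "eval g y = \<zero>" using xR by (simp add: r_neg a_minus_def)
  then show ?thesis using algebraicI[OF gE] by (simp add: g_def)
qed

text \<open>Adjoining an algebraic element as a ring already yields a field, so \<open>E[x]\<close>
  contains the field generated by \<open>K\<close> and \<open>x\<close>.\<close>

lemma generate_field_subset_simple_extension:
  assumes K: "subfield K R" and x: "x \<in> carrier R"
    and E: "subfield E R" "K \<subseteq> E" and alg: "(algebraic over E) x"
  shows "generate_field R (insert x K) \<subseteq> simple_extension E x"
proof (rule generate_field_min_subfield1)
  show "insert x K \<subseteq> carrier R" using x subfieldE(3)[OF K] by auto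
  show "subfield (simple_extension E x) R"
    using simple_extension_is_subfield[OF E(1) x] alg by simp
  show "insert x K \<subseteq> simple_extension E x"
    using simple_extension_incl[OF subfieldE(3)[OF E(1)] x] E(2)
      simple_extension_mem[OF subfieldE(1)[OF E(1)] x] by auto
qed

lemma finite_dimension_base_mono:
  assumes E: "subfield E R" "subfield E' R" "E \<subseteq> E'"
    and fin: "finite_dimension E (carrier R)"
  shows "finite_dimension E' (carrier R)"
proof -
  obtain Us where Us: "set Us \<subseteq> carrier R" "Span E Us = carrier R"
    using exists_base[OF E(1) finite_dimensionE[OF E(1) fin]] by auto
  have "carrier R \<subseteq> Span E' Us"
  proof
    fix v assume "v \<in> carrier R"
    then obtain Ks where "set Ks \<subseteq> E" "v = combine Ks Us"
      using Us Span_eq_combine_set[OF E(1) Us(1)] by auto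
    then show "v \<in> Span E' Us" using E(3) Span_eq_combine_set[OF E(2) Us(1)] by auto
  qed
  moreover have "Span E' Us \<subseteq> carrier R"
    using Span_in_carrier[OF subfieldE(3)[OF E(2)] Us(1)] .
  ultimately have "Span E' Us = carrier R" by auto
  then show ?thesis using Span_finite_dimension[OF E(2) Us(1)] by simp
qed

text \<open>Tower over \<open>E = K(x)\<close>: \<open>y\<close> is algebraic over \<open>E\<close>,
  so \<open>E[y]\<close> is a field of finite dimension over \<open>E\<close>; it contains
  \<open>K(y)\<close>, hence the whole field is finite over it.\<close>

lemma finite_dimension_over_polynomial_value:
  assumes K: "subfield K R" and y: "y \<in> carrier R"
    and x: "x \<in> simple_extension K y" "x \<notin> K"
    and fin: "finite_dimension (generate_field R (insert y K)) (carrier R)"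
  shows "finite_dimension (generate_field R (insert x K)) (carrier R)"
proof -
  have KR: "K \<subseteq> carrier R" using subfieldE(3) K by auto
  have xR: "x \<in> carrier R" using x simple_extension_in_carrier[OF KR y] by auto
  define E where "E = generate_field R (insert x K)"
  have E: "subfield E R" "K \<subseteq> E" "x \<in> E"
    unfolding E_def using KR xR by (auto intro: generate_field.incl generate_field_is_subfield)
  have alg: "(algebraic over E) y"
    by (rule algebraic_over_polynomial_value[OF K y x E])
  have E': "subfield (simple_extension E y) R"
    using simple_extension_is_subfield[OF E(1) y] alg by simp
  have "finite_dimension (simple_extension E y) (carrier R)"
    by (rule finite_dimension_base_mono[OF _ E' generate_field_subset_simple_extension[OF K y E(1,2) alg] fin])
       (rule generate_field_is_subfield, use KR y in auto)
  moreover have "finite_dimension E (simple_extension E y)"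
    using dimension_simple_extension[OF E(1) y alg] by (rule finite_dimensionI)
  ultimately show ?thesis
    using telescopic_base_dim(1)[OF E(1) E'] by (simp add: E_def)
qed

text \<open>If \<open>f\<close> is outside \<open>W\<close>, then \<open>inv f\<close> is in
  \<open>W\<close> and algebraic over \<open>E\<close>, so \<open>E[inv f]\<close> is a field; it
  lies in \<open>W\<close> and contains \<open>f\<close>. This excludes a proper valuation ring
  around such an \<open>E\<close>, and later forces the ring \<open>V[1/t]\<close> to be
  everything.\<close>

lemma algebraic_over_subring_imp_eq:
  assumes W: "subring W R" and dich: "\<And>f. f \<in> carrier R \<Longrightarrow> f \<noteq> \<zero> \<Longrightarrow> f \<in> W \<or> inv f \<in> W"
    and E: "subfield E R" "E \<subseteq> W" and fin: "finite_dimension E (carrier R)"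
  shows "W = carrier R"
proof
  show "W \<subseteq> carrier R" by (rule subringE(1)[OF W])
  show "carrier R \<subseteq> W"
  proof
    fix f assume f: "f \<in> carrier R"
    show "f \<in> W"
    proof (cases "f = \<zero> \<or> f \<in> W")
      case True
      then show ?thesis using subringE(2)[OF W] by auto
    next
      case False
      then have i: "inv f \<in> W" "inv f \<in> carrier R" "inv f \<noteq> \<zero>" "inv (inv f) = f"
        using dich[OF f] nonzero_inv[OF f] by auto
      have "(algebraic over E) (inv f)"
        using finite_dimension_imp_algebraic[OF E(1) carrier_is_subring fin i(2)] .
      then have sf: "subfield (simple_extension E (inv f)) R"
        using simple_extension_is_subfield[OF E(1) i(2)] by simp
      have "inv (inv f) \<in> simple_extension E (inv f)"
        using subfield_m_inv(1)[OF sf] simple_extension_mem[OF subfieldE(1)[OF E(1)] i(2)] i(3) by auto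
      then show ?thesis
        using simple_extension_subring_incl[OF W E(2) i(1)] i(4) by auto
    qed
  qed
qed

end

section \<open>Places are discrete valuations\<close>

locale function_field_place = field F for F :: "('a, 'b) ring_scheme" (structure) +
  fixes K V P :: "'a set"
  assumes function_field: "function_field F K" and V: "valuation_ring F K V"
    and P: "maximalideal P (F\<lparr>carrier := V\<rparr>)"
begin

lemma K: "subfield K F" using function_field by (simp add: function_field_def)

lemma V_subring: "subring V F" using V by (simp add: valuation_ring_def)

lemma K_V: "K \<subseteq> V" and V_carrier: "V \<subseteq> carrier F" and V_proper: "V \<noteq> carrier F"
  and V_dichotomy: "\<And>z. z \<in> carrier F \<Longrightarrow> z \<noteq> \<zero> \<Longrightarrow> z \<in> V \<or> inv z \<in> V"
  using V by (auto simp: valuation_ring_def)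

lemma V_in_carrier [simp]: "a \<in> V \<Longrightarrow> a \<in> carrier F" using V_carrier by auto

lemma V_closed:
  "\<zero> \<in> V" "\<one> \<in> V" "a \<in> V \<Longrightarrow> b \<in> V \<Longrightarrow> a \<oplus> b \<in> V" "a \<in> V \<Longrightarrow> b \<in> V \<Longrightarrow> a \<otimes> b \<in> V" "a \<in> V \<Longrightarrow> \<ominus> a \<in> V"
  using subringE[OF V_subring] by auto

lemma V_pow: "a \<in> V \<Longrightarrow> a [^] (n::nat) \<in> V"
  by (induction n) (auto intro: V_closed)

lemma P_props:
  "P \<subseteq> V" "\<zero> \<in> P" "\<one> \<notin> P" "a \<in> P \<Longrightarrow> b \<in> P \<Longrightarrow> a \<oplus> b \<in> P"
  "a \<in> P \<Longrightarrow> v \<in> V \<Longrightarrow> v \<otimes> a \<in> P" "a \<in> P \<Longrightarrow> v \<in> V \<Longrightarrow> a \<otimes> v \<in> P"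
  "a \<in> P \<Longrightarrow> \<ominus> a \<in> P"
proof -
  interpret M: maximalideal P "F\<lparr>carrier := V\<rparr>" by (rule P)
  show PV: "P \<subseteq> V" using M.Icarr by auto
  show "\<zero> \<in> P" using additive_subgroup.zero_closed[OF M.additive_subgroup_axioms] by simp
  show "\<one> \<notin> P" using M.one_imp_carrier M.I_notcarr by auto
  show "a \<in> P \<Longrightarrow> b \<in> P \<Longrightarrow> a \<oplus> b \<in> P" using additive_subgroup.a_closed[OF M.additive_subgroup_axioms, of a b] by simp
  show 1: "a \<in> P \<Longrightarrow> v \<in> V \<Longrightarrow> v \<otimes> a \<in> P" for a v using M.I_l_closed[of a v] by simp
  show "a \<in> P \<Longrightarrow> v \<in> V \<Longrightarrow> a \<otimes> v \<in> P" using M.I_r_closed[of a v] by simp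
  assume a: "a \<in> P"
  \<comment> \<open>Negation is multiplication by \<open>\<ominus> \<one>\<close>, which avoids the
    additive inverse of the ring with carrier \<open>V\<close>, a priori another operation.\<close>
  then have "\<ominus> \<one> \<otimes> a \<in> P" using V_closed by (intro 1) auto
  moreover have "a \<in> carrier F" using a PV V_carrier by blast
  then have "\<ominus> \<one> \<otimes> a = \<ominus> a" using l_minus[of \<one> a] l_one[of a] one_closed by metis
  ultimately show "\<ominus> a \<in> P" by metis
qed

lemma P_in_carrier [simp]: "a \<in> P \<Longrightarrow> a \<in> carrier F"
  and P_in_V [simp]: "a \<in> P \<Longrightarrow> a \<in> V"
  using P_props(1) by auto

lemma place_ring: "place_ring F P = F\<lparr>carrier := V\<rparr>"
  using place_ring_eq[OF field_axioms V P] .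

lemma V_iff: "z \<in> carrier F \<Longrightarrow> z \<noteq> \<zero> \<Longrightarrow> z \<in> V \<longleftrightarrow> inv z \<notin> P"
  using arg_cong[OF place_ring, of carrier] by (auto simp: place_ring_def set_eq_iff)

lemma unit_inv:
  assumes "u \<in> V" "u \<notin> P"
  shows "u \<noteq> \<zero>" "inv u \<in> V" "inv u \<notin> P"
proof -
  show u: "u \<noteq> \<zero>" using assms P_props(2) by auto
  have uF: "u \<in> carrier F" using assms by auto
  show "inv u \<in> V" using V_iff[of "inv u"] nonzero_inv[OF uF u] assms by simp
  show "inv u \<notin> P" using V_iff[OF uF u] assms by simp
qed

lemma unit_mult:
  assumes "u \<in> V" "u \<notin> P" "v \<in> V" "v \<notin> P"
  shows "u \<otimes> v \<in> V" "u \<otimes> v \<notin> P"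
proof -
  show "u \<otimes> v \<in> V" using assms V_closed by simp
  show "u \<otimes> v \<notin> P"
  proof
    assume "u \<otimes> v \<in> P"
    then have "inv u \<otimes> (u \<otimes> v) \<in> P" using unit_inv(2)[OF assms(1,2)] by (rule P_props(5))
    then show False using assms nonzero_cancel(2)[of u v] unit_inv(1)[OF assms(1,2)] by simp
  qed
qed

lemma unit_add:
  assumes "u \<in> V" "u \<notin> P" "p \<in> P"
  shows "u \<oplus> p \<in> V" "u \<oplus> p \<notin> P"
proof -
  show "u \<oplus> p \<in> V" using assms V_closed by simp
  show "u \<oplus> p \<notin> P"
  proof
    assume "u \<oplus> p \<in> P"
    then have "u \<oplus> p \<oplus> \<ominus> p \<in> P" using assms P_props by auto
    moreover have "u \<oplus> p \<oplus> \<ominus> p = u" using assms by (simp add: a_assoc r_neg)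
    ultimately show False using assms by simp
  qed
qed

lemma K_unit:
  assumes "c \<in> K" "c \<noteq> \<zero>"
  shows "c \<notin> P"
proof
  assume "c \<in> P"
  then have "inv c \<otimes> c \<in> P"
    using subfield_m_inv(1)[OF K, of c] assms K_V by (intro P_props(5)) auto
  then show False using P_props(3) subfield_m_inv(3)[OF K, of c] assms by simp
qed

section \<open>Elements of K(x) as powers of x times units\<close>

lemma simple_extension_in_V: "x \<in> V \<Longrightarrow> simple_extension K x \<subseteq> V"
  by (rule simple_extension_subring_incl[OF V_subring K_V])

text \<open>Take out the lowest power of \<open>x\<close>: what remains is a nonzero constant, which
  is a unit, plus an element of \<open>P\<close>. Along the Horner step \<open>k1 x + k2\<close>, a
  vanishing \<open>k2\<close> raises the exponent by one, and a nonzero \<open>k2\<close> makes the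
  exponent 0.\<close>

lemma simple_extension_form:
  assumes x: "x \<in> P" "x \<noteq> \<zero>" and p: "p \<in> simple_extension K x" "p \<noteq> \<zero>"
  shows "\<exists>a::nat. \<exists>u \<in> V - P. p = x [^] a \<otimes> u"
  using p
proof (induction rule: simple_extension.induct)
  case zero
  then show ?case by simp
next
  case (lin k1 k2)
  have k1: "k1 \<in> V" using simple_extension_in_V[of x] lin x by auto
  have k2: "k2 \<in> V" using K_V lin by auto
  show ?case
  proof (cases "k2 = \<zero>")
    case True
    then have "k1 \<noteq> \<zero>" using lin x by auto
    then obtain a u where u: "u \<in> V - P" "k1 = x [^] (a::nat) \<otimes> u" using lin by blast
    have "k1 \<otimes> x \<oplus> k2 = x [^] (Suc a) \<otimes> u" using u True x by (simp add: m_ac)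
    then show ?thesis using u(1) by blast
  next
    case False
    then have "k2 \<oplus> k1 \<otimes> x \<in> V" "k2 \<oplus> k1 \<otimes> x \<notin> P"
      using unit_add[of k2 "k1 \<otimes> x"] K_unit[of k2] lin k1 k2 x P_props by auto
    then show ?thesis using k1 k2 x by (intro exI[of _ 0] bexI[of _ "k1 \<otimes> x \<oplus> k2"]) (auto simp: a_comm)
  qed
qed

text \<open>Divide two polynomials in \<open>x\<close>, each a power of \<open>x\<close> times a
  unit. On \<open>K(x)\<close> all values are thus multiples of the value of \<open>x\<close>, and
  independence over \<open>K(x)\<close> rests on this.\<close>

lemma generate_field_form:
  assumes x: "x \<in> P" "x \<noteq> \<zero>" and z: "z \<in> generate_field F (insert x K)" "z \<noteq> \<zero>"
  shows "\<exists>m::int. \<exists>u \<in> V - P. z = x [^] m \<otimes> u"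
proof -
  let ?S = "simple_extension K x"
  have xF: "x \<in> carrier F" using x by simp
  have S: "subring ?S F" using simple_extension_is_subring[OF subfieldE(1)[OF K]] x by simp
  have "insert x K \<subseteq> ?S"
    using simple_extension_incl[OF subfieldE(3)[OF K] xF] simple_extension_mem[OF subfieldE(1)[OF K] xF]
    by simp
  then obtain p q where pq: "p \<in> ?S" "q \<in> ?S" "q \<noteq> \<zero>" "z = p \<otimes> inv q"
    using fraction_closure[OF S z(1)] by blast
  have pF: "p \<in> carrier F" "q \<in> carrier F" using subringE(1)[OF S] pq by auto
  then have "p \<noteq> \<zero>" using z pq nonzero_inv by auto
  then obtain a u b v where u: "u \<in> V - P" "p = x [^] (a::nat) \<otimes> u" and v: "v \<in> V - P" "q = x [^] (b::nat) \<otimes> v"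
    using simple_extension_form[OF x] pq by metis
  have vi: "v \<noteq> \<zero>" "inv v \<in> V" "inv v \<notin> P" using unit_inv v by auto
  have xa: "x [^] a = x [^] int a" "x [^] b = x [^] int b" by (simp_all add: int_pow_int)
  note ip = int_pow_props[OF xF x(2)]
  have "inv q = x [^] (- int b) \<otimes> inv v"
    using v vi ip(1,2,4) nonzero_inv_mult[of "x [^] int b" v] by (simp add: xa)
  then have "z = x [^] int a \<otimes> x [^] (- int b) \<otimes> (u \<otimes> inv v)"
    using pq u vi ip(1) by (simp add: xa m_ac)
  then have "z = x [^] (int a + - int b) \<otimes> (u \<otimes> inv v)" using ip(3)[of "int a" "- int b"] by simp
  moreover have "u \<otimes> inv v \<in> V - P" using unit_mult u vi by simp
  ultimately show ?thesis by blast
qed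

text \<open>Up to units, \<open>chain x Us\<close> lists elements of strictly decreasing positive value, none exceeding
  that of \<open>x\<close>; their values are distinct modulo multiples of the value of \<open>x\<close>.\<close>

definition chain :: "'a \<Rightarrow> 'a list \<Rightarrow> bool" where
  "chain x Us \<longleftrightarrow> sorted_wrt (\<lambda>a b. b \<otimes> inv a \<in> P) Us \<and>
     (\<forall>u \<in> set Us. u \<in> P \<and> u \<noteq> \<zero> \<and> x \<otimes> inv u \<in> V)"

text \<open>In terms of values, \<open>0 < v(b) - v(a) < v(x)\<close>, the upper bound because
  \<open>v(b) \<le> v(x)\<close> and \<open>v(a) > 0\<close>. Adding a multiple of
  \<open>v(x)\<close> therefore never gives 0, and one of the two quotients has positive value. For
  negative \<open>m\<close> one factor \<open>x\<close> is split off to form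
  \<open>x \<otimes> inv b\<close>.\<close>

lemma comparable:
  assumes x: "x \<in> P" "x \<noteq> \<zero>" and a: "a \<in> P" "a \<noteq> \<zero>" and b: "b \<in> P" "b \<noteq> \<zero>"
    and ab: "b \<otimes> inv a \<in> P" and xb: "x \<otimes> inv b \<in> V"
  shows "x [^] (m::int) \<otimes> (b \<otimes> inv a) \<in> P \<or> x [^] (- m) \<otimes> (a \<otimes> inv b) \<in> P"
proof (cases "m \<ge> 0")
  case True
  then have "x [^] m = x [^] (nat m)" by (metis int_nat_eq int_pow_int)
  then show ?thesis using ab V_pow[of x "nat m"] x P_props(5) by simp
next
  case False
  have xF: "x \<in> carrier F" and bF: "b \<in> carrier F" "a \<in> carrier F" using x a b by auto
  note i = nonzero_inv[OF bF(1) b(2)]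
  define n where "n = nat (- m - 1)"
  have "x [^] (- m) = x [^] (int n + 1)" using False by (simp add: n_def)
  also have "\<dots> = x [^] n \<otimes> x" using int_pow_props[OF xF x(2)] by (simp add: int_pow_int)
  finally have "x [^] (- m) \<otimes> (a \<otimes> inv b) = x [^] n \<otimes> ((x \<otimes> inv b) \<otimes> a)"
    using xF bF i by (simp add: m_ac)
  moreover have "x [^] n \<otimes> ((x \<otimes> inv b) \<otimes> a) \<in> P"
    using xb V_pow[of x n] x a by (intro P_props(5)) auto
  ultimately show ?thesis by simp
qed

text \<open>The elements whose value is congruent to that of \<open>a\<close> modulo the value of
  \<open>x\<close>, expressed without a valuation: a coset of the group generated by
  \<open>x\<close> and the units.\<close>

definition multiples :: "'a \<Rightarrow> 'a \<Rightarrow> 'a set" where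
  "multiples x a = {x [^] (m::int) \<otimes> a \<otimes> w | m w. w \<in> V - P}"

lemma comparable_multiples:
  assumes x: "x \<in> P" "x \<noteq> \<zero>" and a: "a \<in> P" "a \<noteq> \<zero>" and b: "b \<in> P" "b \<noteq> \<zero>"
    and ab: "b \<otimes> inv a \<in> P" and xb: "x \<otimes> inv b \<in> V"
    and A: "A \<in> multiples x a" and B: "B \<in> multiples x b"
  shows "B \<otimes> inv A \<in> P \<or> A \<otimes> inv B \<in> P"
proof -
  obtain m v where v: "v \<in> V - P" "A = x [^] (m::int) \<otimes> a \<otimes> v" using A by (auto simp: multiples_def)
  obtain n w where w: "w \<in> V - P" "B = x [^] (n::int) \<otimes> b \<otimes> w" using B by (auto simp: multiples_def)
  have xF: "x \<in> carrier F" using x by simp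
  note ip = int_pow_props[OF xF x(2)]
  have c: "a \<in> carrier F" "b \<in> carrier F" "v \<in> carrier F" "w \<in> carrier F" using a b v w by auto
  have nz: "v \<noteq> \<zero>" "w \<noteq> \<zero>" using v w unit_inv by auto
  have iV: "v \<otimes> inv w \<in> V" "w \<otimes> inv v \<in> V" using v w unit_inv V_closed(4) by auto
  note i = nonzero_inv[OF c(1) a(2)] nonzero_inv[OF c(2) b(2)] nonzero_inv[OF c(3) nz(1)] nonzero_inv[OF c(4) nz(2)]
  have iA: "inv A = x [^] (- m) \<otimes> inv a \<otimes> inv v"
    unfolding v(2) using c nz a ip(1,2,4) by (simp add: nonzero_inv_mult nonzero_mult)
  have iB: "inv B = x [^] (- n) \<otimes> inv b \<otimes> inv w"
    unfolding w(2) using c nz b ip(1,2,4) by (simp add: nonzero_inv_mult nonzero_mult)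
  have 1: "B \<otimes> inv A = (x [^] (n - m) \<otimes> (b \<otimes> inv a)) \<otimes> (w \<otimes> inv v)"
  proof -
    have "x [^] (n - m) = x [^] n \<otimes> x [^] (- m)" using ip(3)[of n "- m"] by simp
    then show ?thesis unfolding iA unfolding w(2) using c i ip(1) by (simp add: m_ac)
  qed
  have 2: "A \<otimes> inv B = (x [^] (- (n - m)) \<otimes> (a \<otimes> inv b)) \<otimes> (v \<otimes> inv w)"
  proof -
    have "x [^] (- (n - m)) = x [^] m \<otimes> x [^] (- n)" using ip(3)[of m "- n"] by simp
    then show ?thesis unfolding iB unfolding v(2) using c i ip(1) by (simp add: m_ac)
  qed
  show ?thesis
    using comparable[OF x a b ab xb, of "n - m"] iV unfolding 1 2 by (auto intro: P_props(6))
qed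

lemma multiples_props:
  assumes "x \<in> P" "x \<noteq> \<zero>" "a \<in> P" "a \<noteq> \<zero>" "A \<in> multiples x a"
  shows "A \<in> carrier F" "A \<noteq> \<zero>" "u \<in> V \<Longrightarrow> u \<notin> P \<Longrightarrow> A \<otimes> u \<in> multiples x a"
proof -
  obtain m v where v: "v \<in> V - P" "A = x [^] (m::int) \<otimes> a \<otimes> v" using assms by (auto simp: multiples_def)
  have c: "x \<in> carrier F" "a \<in> carrier F" "v \<in> carrier F" using assms v by auto
  note ip = int_pow_props[OF c(1) assms(2)]
  show "A \<in> carrier F" using v c ip by simp
  show "A \<noteq> \<zero>" using v c ip assms unit_inv(1)[of v] by (auto simp: nonzero_mult)
  assume u: "u \<in> V" "u \<notin> P"
  then have "v \<otimes> u \<in> V - P" using unit_mult v by auto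
  moreover have "A \<otimes> u = x [^] m \<otimes> a \<otimes> (v \<otimes> u)" using u v c ip by (simp add: m_ac)
  ultimately show "A \<otimes> u \<in> multiples x a" by (auto simp: multiples_def)
qed

text \<open>\<open>A \<oplus> B = A (\<one> \<oplus> B/A)\<close>, and \<open>\<one>\<close> plus an
  element of \<open>P\<close> is a unit: a term of larger value changes nothing up to units.\<close>

lemma add_multiples:
  assumes x: "x \<in> P" "x \<noteq> \<zero>" and a: "a \<in> P" "a \<noteq> \<zero>"
    and A: "A \<in> multiples x a" and B: "B \<in> carrier F" "B \<otimes> inv A \<in> P"
  shows "A \<oplus> B \<in> multiples x a"
proof -
  note A' = multiples_props(1,2)[OF x a A]
  have "\<one> \<oplus> B \<otimes> inv A \<in> V" "\<one> \<oplus> B \<otimes> inv A \<notin> P" using unit_add[of \<one>] V_closed P_props B by auto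
  then have "A \<otimes> (\<one> \<oplus> B \<otimes> inv A) \<in> multiples x a" using multiples_props(3)[OF x a A] by simp
  moreover have "A \<otimes> (\<one> \<oplus> B \<otimes> inv A) = A \<oplus> B \<otimes> (A \<otimes> inv A)"
    using A' B nonzero_inv(1)[OF A'] by (simp add: r_distr m_ac)
  ultimately show ?thesis using A' B nonzero_inv[OF A'] by simp
qed

text \<open>By the strict triangle inequality: the nonzero terms \<open>k u\<close> have values in
  different classes modulo that of \<open>x\<close>, so of any two the one of smaller value absorbs
  the other, and the sum stays in the class of a single \<open>u\<close>.\<close>

lemma chain_span:
  assumes x: "x \<in> P" "x \<noteq> \<zero>" and E: "E = generate_field F (insert x K)"
    and "chain x Us" "s \<in> Span E Us" "s \<noteq> \<zero>"
  shows "\<exists>u \<in> set Us. s \<in> multiples x u"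
  using assms(4-)
proof (induction Us arbitrary: s)
  case Nil
  then show ?case by simp
next
  case (Cons u Us)
  have E': "subfield E F"
    unfolding E by (rule generate_field_is_subfield) (use x subfieldE(3)[OF K] in auto)
  have ch: "chain x Us" and u: "u \<in> P" "u \<noteq> \<zero>" using Cons.prems(1) by (auto simp: chain_def)
  have UsF: "set Us \<subseteq> carrier F" using Cons.prems(1) by (auto simp: chain_def)
  obtain k s' where k: "k \<in> E" and s': "s' \<in> Span E Us" and s: "s = k \<otimes> u \<oplus> s'"
    using Cons.prems(2) line_extension_mem_iff by auto
  have s'F: "s' \<in> carrier F" using Span_in_carrier[OF subfieldE(3)[OF E'] UsF] s' by auto
  show ?case
  proof (cases "k = \<zero>")
    case True
    then have "s = s'" using s s'F u by simp
    then show ?thesis using Cons.IH[OF ch] s' Cons.prems by auto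
  next
    case False
    then obtain m w where w: "w \<in> V - P" "k = x [^] (m::int) \<otimes> w"
      using generate_field_form[OF x] k E by blast
    have xF: "x \<in> carrier F" using x by simp
    have "k \<otimes> u = x [^] m \<otimes> u \<otimes> w" using w u int_pow_props(1)[OF xF x(2)] by (simp add: m_ac)
    then have ku: "k \<otimes> u \<in> multiples x u" using w by (auto simp: multiples_def)
    note ku' = multiples_props(1)[OF x u ku]
    show ?thesis
    proof (cases "s' = \<zero>")
      case True
      then show ?thesis using ku s ku' by simp
    next
      case False
      then obtain b where b: "b \<in> set Us" "s' \<in> multiples x b" using Cons.IH[OF ch s'] by auto
      have b': "b \<in> P" "b \<noteq> \<zero>" "b \<otimes> inv u \<in> P" "x \<otimes> inv b \<in> V"
        using Cons.prems(1) b by (auto simp: chain_def)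
      from comparable_multiples[OF x u b' ku b(2)] show ?thesis
      proof
        assume "s' \<otimes> inv (k \<otimes> u) \<in> P"
        then show ?thesis using add_multiples[OF x u ku s'F] s by simp
      next
        assume "k \<otimes> u \<otimes> inv s' \<in> P"
        then have "s' \<oplus> k \<otimes> u \<in> multiples x b" using add_multiples[OF x b'(1,2) b(2) ku'] by simp
        then show ?thesis using s ku' s'F b by (auto simp: a_comm)
      qed
    qed
  qed
qed

text \<open>A dependence would put the head \<open>u\<close> into the class of a later
  \<open>b\<close> as well as into its own. Comparing \<open>u\<close> with itself as a member of
  both classes would give \<open>\<one> \<in> P\<close>.\<close>

lemma chain_independent:
  assumes x: "x \<in> P" "x \<noteq> \<zero>" and E: "E = generate_field F (insert x K)"
    and "chain x Us"
  shows "independent E Us"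
  using assms(4-)
proof (induction Us)
  case (Cons u Us)
  have ch: "chain x Us" and u: "u \<in> P" "u \<noteq> \<zero>" using Cons.prems by (auto simp: chain_def)
  have uF: "u \<in> carrier F" using u by simp
  have "u \<notin> Span E Us"
  proof
    assume "u \<in> Span E Us"
    then obtain b where b: "b \<in> set Us" "u \<in> multiples x b" using chain_span[OF x E ch _ u(2)] by blast
    have b': "b \<in> P" "b \<noteq> \<zero>" "b \<otimes> inv u \<in> P" "x \<otimes> inv b \<in> V"
      using Cons.prems b by (auto simp: chain_def)
    have "u = x [^] (0::int) \<otimes> u \<otimes> \<one>" using uF by simp
    then have "u \<in> multiples x u" unfolding multiples_def using V_closed P_props by blast
    then have "u \<otimes> inv u \<in> P" using comparable_multiples[OF x u b' _ b(2)] by blast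
    then show False using nonzero_inv[OF uF u(2)] P_props by simp
  qed
  then show ?case using Cons.IH[OF ch] uF by (intro li_Cons) auto
qed simp

text \<open>Take \<open>y \<in> V\<close> with \<open>F\<close> finite over \<open>K(y)\<close>. Some nonzero \<open>x \<in> K[y]\<close> lies in \<open>P\<close>: otherwise
  \<open>K(y) \<subseteq> V\<close>, and \<open>V\<close>, being integrally closed, would be all of \<open>F\<close>.\<close>

lemma exists_finite_base:
  "\<exists>x \<in> P. x \<noteq> \<zero> \<and> finite_dimension (generate_field F (insert x K)) (carrier F)"
proof -
  obtain y0 where y0: "y0 \<in> carrier F" "finite_dimension (generate_field F (insert y0 K)) (carrier F)"
    using function_field unfolding function_field_def by blast
  have KF: "K \<subseteq> carrier F" using subfieldE(3)[OF K] .
  \<comment> \<open>If \<open>y0\<close> is not in \<open>V\<close>, its inverse is;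
    \<open>K(y0)\<close> is contained in \<open>K(inv y0)\<close>, and enlarging the base keeps
    \<open>F\<close> finite over it.\<close>
  have "\<exists>y \<in> V. finite_dimension (generate_field F (insert y K)) (carrier F)"
  proof (cases "y0 \<in> V")
    case False
    then have nz: "y0 \<noteq> \<zero>" and y: "inv y0 \<in> V" using V_dichotomy y0 V_closed(1) by auto
    note i = nonzero_inv[OF y0(1) nz]
    have "y0 \<in> generate_field F (insert (inv y0) K)"
      using generate_field.m_inv[OF generate_field.incl, of "inv y0" "insert (inv y0) K" F] i by simp
    then have "generate_field F (insert y0 K) \<subseteq> generate_field F (insert (inv y0) K)"
      using KF i y0(1) by (intro generate_field_min_subfield1 generate_field_is_subfield) (auto intro: generate_field.incl)
    then have "finite_dimension (generate_field F (insert (inv y0) K)) (carrier F)"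
      using finite_dimension_base_mono[OF _ _ _ y0(2)] generate_field_is_subfield KF i y0(1) by auto
    then show ?thesis using y by blast
  qed (use y0 in blast)
  then obtain y where y: "y \<in> V" "finite_dimension (generate_field F (insert y K)) (carrier F)" by blast
  have yF: "y \<in> carrier F" using y by simp
  let ?S = "simple_extension K y"
  have S: "subring ?S F" using simple_extension_is_subring[OF subfieldE(1)[OF K] yF] .
  have SV: "?S \<subseteq> V" using simple_extension_in_V y by simp
  have "\<exists>x \<in> ?S. x \<in> P \<and> x \<noteq> \<zero>"
  proof (rule ccontr)
    assume no: "\<not> ?thesis"
    have KS: "insert y K \<subseteq> ?S"
      using simple_extension_incl[OF KF yF] simple_extension_mem[OF subfieldE(1)[OF K] yF] by simp
    have "generate_field F (insert y K) \<subseteq> V"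
    proof
      fix z assume "z \<in> generate_field F (insert y K)"
      then obtain p q where pq: "p \<in> ?S" "q \<in> ?S" "q \<noteq> \<zero>" "z = p \<otimes> inv q"
        using fraction_closure[OF S _ KS] by blast
      moreover from this have "q \<notin> P" "p \<in> V" "q \<in> V" using no SV by auto
      ultimately show "z \<in> V" using unit_inv[of q] V_closed by auto
    qed
    then have "V = carrier F"
      using algebraic_over_subring_imp_eq[OF V_subring V_dichotomy _ _ y(2)]
        generate_field_is_subfield KF yF by auto
    then show False using V_proper by simp
  qed
  then obtain x where x: "x \<in> ?S" "x \<in> P" "x \<noteq> \<zero>" by blast
  \<comment> \<open>A nonzero constant is a unit, so a nonzero element of \<open>P\<close> comes
    from a nonconstant polynomial in \<open>y\<close>.\<close>
  then have "x \<notin> K" using K_unit by auto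
  then show ?thesis using finite_dimension_over_polynomial_value[OF K yF x(1) _ y(2)] x by blast
qed

text \<open>A normal form for all of \<open>F\<close> rather than generation of \<open>P\<close>:
  the latter follows in \<open>P_eq_principal\<close>, and the exponent is what
  \<open>valuation\<close> has to return.\<close>

definition uniformizer :: "'a \<Rightarrow> bool" where
  "uniformizer t \<longleftrightarrow> t \<in> P \<and> t \<noteq> \<zero> \<and>
     (\<forall>z \<in> carrier F - {\<zero>}. \<exists>m::int. \<exists>u \<in> V - P. z = t [^] m \<otimes> u)"

lemma exists_maximal_nat:
  assumes "Q (0::nat)" "\<And>m. Q m \<Longrightarrow> m \<le> n"
  shows "\<exists>e. Q e \<and> \<not> Q (Suc e)"
  using assms by (metis not_less_eq_eq order_refl nat_induct)

text \<open>The head \<open>t\<close> of a longest chain generates \<open>P\<close>. If \<open>z \<noteq> 0\<close> were divisible by all powers of \<open>t\<close>, then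
  the ring \<open>W = V[1/t]\<close> contains \<open>K(x)\<close>, hence is \<open>F\<close>, so that \<open>t\<^sup>m / z \<in> V\<close> for some \<open>m\<close>.\<close>

lemma exists_uniformizer: "\<exists>t. uniformizer t"
proof -
  obtain x where x: "x \<in> P" "x \<noteq> \<zero>"
    and fin: "finite_dimension (generate_field F (insert x K)) (carrier F)"
    using exists_finite_base by blast
  have xF: "x \<in> carrier F" using x by simp
  have KF: "K \<subseteq> carrier F" using subfieldE(3)[OF K] .
  define E where "E = generate_field F (insert x K)"
  have E: "subfield E F" unfolding E_def using xF KF by (intro generate_field_is_subfield) auto
  obtain n where n: "dimension n E (carrier F)" using fin E_def by auto
  \<comment> \<open>A chain is independent over \<open>K(x)\<close>, so its length is at most the
    degree \<open>n\<close> of \<open>F\<close> over \<open>K(x)\<close>.\<close>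
  have bound: "length Us \<le> n" if "chain x Us" for Us
  proof -
    have "set Us \<subseteq> carrier F" using that by (auto simp: chain_def)
    then show ?thesis using independent_length_le_dimension[OF E n chain_independent[OF x E_def that]] by simp
  qed
  have "chain x [x]" using x nonzero_inv[OF xF x(2)] V_closed by (simp add: chain_def)
  then obtain Us where Us: "chain x Us" "Us \<noteq> []" and mx: "\<And>Vs. chain x Vs \<Longrightarrow> length Vs \<le> length Us"
    using ex_has_greatest_nat[of "chain x" "[x]" length "Suc n"] bound
    by (metis length_greater_0_conv less_Suc_eq_le list.size(3) length_Cons not_less_eq_eq zero_less_Suc le_zero_eq)
  then obtain t Ts where tTs: "Us = t # Ts" by (cases Us) auto
  have t: "t \<in> P" "t \<noteq> \<zero>" "x \<otimes> inv t \<in> V" using Us tTs by (auto simp: chain_def)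
  have tF: "t \<in> carrier F" using t by simp
  note it = nonzero_inv[OF tF t(2)] and ip = int_pow_props[OF tF t(2)]
  \<comment> \<open>Otherwise \<open>y\<close> has smaller value than the head \<open>t\<close>,
    hence than every member, and \<open>y # Us\<close> is a longer chain.\<close>
  have gen: "y \<otimes> inv t \<in> V" if y: "y \<in> P" "y \<noteq> \<zero>" for y
  proof (rule ccontr)
    assume no: "y \<otimes> inv t \<notin> V"
    have yF: "y \<in> carrier F" using y by simp
    note iy = nonzero_inv[OF yF y(2)]
    have "y \<otimes> inv t \<noteq> \<zero>" using nonzero_mult it yF y by auto
    then have "inv (y \<otimes> inv t) \<in> P" using V_iff no yF it by auto
    then have ty: "t \<otimes> inv y \<in> P" using nonzero_inv_mult[OF yF y(2) it(1,2)] it iy tF by (simp add: m_comm)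
    have "b \<otimes> inv y \<in> P" if "b \<in> set Us" for b
    proof (cases "b = t")
      case True
      then show ?thesis using ty by simp
    next
      case False
      then have "b \<otimes> inv t \<in> P" "b \<in> carrier F" using Us that tTs by (auto simp: chain_def)
      moreover from this have "b \<otimes> inv y = (b \<otimes> inv t) \<otimes> (t \<otimes> inv y)"
        using tF it iy by (simp add: m_assoc nonzero_cancel t)
      ultimately show ?thesis using ty P_props(5) by simp
    qed
    moreover have "x \<otimes> inv y \<in> V"
    proof -
      have "x \<otimes> inv y = (x \<otimes> inv t) \<otimes> (t \<otimes> inv y)" using xF tF it iy by (simp add: m_assoc nonzero_cancel t)
      then show ?thesis using t ty V_closed by simp
    qed
    ultimately have "chain x (y # Us)" using Us y by (auto simp: chain_def)
    then show False using mx by fastforce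
  qed
  have tp: "t [^] (Suc m) = t [^] m \<otimes> t" "t [^] m \<in> P \<or> m = 0" "t [^] m \<noteq> \<zero>" "t [^] m \<in> V" for m :: nat
  proof -
    show "t [^] m \<in> V" using t by (intro V_pow) simp
    show "t [^] m \<noteq> \<zero>" using ip(2)[of "int m"] by (simp add: int_pow_int)
    show "t [^] m \<in> P \<or> m = 0" using t V_pow[of t "m - 1"] P_props(5)[of t "t [^] (m - 1)"]
      by (cases m) auto
  qed simp
  have tpF: "t [^] m \<in> carrier F" for m :: nat using tF by simp
  \<comment> \<open>Divide by \<open>t\<close> as often as possible within \<open>V\<close>. The
    last quotient is not in \<open>P\<close>, for \<open>gen\<close> would allow one more
    division.\<close>
  have descend: "\<exists>e::nat. z \<otimes> inv (t [^] e) \<in> V - P"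
    if z: "z \<in> V" "z \<noteq> \<zero>" and bd: "\<And>m::nat. z \<otimes> inv (t [^] m) \<in> V \<Longrightarrow> m \<le> B" for z B
  proof -
    have "z \<otimes> inv (t [^] (0::nat)) \<in> V" using z by simp
    then obtain e :: nat where e: "z \<otimes> inv (t [^] e) \<in> V" "z \<otimes> inv (t [^] Suc e) \<notin> V"
      using exists_maximal_nat[of "\<lambda>m. z \<otimes> inv (t [^] m) \<in> V" B] bd by blast
    have ie: "inv (t [^] e) \<in> carrier F" "inv (t [^] e) \<noteq> \<zero>" using nonzero_inv tp(3)[of e] tpF[of e] by auto
    have "z \<otimes> inv (t [^] e) \<notin> P"
    proof
      assume "z \<otimes> inv (t [^] e) \<in> P"
      moreover have "z \<otimes> inv (t [^] e) \<noteq> \<zero>" using nonzero_mult z ie by simp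
      ultimately have "z \<otimes> inv (t [^] e) \<otimes> inv t \<in> V" by (rule gen)
      then show False using e z ie it tp(1)[of e] tpF[of e] tp(3)[of e] tF t by (simp add: nonzero_inv_mult m_assoc)
    qed
    then show ?thesis using e by blast
  qed
  \<comment> \<open>If \<open>t [^] m\<close> divides \<open>x\<close> in \<open>V\<close>, the
    powers of \<open>t\<close> from the first to the \<open>m\<close>-th form a chain, so
    \<open>m\<close> is at most \<open>n\<close>.\<close>
  have x_bound: "m \<le> n" if xm: "x \<otimes> inv (t [^] (m::nat)) \<in> V" for m
  proof -
    have pd: "t [^] (j::nat) \<otimes> inv (t [^] (i::nat)) = t [^] (j - i)" if "i \<le> j" for i j
    proof -
      have "t [^] j = t [^] (j - i) \<otimes> t [^] i" using nat_pow_mult[OF tF, of "j - i" i] that by simp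
      then show ?thesis using tpF nonzero_inv[OF tpF tp(3)] by (simp add: m_assoc)
    qed
    have "x \<otimes> inv (t [^] i) \<in> V" if "i \<le> m" for i :: nat
    proof -
      have "x \<otimes> inv (t [^] i) = (x \<otimes> inv (t [^] m)) \<otimes> (t [^] m \<otimes> inv (t [^] i))"
        using xF tpF nonzero_inv[OF tpF tp(3)] by (simp add: m_assoc nonzero_cancel tp)
      also have "\<dots> \<in> V" using xm that tp(4) by (simp add: pd V_closed)
      finally show ?thesis .
    qed
    moreover have "t [^] i \<in> P" if "i \<ge> Suc 0" for i :: nat using tp(2)[of i] that by auto
    moreover have "sorted_wrt (\<lambda>i j. t [^] j \<otimes> inv (t [^] i) \<in> P) [Suc 0..<Suc m]"
    proof (rule sorted_wrt_mono_rel[OF _ sorted_wrt_upt])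
      fix i j :: nat assume "i < j"
      then show "t [^] j \<otimes> inv (t [^] i) \<in> P" using pd[of i j] tp(2)[of "j - i"] by simp
    qed
    ultimately have "chain x (map (\<lambda>i. t [^] i) [Suc 0..<Suc m])"
      using tp(3) by (auto simp: chain_def sorted_wrt_map simp del: upt_Suc)
    from bound[OF this] show ?thesis by (simp del: upt_Suc)
  qed
  \<comment> \<open>So \<open>x\<close> is a power of \<open>t\<close> times a unit, which puts
    \<open>inv x\<close> into the ring \<open>W\<close> below.\<close>
  obtain e :: nat where e: "x \<otimes> inv (t [^] e) \<in> V - P" using descend[of x n] x x_bound by auto
  have inf_bound: "\<exists>m::nat. z \<otimes> inv (t [^] m) \<notin> V" if z: "z \<in> V" "z \<noteq> \<zero>" for z
  proof (rule ccontr)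
    assume "\<not> ?thesis"
    then have all: "z \<otimes> inv (t [^] m) \<in> V" for m :: nat by blast
    define W where "W = {f \<in> carrier F. \<exists>m::nat. f \<otimes> t [^] m \<in> V}"
    have WI: "f \<in> W" if "f \<in> carrier F" "f \<otimes> t [^] (m::nat) \<in> V" for f m using that by (auto simp: W_def)
    have VW: "f \<in> W" if "f \<in> V" for f using WI[of f 0] that by simp
    have W: "subring W F"
    proof (rule subringI)
      show "W \<subseteq> carrier F" by (auto simp: W_def)
      show "\<one> \<in> W" using VW V_closed by simp
      fix f assume "f \<in> W"
      then obtain m where f: "f \<in> carrier F" "f \<otimes> t [^] (m::nat) \<in> V" by (auto simp: W_def)
      then show "\<ominus> f \<in> W" using V_closed(5)[OF f(2)] tpF by (intro WI[of _ m]) (auto simp: l_minus)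
      fix g assume "g \<in> W"
      then obtain k where g: "g \<in> carrier F" "g \<otimes> t [^] (k::nat) \<in> V" by (auto simp: W_def)
      have "(f \<otimes> g) \<otimes> t [^] (m + k) = (f \<otimes> t [^] m) \<otimes> (g \<otimes> t [^] k)"
        using f g tpF by (simp add: m_ac nat_pow_mult[OF tF, symmetric])
      then show "f \<otimes> g \<in> W" using f g V_closed by (intro WI[of _ "m + k"]) auto
      have "(f \<oplus> g) \<otimes> t [^] (m + k) = (f \<otimes> t [^] m) \<otimes> t [^] k \<oplus> (g \<otimes> t [^] k) \<otimes> t [^] m"
        using f g tpF by (simp add: l_distr r_distr m_ac nat_pow_mult[OF tF, symmetric])
      then show "f \<oplus> g \<in> W" using f g tp(4) V_closed by (intro WI[of _ "m + k"]) auto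
    qed
    have ix: "inv x \<in> W"
    proof -
      note ixx = nonzero_inv[OF xF x(2)] and ite = nonzero_inv[OF tpF tp(3), of e]
      have "inv (x \<otimes> inv (t [^] e)) = inv x \<otimes> t [^] e"
        using nonzero_inv_mult[OF xF x(2) ite(1,2)] ite by simp
      then show ?thesis using unit_inv(2)[of "x \<otimes> inv (t [^] e)"] e ixx by (intro WI[of _ e]) auto
    qed
    have EW: "E \<subseteq> W"
    proof
      fix f assume f: "f \<in> E"
      show "f \<in> W"
      proof (cases "f = \<zero>")
        case True
        then show ?thesis using VW V_closed by simp
      next
        case False
        then obtain m u where u: "u \<in> V - P" "f = x [^] (m::int) \<otimes> u"
          using generate_field_form[OF x] f E_def by blast
        have "x [^] m \<in> W"
        proof (induction m rule: int_induct[where k = 0])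
          case base
          show ?case using subringE(3)[OF W] by simp
        next
          case (step1 i)
          then show ?case
            using int_pow_props(3,5)[OF xF x(2)] subringE(6)[OF W] VW[of x] x by simp
        next
          case (step2 i)
          have "x [^] (i - 1) = x [^] i \<otimes> inv x"
            using int_pow_props(3)[OF xF x(2), of i "- 1"] int_pow_props(4)[OF xF x(2), of 1]
              int_pow_props(5)[OF xF x(2)] by simp
          then show ?case using step2 ix subringE(6)[OF W] by simp
        qed
        then show ?thesis using u VW subringE(6)[OF W] by auto
      qed
    qed
    have "W = carrier F"
      using algebraic_over_subring_imp_eq[OF W _ E EW finite_dimensionI[OF n]] V_dichotomy VW by blast
    moreover have zF: "z \<in> carrier F" using z by simp
    note iz = nonzero_inv[OF zF z(2)]
    ultimately obtain m where m: "inv z \<otimes> t [^] (m::nat) \<in> V" using iz by (auto simp: W_def)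
    note itm = nonzero_inv[OF tpF tp(3), of m]
    \<comment> \<open>One more power of \<open>t\<close> than \<open>inv z\<close> needs: both
      factors lie in \<open>V\<close>, and their product is \<open>inv t\<close>.\<close>
    have "(z \<otimes> inv (t [^] Suc m)) \<otimes> (inv z \<otimes> t [^] m) = z \<otimes> inv z \<otimes> (inv (t [^] m) \<otimes> t [^] m) \<otimes> inv t"
    proof -
      have "inv (t [^] Suc m) = inv (t [^] m) \<otimes> inv t"
        using nonzero_inv_mult[OF tpF tp(3) tF t(2), of m] tp(1) by simp
      then show ?thesis using zF iz(1) itm(1) it(1) tpF[of m] by (simp add: m_ac del: nat_pow_Suc)
    qed
    also have "\<dots> = inv t" using iz itm it by simp
    finally have "inv t \<in> V" using V_closed(4)[OF all[of "Suc m"] m] by simp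
    then have "inv t \<otimes> t \<in> P" using t by (intro P_props(5))
    then show False using it P_props by simp
  qed
  have form: "\<exists>m::int. \<exists>u \<in> V - P. z = t [^] m \<otimes> u" if z: "z \<in> V" "z \<noteq> \<zero>" for z
  proof -
    obtain b where b: "z \<otimes> inv (t [^] (b::nat)) \<notin> V" using inf_bound[OF z] by blast
    have "m \<le> b" if "z \<otimes> inv (t [^] m) \<in> V" for m :: nat
    proof (rule ccontr)
      assume "\<not> m \<le> b"
      then have "t [^] m = t [^] (m - b) \<otimes> t [^] b" using nat_pow_mult[OF tF, of "m - b" b] by simp
      then have "z \<otimes> inv (t [^] b) = (z \<otimes> inv (t [^] m)) \<otimes> t [^] (m - b)"
        using z tpF nonzero_inv[OF tpF tp(3)] by (simp add: nonzero_inv_mult[OF tpF tp(3) tpF tp(3)] m_ac nonzero_cancel tp)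
      then show False using b that V_closed(4) tp(4) by simp
    qed
    then obtain e :: nat where "z \<otimes> inv (t [^] e) \<in> V - P" using descend[OF z] by blast
    moreover have "z = t [^] int e \<otimes> (z \<otimes> inv (t [^] e))"
      using z tpF nonzero_inv[OF tpF tp(3)] by (simp add: int_pow_int m_lcomm)
    ultimately show ?thesis by blast
  qed
  have "\<exists>m::int. \<exists>u \<in> V - P. z = t [^] m \<otimes> u" if z: "z \<in> carrier F" "z \<noteq> \<zero>" for z
  proof (cases "z \<in> V")
    case False
    note iz = nonzero_inv[OF z]
    have "inv z \<in> V" using False V_dichotomy[OF z] by simp
    then obtain m u where u: "u \<in> V - P" "inv z = t [^] (m::int) \<otimes> u" using form iz by blast
    have "z = inv (t [^] m \<otimes> u)" using iz u by simp
    also have "\<dots> = t [^] (- m) \<otimes> inv u"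
      using u unit_inv(1)[of u] ip(1,2,4) by (simp add: nonzero_inv_mult)
    finally show ?thesis using unit_inv[of u] u by blast
  qed (use form z in blast)
  then show ?thesis using t by (auto simp: uniformizer_def)
qed

end

section \<open>The valuation read off from a uniformizer\<close>

context function_field_place
begin

lemma Units_place_ring: "Units (place_ring F P) = V - P"
proof
  show "Units (place_ring F P) \<subseteq> V - P"
  proof
    fix u assume "u \<in> Units (place_ring F P)"
    then obtain v where uv: "u \<in> V" "v \<in> V" "v \<otimes> u = \<one>" by (auto simp: place_ring Units_def)
    then have "u \<notin> P" using P_props(5)[of u v] P_props(3) by auto
    then show "u \<in> V - P" using uv by simp
  qed
  show "V - P \<subseteq> Units (place_ring F P)"
  proof
    fix u assume u: "u \<in> V - P"
    then have "inv u \<in> V" "inv u \<otimes> u = \<one>" "u \<otimes> inv u = \<one>"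
      using unit_inv[of u] nonzero_inv[of u] by auto
    then show "u \<in> Units (place_ring F P)" using u by (auto simp: place_ring Units_def)
  qed
qed

lemma unit_int_pow:
  assumes "w \<in> V - P"
  shows "w [^] (m::int) \<in> V - P"
proof -
  have n: "w [^] (k::nat) \<in> V - P" for k
    using assms by (induction k) (auto simp: V_closed P_props unit_mult)
  have m: "x [^] m = (if m < 0 then inv (x [^] nat (- m)) else x [^] nat m)" for x by (rule int_pow_def2)
  show ?thesis unfolding m using n unit_inv by (auto simp del: pow_nat)
qed

context
  fixes t assumes t: "uniformizer t"
begin

lemma uniformizer_props: "t \<in> P" "t \<noteq> \<zero>" "t \<in> carrier F"
  using t by (auto simp: uniformizer_def)

lemmas t_pow = int_pow_props[OF uniformizer_props(3,2)]

lemma uniformizer_form: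
  assumes "z \<in> carrier F" "z \<noteq> \<zero>"
  obtains m u where "u \<in> V - P" "z = t [^] (m::int) \<otimes> u"
  using t assms unfolding uniformizer_def by blast

lemma t_pow_nonneg: "m \<ge> 0 \<Longrightarrow> t [^] (m::int) \<in> V"
proof -
  assume "m \<ge> 0"
  then have "t [^] m = t [^] nat m" by (metis int_nat_eq int_pow_int)
  then show ?thesis using V_pow[of t "nat m"] uniformizer_props by simp
qed

lemma t_pow_pos: "m > 0 \<Longrightarrow> t [^] (m::int) \<in> P"
  using t_pow(3)[of "m - 1" 1] t_pow(5) t_pow_nonneg[of "m - 1"] uniformizer_props
  by (simp add: P_props(5))

lemma t_pow_unit_in_V_iff:
  assumes u: "u \<in> V - P"
  shows "t [^] (m::int) \<otimes> u \<in> V \<longleftrightarrow> m \<ge> 0"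
proof
  assume tu: "t [^] m \<otimes> u \<in> V"
  show "m \<ge> 0"
  proof (rule ccontr)
    assume "\<not> m \<ge> 0"
    then have "t [^] (- m) \<otimes> (t [^] m \<otimes> u) \<in> P" using tu t_pow_pos by (intro P_props(6)) auto
    moreover have "t [^] (- m) \<otimes> (t [^] m \<otimes> u) = u"
      using t_pow u nonzero_cancel(2) by auto
    ultimately show False using u by simp
  qed
qed (use t_pow_nonneg u V_closed in auto)

lemma t_pow_unit_in_P_iff:
  assumes u: "u \<in> V - P"
  shows "t [^] (m::int) \<otimes> u \<in> P \<longleftrightarrow> m \<ge> 1"
proof
  assume "t [^] m \<otimes> u \<in> P"
  then have "m \<ge> 0" "m \<noteq> 0" using t_pow_unit_in_V_iff[OF u, of m] u by auto
  then show "m \<ge> 1" by simp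
qed (use t_pow_pos u P_props in auto)

text \<open>Testing all \<open>j\<close> determines the exponent \<open>m\<close> from
  \<open>z\<close> and \<open>t\<close> alone, whatever the unit.\<close>

lemma mult_t_pow_in_V_iff:
  assumes u: "u \<in> V - P" and z: "z = t [^] (m::int) \<otimes> u"
  shows "z \<otimes> t [^] (j::int) \<in> V \<longleftrightarrow> m + j \<ge> 0"
proof -
  have "z \<otimes> t [^] j = t [^] (m + j) \<otimes> u" using u z t_pow by (simp add: m_ac)
  then show ?thesis using t_pow_unit_in_V_iff[OF u] by simp
qed

lemma P_eq_principal: "P = PIdl\<^bsub>place_ring F P\<^esub> t"
proof -
  have "PIdl\<^bsub>place_ring F P\<^esub> t = {v \<otimes> t | v. v \<in> V}"
    by (auto simp: cgenideal_def place_ring)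
  also have "\<dots> = P"
  proof safe
    fix v assume "v \<in> V" then show "v \<otimes> t \<in> P" using uniformizer_props P_props by auto
  next
    fix p assume p: "p \<in> P"
    show "\<exists>v. p = v \<otimes> t \<and> v \<in> V"
    proof (cases "p = \<zero>")
      case True
      then show ?thesis using uniformizer_props V_closed by (intro exI[of _ \<zero>]) auto
    next
      case False
      then obtain m u where u: "u \<in> V - P" "p = t [^] (m::int) \<otimes> u"
        using uniformizer_form p by (metis P_in_carrier)
      then have m: "m \<ge> 1" using t_pow_unit_in_P_iff p by simp
      have "t [^] m = t [^] (m - 1) \<otimes> t" using t_pow(3)[of "m - 1" 1] t_pow(5) by simp
      then have "p = (t [^] (m - 1) \<otimes> u) \<otimes> t" using u t_pow uniformizer_props by (simp add: m_ac)
      moreover have "t [^] (m - 1) \<otimes> u \<in> V" using t_pow_unit_in_V_iff m u by simp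
      ultimately show ?thesis by blast
    qed
  qed
  finally show ?thesis by simp
qed

text \<open>Write \<open>t = v t'\<close> with both factors in normal form, of exponents
  \<open>k \<ge> 0\<close> and \<open>m \<ge> 1\<close>. Then \<open>k + m = 1\<close>, so
  \<open>m = 1\<close>.\<close>

lemma other_generator:
  assumes t': "t' \<in> P" "P = PIdl\<^bsub>place_ring F P\<^esub> t'"
  shows "\<exists>w \<in> V - P. t' = t \<otimes> w"
proof -
  have "t \<in> PIdl\<^bsub>place_ring F P\<^esub> t'" using t'(2) uniformizer_props(1) by simp
  then obtain v where v: "v \<in> V" "t = v \<otimes> t'" by (auto simp: cgenideal_def place_ring)
  have "t' \<noteq> \<zero>" using v uniformizer_props by auto
  then obtain m w where w: "w \<in> V - P" "t' = t [^] (m::int) \<otimes> w"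
    using uniformizer_form t' by (metis P_in_carrier)
  have m: "m \<ge> 1" using t_pow_unit_in_P_iff w t' by simp
  have "v \<noteq> \<zero>" using v uniformizer_props t' by auto
  then obtain k u where u: "u \<in> V - P" "v = t [^] (k::int) \<otimes> u"
    using uniformizer_form v by (metis V_in_carrier)
  have k: "k \<ge> 0" using t_pow_unit_in_V_iff[OF u(1), of k] v(1) unfolding u(2) by simp
  have eq: "t = t [^] (k + m) \<otimes> (u \<otimes> w)"
  proof -
    have "v \<otimes> t' = t [^] (k + m) \<otimes> (u \<otimes> w)"
      unfolding u(2) w(2) using u(1) w(1) t_pow(1,3) by (simp add: m_ac)
    then show ?thesis using v(2) by (rule trans[rotated])
  qed
  have uw: "u \<otimes> w \<in> V - P" using unit_mult u w by simp
  have one: "\<one> \<in> V - P" using V_closed P_props by simp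
  have eq1: "t = t [^] (1::int) \<otimes> \<one>" using t_pow(5) uniformizer_props(3) by simp
  \<comment> \<open>The shift by \<open>- 2\<close> tests whether \<open>k + m \<ge> 2\<close>; the
    test fails because \<open>t\<close> times \<open>t [^] (- 2)\<close> is not in
    \<open>V\<close>.\<close>
  have "k + m + - 2 \<ge> 0 \<longleftrightarrow> 1 + - 2 \<ge> (0::int)"
    using mult_t_pow_in_V_iff[OF uw eq, of "- 2"] mult_t_pow_in_V_iff[OF one eq1, of "- 2"] by (rule trans[OF sym])
  then have "m = 1" using m k by simp
  then show ?thesis using w t_pow(5) by auto
qed

text \<open>\<open>valuation\<close> admits any generator of \<open>P\<close>. Another one is
  \<open>t\<close> times a unit, and the power of that unit moves into the unit part, so all
  generators give the same exponent.\<close>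

lemma valuation_eq:
  assumes u: "u \<in> V - P" and z: "z = t [^] (m::int) \<otimes> u"
  shows "valuation F P z = m"
  unfolding valuation_def
proof (rule the_equality)
  show "\<exists>t \<in> P. P = PIdl\<^bsub>place_ring F P\<^esub> t \<and> (\<exists>u \<in> Units (place_ring F P). z = t [^] m \<otimes> u)"
    using uniformizer_props P_eq_principal Units_place_ring u z by auto
next
  fix m' :: int assume "\<exists>t \<in> P. P = PIdl\<^bsub>place_ring F P\<^esub> t \<and> (\<exists>u \<in> Units (place_ring F P). z = t [^] m' \<otimes> u)"
  then obtain t' u' where t': "t' \<in> P" "P = PIdl\<^bsub>place_ring F P\<^esub> t'" and u': "u' \<in> V - P" "z = t' [^] m' \<otimes> u'"
    using Units_place_ring by auto
  obtain w where w: "w \<in> V - P" "t' = t \<otimes> w" using other_generator[OF t'] by blast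
  have wc: "w \<in> carrier F" "w \<noteq> \<zero>" using w unit_inv by auto
  have wm: "w [^] m' \<in> V - P" using unit_int_pow[OF w(1)] .
  have "z = t [^] m' \<otimes> (w [^] m' \<otimes> u')"
    using u' w wc wm t_pow uniformizer_props int_pow_distrib[of t w m'] by (simp add: m_assoc)
  moreover have "w [^] m' \<otimes> u' \<in> V - P" using unit_mult wm u' by auto
  ultimately have "z \<otimes> t [^] (j::int) \<in> V \<longleftrightarrow> m' + j \<ge> 0" for j
    using mult_t_pow_in_V_iff by blast
  moreover have "z \<otimes> t [^] (j::int) \<in> V \<longleftrightarrow> m + j \<ge> 0" for j
    using mult_t_pow_in_V_iff[OF u z] .
  ultimately have "m' + j \<ge> 0 \<longleftrightarrow> m + j \<ge> 0" for j by blast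
  from this[of "- m"] this[of "- m'"] show "m' = m" by simp
qed

text \<open>Pole bounds become membership in \<open>V\<close>, so their stability under sums and
  products is that of a ring, without comparing values.\<close>

lemma valuation_ge_iff:
  assumes "f \<in> carrier F"
  shows "f = \<zero> \<or> valuation F P f \<ge> - m \<longleftrightarrow> f \<otimes> t [^] m \<in> V"
proof (cases "f = \<zero>")
  case True
  then show ?thesis using t_pow V_closed by simp
next
  case False
  then obtain v u where u: "u \<in> V - P" "f = t [^] (v::int) \<otimes> u" using uniformizer_form assms by blast
  then show ?thesis using valuation_eq[OF u] mult_t_pow_in_V_iff[OF u, of m] False by auto
qed

end

abbreviation bounded_pole :: "int \<Rightarrow> 'a \<Rightarrow> bool" where
  "bounded_pole m f \<equiv> f = \<zero> \<or> valuation F P f \<ge> - m"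

lemma bounded_pole_add:
  assumes "f \<in> carrier F" "g \<in> carrier F" "bounded_pole m f" "bounded_pole m g"
  shows "bounded_pole m (f \<oplus> g)"
proof -
  obtain t where t: "uniformizer t" using exists_uniformizer by blast
  note iff = valuation_ge_iff[OF t] and tp = t_pow[OF t]
  show ?thesis
    using assms V_closed(3)[of "f \<otimes> t [^] m" "g \<otimes> t [^] m"] tp by (simp add: iff l_distr)
qed

lemma bounded_pole_mult:
  assumes "f \<in> carrier F" "g \<in> carrier F" "bounded_pole m f" "bounded_pole l g"
  shows "bounded_pole (m + l) (f \<otimes> g)"
proof -
  obtain t where t: "uniformizer t" using exists_uniformizer by blast
  note iff = valuation_ge_iff[OF t] and tp = t_pow[OF t]
  have "f \<otimes> g \<otimes> t [^] (m + l) = (f \<otimes> t [^] m) \<otimes> (g \<otimes> t [^] l)"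
    using assms tp by (simp add: m_ac)
  moreover have "f \<otimes> t [^] m \<in> V" "g \<otimes> t [^] l \<in> V" using assms iff by blast+
  ultimately have "f \<otimes> g \<otimes> t [^] (m + l) \<in> V" using V_closed(4) by simp
  then show ?thesis using iff[of "f \<otimes> g" "m + l"] assms by simp
qed

lemma bounded_pole_0_iff:
  assumes "f \<in> carrier F"
  shows "bounded_pole 0 f \<longleftrightarrow> f \<in> V"
proof -
  obtain t where t: "uniformizer t" using exists_uniformizer by blast
  show ?thesis using valuation_ge_iff[OF t assms, of 0] assms by simp
qed

end

section \<open>Riemann-Roch spaces under sums and products\<close>

lemma place_obtain:
  assumes "function_field F K" "P \<in> places F K"
  obtains V where "function_field_place F K V P"
proof -
  obtain V where "valuation_ring F K V" "maximalideal P (F\<lparr>carrier := V\<rparr>)"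
    using assms(2) by (auto simp: places_def)
  then have "function_field_place F K V P"
    using assms(1) by (auto simp: function_field_place_def function_field_place_axioms_def function_field_def)
  then show ?thesis by (rule that)
qed

lemma riemann_roch_add:
  assumes ff: "function_field F K" and "f \<in> riemann_roch_space F K D" "g \<in> riemann_roch_space F K D"
  shows "f \<oplus>\<^bsub>F\<^esub> g \<in> riemann_roch_space F K D"
proof -
  interpret field F using ff by (simp add: function_field_def)
  have fg: "f \<in> carrier F" "g \<in> carrier F" using assms by (auto simp: riemann_roch_space_def)
  have "f \<oplus>\<^bsub>F\<^esub> g = \<zero>\<^bsub>F\<^esub> \<or> valuation F P (f \<oplus>\<^bsub>F\<^esub> g) \<ge> - Poly_Mapping.lookup D P" if Pl: "P \<in> places F K" for P
  proof -
    obtain V where "function_field_place F K V P" using place_obtain[OF ff Pl] .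
    then interpret function_field_place F K V P .
    show ?thesis by (rule bounded_pole_add) (use assms Pl in \<open>auto simp: riemann_roch_space_def\<close>)
  qed
  then show ?thesis using fg by (auto simp: riemann_roch_space_def)
qed

lemma riemann_roch_mult:
  assumes ff: "function_field F K" and "f \<in> riemann_roch_space F K D" "g \<in> riemann_roch_space F K E"
  shows "f \<otimes>\<^bsub>F\<^esub> g \<in> riemann_roch_space F K (D + E)"
proof -
  interpret field F using ff by (simp add: function_field_def)
  have fg: "f \<in> carrier F" "g \<in> carrier F" using assms by (auto simp: riemann_roch_space_def)
  have "f \<otimes>\<^bsub>F\<^esub> g = \<zero>\<^bsub>F\<^esub> \<or> valuation F P (f \<otimes>\<^bsub>F\<^esub> g) \<ge> - Poly_Mapping.lookup (D + E) P" if Pl: "P \<in> places F K" for P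
  proof -
    obtain V where "function_field_place F K V P" using place_obtain[OF ff Pl] .
    then interpret function_field_place F K V P .
    show ?thesis unfolding lookup_add
      by (rule bounded_pole_mult) (use assms Pl in \<open>auto simp: riemann_roch_space_def\<close>)
  qed
  then show ?thesis using fg by (auto simp: riemann_roch_space_def)
qed

lemma riemann_roch_constants:
  assumes ff: "function_field F K"
  shows "K \<subseteq> riemann_roch_space F K 0"
proof
  interpret field F using ff by (simp add: function_field_def)
  fix c assume c: "c \<in> K"
  have cF: "c \<in> carrier F" using c ff subfieldE(3)[of K F] unfolding function_field_def by blast
  have "c = \<zero>\<^bsub>F\<^esub> \<or> valuation F P c \<ge> - Poly_Mapping.lookup 0 P" if Pl: "P \<in> places F K" for P
  proof -
    obtain V where "function_field_place F K V P" using place_obtain[OF ff Pl] .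
    then interpret function_field_place F K V P .
    show ?thesis using bounded_pole_0_iff[OF cF] c K_V by auto
  qed
  then show "c \<in> riemann_roch_space F K 0" using cF by (auto simp: riemann_roch_space_def)
qed

lemma riemann_roch_prod:
  assumes ff: "function_field F K" and "finite A" "f \<in> A \<rightarrow> riemann_roch_space F K D"
  shows "finprod F f A \<in> riemann_roch_space F K (frag_cmul (int (card A)) D)"
  using assms(2,3)
proof (induction A rule: finite_induct)
  case empty
  interpret field F using ff by (simp add: function_field_def)
  have "\<one>\<^bsub>F\<^esub> \<in> K" using ff subringE(3)[OF subfieldE(1)] by (auto simp: function_field_def)
  then show ?case using riemann_roch_constants[OF ff] by auto
next
  case (insert a A)
  interpret field F using ff by (simp add: function_field_def)
  have fA: "f \<in> A \<rightarrow> carrier F" "f a \<in> carrier F" using insert by (auto simp: riemann_roch_space_def)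
  have "f a \<otimes>\<^bsub>F\<^esub> finprod F f A \<in> riemann_roch_space F K (D + frag_cmul (int (card A)) D)"
    using insert by (intro riemann_roch_mult[OF ff]) auto
  also have "D + frag_cmul (int (card A)) D = frag_cmul (int (card (insert a A))) D"
    using insert by (simp add: frag_cmul_distrib)
  finally show ?case using insert fA by simp
qed

text \<open>Outside the support the allowed pole order is 0, and the elements without a pole form
  the valuation ring. This makes \<open>ev\<close> meaningful at \<open>Q\<close> and at the chosen
  places.\<close>

lemma riemann_roch_in_place_ring:
  assumes ff: "function_field F K" and f: "f \<in> riemann_roch_space F K D"
    and Pl: "P \<in> places F K" "P \<notin> Poly_Mapping.keys D"
  shows "f \<in> carrier (place_ring F P)"
proof -
  obtain V where "function_field_place F K V P" using place_obtain[OF ff Pl(1)] .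
  then interpret function_field_place F K V P .
  have "Poly_Mapping.lookup D P = 0" using Pl by (simp add: in_keys_iff)
  then have "f \<in> carrier F" "bounded_pole 0 f" using f Pl by (auto simp: riemann_roch_space_def)
  then show ?thesis using bounded_pole_0_iff by (simp add: place_ring)
qed

section \<open>Uniqueness of finite fields\<close>

context cring
begin

definition of_integer :: "int \<Rightarrow> 'a" where "of_integer a = [a] \<cdot> \<one>"

lemma of_integer_closed [simp]: "of_integer a \<in> carrier R"
  unfolding of_integer_def by (rule add.int_pow_closed) simp

lemma of_integer_add: "of_integer (a + b) = of_integer a \<oplus> of_integer b"
  unfolding of_integer_def using add.int_pow_mult[of \<one> a b] by simp

lemma of_integer_0 [simp]: "of_integer 0 = \<zero>" and of_integer_1 [simp]: "of_integer 1 = \<one>"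
  unfolding of_integer_def using add.int_pow_1[of \<one>] by (simp_all add: add_pow_def)

lemma of_integer_mult: "of_integer (a * b) = of_integer a \<otimes> of_integer b"
proof -
  have c: "[b] \<cdot> \<one> \<in> carrier R" by (rule add.int_pow_closed) simp
  have "of_integer a \<otimes> of_integer b = [a] \<cdot> (\<one> \<otimes> [b] \<cdot> \<one>)"
    unfolding of_integer_def using c by (intro add_pow_ldistr_int) auto
  also have "\<dots> = [a] \<cdot> ([b] \<cdot> \<one>)" using c by simp
  also have "\<dots> = [(b * a)] \<cdot> \<one>" using add.int_pow_pow[of \<one> a b] by simp
  finally show ?thesis by (simp add: of_integer_def mult.commute)
qed

text \<open>The value at \<open>x\<close> of an integer polynomial, through the canonical map from the integers. Integer
  polynomials serve as common representatives for the polynomials over the prime fields of two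
  rings.\<close>

definition int_eval :: "int poly \<Rightarrow> 'a \<Rightarrow> 'a" where
  "int_eval c x = eval (map of_integer (rev (coeffs c))) x"

lemma int_eval_closed [simp]: "x \<in> carrier R \<Longrightarrow> int_eval c x \<in> carrier R"
  unfolding int_eval_def by (intro eval_in_carrier) auto

lemma int_eval_0 [simp]: "int_eval 0 x = \<zero>"
  by (simp add: int_eval_def)

lemma int_eval_pCons:
  assumes "x \<in> carrier R"
  shows "int_eval (pCons a c) x = int_eval c x \<otimes> x \<oplus> of_integer a"
proof (cases "a = 0 \<and> c = 0")
  case False
  then have "coeffs (pCons a c) = a # coeffs c" by (auto simp: cCons_def)
  then show ?thesis unfolding int_eval_def using assms eval_append_aux[of "map of_integer (rev (coeffs c))" "of_integer a" x]
    by (simp add: image_subset_iff)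
qed (use assms in simp)

lemma int_eval_1 [simp]: "x \<in> carrier R \<Longrightarrow> int_eval 1 x = \<one>"
  unfolding one_pCons by (simp add: int_eval_pCons)

lemma int_eval_add:
  assumes x: "x \<in> carrier R"
  shows "int_eval (c + d) x = int_eval c x \<oplus> int_eval d x"
proof (induction c d rule: poly_induct2)
  case (pCons a p b q)
  then show ?case using x by (simp add: int_eval_pCons of_integer_add l_distr a_ac)
qed simp

lemma int_eval_smult:
  assumes x: "x \<in> carrier R"
  shows "int_eval (Polynomial.smult a c) x = of_integer a \<otimes> int_eval c x"
  by (induction c) (use x in \<open>simp_all add: int_eval_pCons of_integer_mult r_distr m_assoc\<close>)

lemma int_eval_mult:
  assumes x: "x \<in> carrier R"
  shows "int_eval (c * d) x = int_eval c x \<otimes> int_eval d x"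
proof (induction c)
  case (pCons a c)
  then show ?case
    using x by (simp add: int_eval_pCons int_eval_add int_eval_smult l_distr r_distr m_ac a_ac)
qed (use x in simp)

lemma of_integer_uminus: "of_integer (- a) = \<ominus> of_integer a"
  using of_integer_add[of a "- a"] by (simp add: minus_equality[of "of_integer (-a)"] a_comm)

lemma int_eval_diff:
  assumes x: "x \<in> carrier R"
  shows "int_eval (c - d) x = int_eval c x \<ominus> int_eval d x"
proof -
  have "int_eval (c - d) x = int_eval (c + Polynomial.smult (- 1) d) x" by simp
  then show ?thesis
    using x by (simp only: int_eval_add int_eval_smult) (simp add: of_integer_uminus l_minus a_minus_def)
qed

lemma int_eval_monom:
  assumes x: "x \<in> carrier R"
  shows "int_eval (Polynomial.monom 1 n) x = x [^] n"
  by (induction n) (use x in \<open>simp_all add: Polynomial.monom_0 monom_Suc int_eval_pCons one_pCons[symmetric]\<close>)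

lemma int_eval_dvd_coeffs:
  assumes x: "x \<in> carrier R" and p: "of_integer p = \<zero>" and d: "\<forall>i. p dvd Polynomial.coeff c i"
  shows "int_eval c x = \<zero>"
  using d
proof (induction c)
  case (pCons a c)
  have "p dvd a" using pCons.prems by (metis coeff_pCons_0)
  then have "of_integer a = \<zero>" using p by (auto simp: dvd_def of_integer_mult)
  moreover have "\<forall>i. p dvd Polynomial.coeff c i" using pCons.prems by (metis coeff_pCons_Suc)
  ultimately show ?case using x pCons.IH by (simp add: int_eval_pCons)
qed simp

end

text \<open>The leading coefficient 1 survives in every field, so the image keeps the degree of
  \<open>c\<close> and is not the zero polynomial even in positive characteristic.\<close>

lemma (in field) card_int_eval_roots:
  assumes c: "Polynomial.coeff c (Polynomial.degree c) = (1::int)"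
  shows "card {x \<in> carrier R. int_eval c x = \<zero>} \<le> Polynomial.degree c"
proof -
  let ?l = "map of_integer (rev (coeffs c))"
  have c0: "c \<noteq> 0" using c by auto
  then have l: "?l \<noteq> []" by simp
  have "hd ?l = of_integer (last (coeffs c))"
    using c0 by (simp add: hd_map hd_rev)
  then have "hd ?l = \<one>" using last_coeffs_eq_coeff_degree[OF c0] c by simp
  then have "polynomial (carrier R) ?l" unfolding polynomial_def by auto
  then have p: "?l \<in> carrier (poly_ring R)" by (simp add: univ_poly_carrier)
  have "{x \<in> carrier R. int_eval c x = \<zero>} = set_mset (roots ?l)"
    using roots_mem_iff_is_root[OF p] l by (auto simp: is_root_def int_eval_def)
  moreover have "card (set_mset M) \<le> size M" for M :: "'a multiset"
    by (induction M) (auto simp: card_insert_if)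
  then have "card (set_mset (roots ?l)) \<le> size (roots ?l)" .
  moreover have "size (roots ?l) \<le> Polynomial.degree c"
    using size_roots_le_degree[OF p] by (simp add: length_coeffs[OF c0])
  ultimately show ?thesis by simp
qed

lemma (in field) finite_field_pow_card:
  assumes fin: "finite (carrier R)" and x: "x \<in> carrier R"
  shows "x [^] card (carrier R) = x"
proof (cases "x = \<zero>")
  case True
  have "card (carrier R) \<noteq> 0" using fin by auto
  then show ?thesis using True by (simp add: nat_pow_zero)
next
  case False
  interpret M: group "Multiplicative_Group.mult_of R" by (rule field_mult_group)
  have "x [^]\<^bsub>Multiplicative_Group.mult_of R\<^esub> Coset.order (Multiplicative_Group.mult_of R) = \<one>"
    using M.pow_order_eq_1[of x] x False by simp
  then have "x [^] (card (carrier R) - 1) = \<one>"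
    using order_mult_of[OF fin]
    by (simp add: Multiplicative_Group.nat_pow_mult_of Coset.order_def)
  then have "x [^] Suc (card (carrier R) - 1) = x" using x by simp
  moreover have "card (carrier R) > 0" using fin by (auto simp: card_gt_0_iff)
  ultimately show ?thesis by (metis Suc_pred')
qed

text \<open>The order of the additive group annihilates \<open>\<one>\<close>, and without zero
  divisors a vanishing power of \<open>p\<close> forces \<open>p\<close> to vanish.\<close>

lemma (in field) of_integer_char:
  assumes "card (carrier R) = p ^ s"
  shows "of_integer (int p) = \<zero>"
proof -
  have "of_integer (int (card (carrier R))) = \<zero>"
    unfolding of_integer_def using add.pow_order_eq_1[of \<one>] by (simp add: add_pow_int_ge Coset.order_def)
  then have "of_integer (int p ^ s) = \<zero>" using assms by simp
  moreover have "of_integer (int p ^ s) = \<zero> \<Longrightarrow> of_integer (int p) = \<zero>"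
  proof (induction s)
    case (Suc s)
    then show ?case using integral[of "of_integer (int p)" "of_integer (int p ^ s)"]
      by (auto simp: of_integer_mult)
  qed simp
  ultimately show ?thesis by simp
qed

text \<open>Divide by \<open>f\<close>: a nonzero remainder also vanishes at \<open>g\<close> and
  has smaller degree. Minimality of \<open>f\<close> among the monic relations forces all its
  coefficients to be divisible by \<open>p\<close>, so it vanishes at every element of a field in
  which \<open>p\<close> is 0, in particular at \<open>h\<close>.\<close>

lemma minimal_monic_relation:
  assumes L1: "field L1" and L2: "field L2" and p: "Factorial_Ring.prime (p::nat)"
    and z1: "cring.of_integer L1 (int p) = \<zero>\<^bsub>L1\<^esub>" and z2: "cring.of_integer L2 (int p) = \<zero>\<^bsub>L2\<^esub>"
    and g: "g \<in> carrier L1" and h: "h \<in> carrier L2"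
    and f: "Polynomial.coeff f (Polynomial.degree f) = 1" "cring.int_eval L1 f g = \<zero>\<^bsub>L1\<^esub>"
    and mn: "\<And>f'. Polynomial.coeff f' (Polynomial.degree f') = 1 \<Longrightarrow> cring.int_eval L1 f' g = \<zero>\<^bsub>L1\<^esub> \<Longrightarrow>
      Polynomial.degree f \<le> Polynomial.degree f'"
    and c: "cring.int_eval L1 c g = \<zero>\<^bsub>L1\<^esub>"
  shows "\<exists>u r. c = f * u + r \<and> (r = 0 \<or> Polynomial.degree r < Polynomial.degree f) \<and> cring.int_eval L2 r h = \<zero>\<^bsub>L2\<^esub>"
proof -
  interpret L1: field L1 by (rule L1)
  interpret L2: field L2 by (rule L2)
  have small: "\<forall>i. int p dvd Polynomial.coeff r i"
    if "L1.int_eval r g = \<zero>\<^bsub>L1\<^esub>" "Polynomial.degree r < Polynomial.degree f" for r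
    using that
  proof (induction "Polynomial.degree r" arbitrary: r rule: less_induct)
    case less
    define n where "n = Polynomial.degree r"
    define a where "a = Polynomial.coeff r n"
    have pa: "int p dvd a"
    proof (rule ccontr)
      assume "\<not> int p dvd a"
      then have "coprime (int p) a" using p by (intro prime_imp_coprime) auto
      then obtain u v where uv: "u * int p + v * a = 1" by (metis bezout_int coprime_iff_gcd_eq_1)
      \<comment> \<open>Bezout makes the leading coefficient 1: the added term has a coefficient
        divisible by \<open>p\<close>, which is 0 in \<open>L1\<close>, so the value at
        \<open>g\<close> remains 0.\<close>
      define f' where "f' = Polynomial.smult v r + Polynomial.monom (u * int p) n"
      have deg: "Polynomial.degree f' \<le> n"
        unfolding f'_def using degree_smult_le[of v r] degree_monom_le[of "u * int p" n]
        by (intro degree_add_le) (auto simp: n_def)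
      have co: "Polynomial.coeff f' n = 1" using uv by (simp add: f'_def a_def)
      then have degn: "Polynomial.degree f' = n" using deg le_degree[of f' n] by simp
      have "f' = Polynomial.smult v r + Polynomial.smult (u * int p) (Polynomial.monom 1 n)"
        by (simp add: f'_def smult_monom)
      then have "L1.int_eval f' g = \<zero>\<^bsub>L1\<^esub>"
        using g less.prems z1 by (simp add: L1.int_eval_add L1.int_eval_smult L1.of_integer_mult)
      from mn[OF _ this] have "Polynomial.degree f \<le> n" using co degn by simp
      then show False using less.prems n_def by simp
    qed
    \<comment> \<open>With the leading coefficient divisible by \<open>p\<close>, cutting off the
      leading term leaves 0 or a polynomial of smaller degree that still vanishes at
      \<open>g\<close>.\<close>
    define r' where "r' = r - Polynomial.monom a n"
    have r: "r = r' + Polynomial.monom a n" by (simp add: r'_def)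
    have deg: "Polynomial.degree r' \<le> n"
      unfolding r'_def using degree_monom_le[of a n] by (intro degree_diff_le) (auto simp: n_def)
    have co: "Polynomial.coeff r' n = 0" by (simp add: r'_def a_def)
    have "\<forall>i. int p dvd Polynomial.coeff r' i"
    proof (cases "r' = 0")
      case False
      then have "Polynomial.degree r' < n" using deg co by (metis le_neq_implies_less leading_coeff_0_iff)
      moreover have "L1.int_eval r' g = \<zero>\<^bsub>L1\<^esub>"
      proof -
        have "L1.of_integer a = \<zero>\<^bsub>L1\<^esub>" using pa z1 by (auto simp: dvd_def L1.of_integer_mult)
        moreover have "r' = r - Polynomial.smult a (Polynomial.monom 1 n)"
          by (simp add: r'_def smult_monom)
        ultimately show ?thesis
          using g less.prems by (simp add: L1.int_eval_diff L1.int_eval_smult)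
      qed
      ultimately show ?thesis using less.hyps less.prems n_def by simp
    qed simp
    then show ?case unfolding r using pa by (simp add: Polynomial.coeff_monom)
  qed
  have f0: "f \<noteq> 0" using f(1) by auto
  \<comment> \<open>Pseudo-division scales \<open>c\<close> by a power of the leading coefficient of
    \<open>f\<close>, which is 1 here, so it is genuine division.\<close>
  obtain u r where ur: "pseudo_divmod c f = (u, r)" by fastforce
  have "c = f * u + r" "r = 0 \<or> Polynomial.degree r < Polynomial.degree f"
    using pseudo_divmod[OF f0 ur] f(1) by auto
  moreover have "L2.int_eval r h = \<zero>\<^bsub>L2\<^esub>"
  proof (cases "r = 0")
    case False
    have "L1.int_eval r g = \<zero>\<^bsub>L1\<^esub>"
      using c f(2) g \<open>c = f * u + r\<close> by (simp add: L1.int_eval_add L1.int_eval_mult)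
    then have "\<forall>i. int p dvd Polynomial.coeff r i" using small False calculation(2) by blast
    then show ?thesis using L2.int_eval_dvd_coeffs[OF h z2] by simp
  qed simp
  ultimately show ?thesis by blast
qed

text \<open>A generator \<open>g\<close> of the multiplicative group of \<open>L1\<close> generates \<open>L1\<close> as a ring. Its minimal
  polynomial divides \<open>X^N - X\<close>, which vanishes on \<open>L2\<close>, so by counting roots it has a root \<open>h\<close>
  in \<open>L2\<close>, and \<open>g \<mapsto> h\<close> defines the isomorphism.\<close>

lemma finite_fields_isomorphic:
  assumes L1: "field L1" and L2: "field L2" and p: "Factorial_Ring.prime (p::nat)"
    and card1: "card (carrier L1) = p ^ s" and card2: "card (carrier L2) = p ^ s"
  shows "\<exists>\<phi>. \<phi> \<in> ring_iso L1 L2"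
proof -
  interpret L1: field L1 by (rule L1)
  interpret L2: field L2 by (rule L2)
  define N where "N = p ^ s"
  have N: "card (carrier L1) = N" "card (carrier L2) = N" using card1 card2 N_def by simp_all
  have "p > 0" using p prime_gt_0_nat by simp
  then have N0: "N > 0" by (simp add: N_def)
  have fin: "finite (carrier L1)" "finite (carrier L2)" using N0 N card_ge_0_finite by metis+
  have "card {\<zero>\<^bsub>L1\<^esub>, \<one>\<^bsub>L1\<^esub>} \<le> N" unfolding N(1)[symmetric] by (rule card_mono) (use fin in auto)
  then have N2: "N \<ge> 2" by simp
  note z1 = L1.of_integer_char[OF card1] and z2 = L2.of_integer_char[OF card2]
  obtain g where g: "g \<in> carrier L1" "g \<noteq> \<zero>\<^bsub>L1\<^esub>"
    and gen: "carrier L1 - {\<zero>\<^bsub>L1\<^esub>} = {g [^]\<^bsub>L1\<^esub> i | i::nat. i \<in> UNIV}"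
    using L1.finite_field_mult_group_has_gen[OF fin(1)] by auto
  let ?monic = "\<lambda>f. Polynomial.coeff f (Polynomial.degree f) = (1::int) \<and> L1.int_eval f g = \<zero>\<^bsub>L1\<^esub>"
  define w :: "int poly" where "w = Polynomial.monom 1 N - Polynomial.monom 1 1"
  have wN: "Polynomial.degree w = N"
    using degree_add_eq_left[of "- Polynomial.monom 1 1" "Polynomial.monom (1::int) N"] N2
    by (simp add: w_def Polynomial.degree_monom_eq)
  have w1: "Polynomial.coeff w N = 1" using N2 by (simp add: w_def)
  have eval_w: "L1.int_eval w x = \<zero>\<^bsub>L1\<^esub>" if "x \<in> carrier L1" for x
    using that L1.finite_field_pow_card[OF fin(1) that] N
    unfolding w_def by (simp add: L1.int_eval_diff L1.int_eval_monom del: One_nat_def)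
  have eval_w2: "L2.int_eval w x = \<zero>\<^bsub>L2\<^esub>" if "x \<in> carrier L2" for x
    using that L2.finite_field_pow_card[OF fin(2) that] N
    unfolding w_def by (simp add: L2.int_eval_diff L2.int_eval_monom del: One_nat_def)
  have mw: "?monic w" using wN w1 eval_w[OF g(1)] by simp
  obtain f where f: "?monic f" and mn: "\<And>f'. ?monic f' \<Longrightarrow> Polynomial.degree f \<le> Polynomial.degree f'"
    using ex_has_least_nat[of ?monic w Polynomial.degree] mw by blast
  have relation: "\<exists>u r. c = f * u + r \<and> (r = 0 \<or> Polynomial.degree r < Polynomial.degree f) \<and> L2.int_eval r h = \<zero>\<^bsub>L2\<^esub>"
    if "h \<in> carrier L2" "L1.int_eval c g = \<zero>\<^bsub>L1\<^esub>" for c h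
    using minimal_monic_relation[OF L1 L2 p z1 z2 g(1) that(1) _ _ _ that(2), of f] f mn by blast
  have degf: "Polynomial.degree f > 0"
  proof (rule ccontr)
    assume "\<not> Polynomial.degree f > 0"
    then obtain a where "f = [:a:]" by (metis degree_eq_zeroE gr0I)
    then have "f = 1" using f by (simp add: one_pCons)
    then show False using f g by simp
  qed
  have "\<exists>h \<in> carrier L2. L2.int_eval f h = \<zero>\<^bsub>L2\<^esub>"
  proof (rule ccontr)
    assume no: "\<not> ?thesis"
    \<comment> \<open>Without a root of \<open>f\<close>, all \<open>N\<close> elements of
      \<open>L2\<close> would be roots of the cofactor \<open>u\<close>, which is monic of degree
      smaller than \<open>N\<close>. The element 0 serves only to obtain some quotient and
      remainder.\<close>
    obtain u r where ur: "w = f * u + r" "r = 0 \<or> Polynomial.degree r < Polynomial.degree f"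
      using relation[OF L2.zero_closed] mw by blast
    have degf_w: "Polynomial.degree f \<le> N" using mn[OF mw] wN by simp
    have fu: "f * u = w - r" using ur by simp
    have rN: "Polynomial.coeff r i = 0" if "i \<ge> N" for i
      using ur(2) that degf_w by (auto intro: coeff_eq_0)
    have "Polynomial.coeff (f * u) N = 1" using rN w1 by (simp add: fu)
    moreover have "Polynomial.degree (f * u) \<le> N"
      by (rule Polynomial.degree_le) (use wN rN in \<open>auto simp: fu coeff_eq_0\<close>)
    ultimately have dfu: "Polynomial.degree (f * u) = N" using le_degree[of "f * u" N] by simp
    have "u \<noteq> 0" "f \<noteq> 0" using dfu N2 by auto
    then have "Polynomial.degree f + Polynomial.degree u = N" using dfu by (simp add: degree_mult_eq)
    moreover have "Polynomial.coeff u (Polynomial.degree u) = 1"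
      using lead_coeff_mult[of f u] f dfu \<open>Polynomial.coeff (f * u) N = 1\<close> by simp
    moreover have "{x \<in> carrier L2. L2.int_eval u x = \<zero>\<^bsub>L2\<^esub>} = carrier L2"
    proof safe
      fix x assume x: "x \<in> carrier L2"
      obtain u' r' where u': "w = f * u' + r'" "r' = 0 \<or> Polynomial.degree r' < Polynomial.degree f"
        "L2.int_eval r' x = \<zero>\<^bsub>L2\<^esub>"
        using relation[OF x] mw by blast
      have "f * (u - u') = r' - r" using ur u' by (simp add: algebra_simps)
      \<comment> \<open>The relation at \<open>x\<close> comes with its own quotient, but division
        by a monic polynomial has only one.\<close>
      have "u = u'"
      proof (rule ccontr)
        assume "u \<noteq> u'"
        then have "Polynomial.degree (f * (u - u')) \<ge> Polynomial.degree f"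
          using \<open>f \<noteq> 0\<close> by (simp add: degree_mult_eq)
        moreover have "Polynomial.degree (r' - r) < Polynomial.degree f"
          using ur(2) u'(2) degf by (intro degree_diff_less) auto
        ultimately show False using \<open>f * (u - u') = r' - r\<close> by simp
      qed
      then have "L2.int_eval f x \<otimes>\<^bsub>L2\<^esub> L2.int_eval u x = \<zero>\<^bsub>L2\<^esub>"
        using eval_w2[OF x] u' x by (simp add: L2.int_eval_add L2.int_eval_mult)
      then show "L2.int_eval u x = \<zero>\<^bsub>L2\<^esub>" using no x L2.integral[of "L2.int_eval f x" "L2.int_eval u x"] by auto
    qed
    ultimately show False using L2.card_int_eval_roots[of u] N degf by simp
  qed
  then obtain h where h: "h \<in> carrier L2" "L2.int_eval f h = \<zero>\<^bsub>L2\<^esub>" by blast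
  have ker: "L2.int_eval c h = \<zero>\<^bsub>L2\<^esub>" if c: "L1.int_eval c g = \<zero>\<^bsub>L1\<^esub>" for c
  proof -
    obtain u r where "c = f * u + r" "L2.int_eval r h = \<zero>\<^bsub>L2\<^esub>" using relation[OF h(1) c] by blast
    then show ?thesis using h by (simp add: L2.int_eval_add L2.int_eval_mult)
  qed
  define rep where "rep z = (SOME c. L1.int_eval c g = z)" for z
  have surj: "\<exists>c. L1.int_eval c g = z" if "z \<in> carrier L1" for z
  proof (cases "z = \<zero>\<^bsub>L1\<^esub>")
    case True
    then show ?thesis by (intro exI[of _ 0]) simp
  next
    case False
    then have "z \<in> carrier L1 - {\<zero>\<^bsub>L1\<^esub>}" using that by simp
    then obtain i :: nat where "z = g [^]\<^bsub>L1\<^esub> i" unfolding gen by blast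
    then show ?thesis using g by (intro exI[of _ "Polynomial.monom 1 i"]) (simp add: L1.int_eval_monom)
  qed
  have rep: "L1.int_eval (rep z) g = z" if "z \<in> carrier L1" for z
    unfolding rep_def using surj[OF that] by (rule someI_ex)
  define \<phi> where "\<phi> z = L2.int_eval (rep z) h" for z
  \<comment> \<open>By \<open>ker\<close> the value does not depend on the representative, so each
    homomorphism law may be checked on a convenient one.\<close>
  have \<phi>: "\<phi> z = L2.int_eval c h" if "L1.int_eval c g = z" "z \<in> carrier L1" for z c
  proof -
    have "L1.int_eval (rep z - c) g = \<zero>\<^bsub>L1\<^esub>"
      using that rep g by (simp add: L1.int_eval_diff)
    then have "L2.int_eval (rep z - c) h = \<zero>\<^bsub>L2\<^esub>" by (rule ker)
    then show ?thesis using h by (simp add: L2.int_eval_diff \<phi>_def)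
  qed
  have hom: "\<phi> \<in> ring_hom L1 L2"
  proof (rule ring_hom_memI)
    fix x assume x: "x \<in> carrier L1"
    show "\<phi> x \<in> carrier L2" using h by (simp add: \<phi>_def)
    fix y assume y: "y \<in> carrier L1"
    show "\<phi> (x \<otimes>\<^bsub>L1\<^esub> y) = \<phi> x \<otimes>\<^bsub>L2\<^esub> \<phi> y"
      using \<phi>[of "rep x * rep y" "x \<otimes>\<^bsub>L1\<^esub> y"] x y g h rep
      by (simp add: L1.int_eval_mult L2.int_eval_mult) (simp add: \<phi>_def)
    show "\<phi> (x \<oplus>\<^bsub>L1\<^esub> y) = \<phi> x \<oplus>\<^bsub>L2\<^esub> \<phi> y"
      using \<phi>[of "rep x + rep y" "x \<oplus>\<^bsub>L1\<^esub> y"] x y g h rep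
      by (simp add: L1.int_eval_add L2.int_eval_add) (simp add: \<phi>_def)
  next
    show "\<phi> \<one>\<^bsub>L1\<^esub> = \<one>\<^bsub>L2\<^esub>" using \<phi>[of 1 "\<one>\<^bsub>L1\<^esub>"] g h by simp
  qed
  have inj: "inj_on \<phi> (carrier L1)" by (rule non_trivial_field_hom_is_inj[OF hom L1 L2])
  have "\<phi> ` carrier L1 = carrier L2"
  proof (rule card_subset_eq[OF fin(2)])
    show "\<phi> ` carrier L1 \<subseteq> carrier L2" using ring_hom_memE(1)[OF hom] by auto
    show "card (\<phi> ` carrier L1) = card (carrier L2)" using N card_image[OF inj] by simp
  qed
  then have "\<phi> \<in> ring_iso L1 L2" using hom inj by (auto simp: ring_iso_def bij_betw_def)
  then show ?thesis by blast
qed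

section \<open>Residue fields\<close>

lemma (in ring) line_extension_unique:
  assumes K: "subfield K R" and E: "dimension n K E" and v: "v \<in> carrier R" "v \<notin> E"
    and k: "k \<in> K" "k' \<in> K" "e \<in> E" "e' \<in> E" and eq: "k \<otimes> v \<oplus> e = k' \<otimes> v \<oplus> e'"
  shows "k = k'" "e = e'"
proof -
  note Ep = space_subgroup_props[OF K E] and KR = subfieldE(3)[OF K]
  have c: "k \<in> carrier R" "k' \<in> carrier R" "e \<in> carrier R" "e' \<in> carrier R" using k KR Ep(1) by auto
  have "(k \<ominus> k') \<otimes> v = e' \<ominus> e"
  proof -
    have "(k \<ominus> k') \<otimes> v = (k \<otimes> v \<oplus> e) \<ominus> k' \<otimes> v \<ominus> e" using c v by algebra
    also have "\<dots> = (k' \<otimes> v \<oplus> e') \<ominus> k' \<otimes> v \<ominus> e" by (simp only: eq)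
    also have "\<dots> = e' \<ominus> e" using c v by algebra
    finally show ?thesis .
  qed
  moreover have "e' \<ominus> e \<in> E" using k Ep(3,4) by (simp add: a_minus_def)
  ultimately have inE: "(k \<ominus> k') \<otimes> v \<in> E" by simp
  have kk: "k \<ominus> k' \<in> K" using k subringE(5,7)[OF subfieldE(1)[OF K]] by (simp add: a_minus_def)
  show "k = k'"
  proof (rule ccontr)
    assume "k \<noteq> k'"
    then have "k \<ominus> k' \<noteq> \<zero>" using c by simp
    then show False using Ep(6)[of "k \<ominus> k'" v] kk inE v by simp
  qed
  then show "e = e'" using eq c v by simp
qed

lemma (in ring) card_dimension:
  assumes K: "subfield K R" "finite K" and E: "dimension n K E"
  shows "finite E \<and> card E = card K ^ n"
  using E K
proof (induction rule: dimension.induct)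
  case (Suc_dim v E n K)
  let ?f = "\<lambda>(k, e). k \<otimes> v \<oplus> e"
  have "inj_on ?f (K \<times> E)"
    using line_extension_unique[OF Suc_dim.prems(1) Suc_dim.hyps(3,1,2)] by (auto simp: inj_on_def)
  moreover have "line_extension K v E = ?f ` (K \<times> E)"
    by (rule Set.set_eqI)
      (simp only: line_extension_mem_iff image_iff mem_Sigma_iff Bex_def split_paired_Ex prod.case, blast)
  ultimately show ?case using Suc_dim.IH Suc_dim.prems by (simp add: card_image card_cartesian_product)
qed simp

text \<open>A basis with its dual coordinate forms, built by adjoining one vector at a time. It
  serves to write down a tensor decomposition and to find a linear section of the evaluation at
  \<open>Q\<close>.\<close>

lemma (in ring) dimension_coordinates:
  assumes K: "subfield K R" and E: "dimension n K E"
  shows "\<exists>b \<alpha>. (\<forall>i<n. b i \<in> E \<and> \<alpha> i \<in> E \<rightarrow> K \<and>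
      (\<forall>x \<in> E. \<forall>y \<in> E. \<alpha> i (x \<oplus> y) = \<alpha> i x \<oplus> \<alpha> i y) \<and> (\<forall>c \<in> K. \<forall>x \<in> E. \<alpha> i (c \<otimes> x) = c \<otimes> \<alpha> i x)) \<and>
    (\<forall>x \<in> E. x = (\<Oplus>i\<in>{..<n}. \<alpha> i x \<otimes> b i))"
  using E K
proof (induction rule: dimension.induct)
  case (zero_dim K)
  then show ?case by simp
next
  case (Suc_dim v E n K)
  note Ep = space_subgroup_props[OF Suc_dim.prems Suc_dim.hyps(3)] and KR = subfieldE(3)[OF Suc_dim.prems]
  note Kr = subringE[OF subfieldE(1)[OF Suc_dim.prems]]
  from Suc_dim.IH[OF Suc_dim.prems] obtain b \<alpha> where H:
    "\<forall>i<n. b i \<in> E \<and> \<alpha> i \<in> E \<rightarrow> K \<and> (\<forall>x \<in> E. \<forall>y \<in> E. \<alpha> i (x \<oplus> y) = \<alpha> i x \<oplus> \<alpha> i y) \<and>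
      (\<forall>c \<in> K. \<forall>x \<in> E. \<alpha> i (c \<otimes> x) = c \<otimes> \<alpha> i x)"
    "\<forall>x \<in> E. x = (\<Oplus>i\<in>{..<n}. \<alpha> i x \<otimes> b i)"
    by (elim exE conjE) (rule that)
  have b: "b i \<in> E" and \<alpha>: "\<alpha> i \<in> E \<rightarrow> K"
    and add: "x \<in> E \<Longrightarrow> y \<in> E \<Longrightarrow> \<alpha> i (x \<oplus> y) = \<alpha> i x \<oplus> \<alpha> i y"
    and sm: "c \<in> K \<Longrightarrow> x \<in> E \<Longrightarrow> \<alpha> i (c \<otimes> x) = c \<otimes> \<alpha> i x" if "i < n" for i c x y
    using H(1) that by simp_all
  have dec: "x = (\<Oplus>i\<in>{..<n}. \<alpha> i x \<otimes> b i)" if "x \<in> E" for x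
    using H(2) that by (rule bspec)
  let ?L = "line_extension K v E"
  have "\<forall>x\<in>?L. \<exists>k e. k \<in> K \<and> e \<in> E \<and> x = k \<otimes> v \<oplus> e" using line_extension_mem_iff by blast
  \<comment> \<open>\<open>\<kappa>\<close> is the coefficient of the new vector and
    \<open>\<epsilon>\<close> the part in \<open>E\<close>; being unique, they are linear.\<close>
  then obtain \<kappa> \<epsilon> where ke: "\<And>x. x \<in> ?L \<Longrightarrow> \<kappa> x \<in> K \<and> \<epsilon> x \<in> E \<and> x = \<kappa> x \<otimes> v \<oplus> \<epsilon> x" by metis
  have uniq: "\<kappa> x = k \<and> \<epsilon> x = e" if "x = k \<otimes> v \<oplus> e" "k \<in> K" "e \<in> E" for x k e
  proof -
    have "x \<in> ?L" using that line_extension_mem_iff by blast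
    then show ?thesis
      using line_extension_unique[OF Suc_dim.prems Suc_dim.hyps(3,1,2), of "\<kappa> x" k "\<epsilon> x" e] ke that by metis
  qed
  have vc: "v \<in> carrier R" by (rule Suc_dim.hyps)
  have kadd: "\<kappa> (x \<oplus> y) = \<kappa> x \<oplus> \<kappa> y \<and> \<epsilon> (x \<oplus> y) = \<epsilon> x \<oplus> \<epsilon> y" if "x \<in> ?L" "y \<in> ?L" for x y
  proof (rule uniq)
    have c: "\<kappa> x \<in> carrier R" "\<kappa> y \<in> carrier R" "\<epsilon> x \<in> carrier R" "\<epsilon> y \<in> carrier R"
      using ke that KR Ep(1) by blast+
    have "x \<oplus> y = (\<kappa> x \<otimes> v \<oplus> \<epsilon> x) \<oplus> (\<kappa> y \<otimes> v \<oplus> \<epsilon> y)" using ke that by simp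
    also have "\<dots> = (\<kappa> x \<oplus> \<kappa> y) \<otimes> v \<oplus> (\<epsilon> x \<oplus> \<epsilon> y)" using c vc by algebra
    finally show "x \<oplus> y = (\<kappa> x \<oplus> \<kappa> y) \<otimes> v \<oplus> (\<epsilon> x \<oplus> \<epsilon> y)" .
  qed (use ke that Kr(7) Ep(3) in auto)
  have ksm: "\<kappa> (a \<otimes> x) = a \<otimes> \<kappa> x \<and> \<epsilon> (a \<otimes> x) = a \<otimes> \<epsilon> x" if "a \<in> K" "x \<in> ?L" for a x
  proof (rule uniq)
    have c: "\<kappa> x \<in> carrier R" "a \<in> carrier R" "\<epsilon> x \<in> carrier R"
      using ke that KR Ep(1) by blast+
    have "a \<otimes> x = a \<otimes> (\<kappa> x \<otimes> v \<oplus> \<epsilon> x)" using ke that by simp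
    also have "\<dots> = (a \<otimes> \<kappa> x) \<otimes> v \<oplus> (a \<otimes> \<epsilon> x)" using c vc by algebra
    finally show "a \<otimes> x = (a \<otimes> \<kappa> x) \<otimes> v \<oplus> (a \<otimes> \<epsilon> x)" .
  qed (use ke that Kr(6) Ep(5) in auto)
  define b' where "b' i = (if i = n then v else b i)" for i
  define \<alpha>' where "\<alpha>' i x = (if i = n then \<kappa> x else \<alpha> i (\<epsilon> x))" for i x
  have EL: "e \<in> ?L" if "e \<in> E" for e
  proof -
    have "e = \<zero> \<otimes> v \<oplus> e" using that Ep(1) vc by auto
    then show ?thesis using that Kr(2) line_extension_mem_iff by blast
  qed
  have vL: "v \<in> ?L"
  proof -
    have "v = \<one> \<otimes> v \<oplus> \<zero>" using vc by simp
    then show ?thesis using Kr(3) Ep(2) line_extension_mem_iff by blast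
  qed
  show ?case
  proof (intro exI[of _ b'] exI[of _ \<alpha>'] conjI allI impI ballI)
    fix i assume i: "i < Suc n"
    then have i': "i < n" if "i \<noteq> n" using that by simp
    show "b' i \<in> ?L" using i b EL vL by (auto simp: b'_def)
    show "\<alpha>' i \<in> ?L \<rightarrow> K" using \<alpha>[OF i'] ke by (auto simp: \<alpha>'_def Pi_iff)
    show "\<alpha>' i (x \<oplus> y) = \<alpha>' i x \<oplus> \<alpha>' i y" if "x \<in> ?L" "y \<in> ?L" for x y
      using i kadd[OF that] add[of i "\<epsilon> x" "\<epsilon> y"] ke that by (auto simp: \<alpha>'_def)
    show "\<alpha>' i (c \<otimes> x) = c \<otimes> \<alpha>' i x" if "c \<in> K" "x \<in> ?L" for c x
      using i ksm[OF that] sm[of i c "\<epsilon> x"] ke that by (auto simp: \<alpha>'_def)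
  next
    fix x assume x: "x \<in> ?L"
    have ab: "(\<lambda>i. \<alpha> i (\<epsilon> x) \<otimes> b i) \<in> {..<n} \<rightarrow> carrier R"
      using \<alpha> b ke[OF x] KR Ep(1) by (auto simp: Pi_iff subset_iff)
    have "(\<Oplus>i\<in>{..<n}. \<alpha>' i x \<otimes> b' i) = (\<Oplus>i\<in>{..<n}. \<alpha> i (\<epsilon> x) \<otimes> b i)"
      using ab by (intro finsum_cong') (auto simp: \<alpha>'_def b'_def)
    also have "\<dots> = \<epsilon> x" using dec[of "\<epsilon> x"] ke[OF x] by simp
    finally have s: "(\<Oplus>i\<in>{..<n}. \<alpha>' i x \<otimes> b' i) = \<epsilon> x" .
    have c: "(\<lambda>i. \<alpha>' i x \<otimes> b' i) \<in> {..<n} \<rightarrow> carrier R" "\<kappa> x \<in> carrier R"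
      using ab ke[OF x] KR by (auto simp: \<alpha>'_def b'_def)
    have "(\<Oplus>i\<in>{..<Suc n}. \<alpha>' i x \<otimes> b' i) = \<kappa> x \<otimes> v \<oplus> \<epsilon> x"
      unfolding lessThan_Suc using c vc s by (subst finsum_insert) (auto simp: \<alpha>'_def b'_def)
    then show "x = (\<Oplus>i\<in>{..<Suc n}. \<alpha>' i x \<otimes> b' i)" using ke[OF x] by simp
  qed
qed

lemma (in ring) finite_imp_finite_dimension:
  assumes "subfield K R" "finite (carrier R)"
  shows "finite_dimension K (carrier R)"
proof -
  obtain Us where Us: "set Us = carrier R" using finite_list[OF assms(2)] by blast
  then have "carrier R \<subseteq> Span K Us" "Span K Us \<subseteq> carrier R"
    using Span_base_incl[OF assms(1), of Us] Span_in_carrier[OF subfieldE(3)[OF assms(1)], of Us] by auto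
  then show ?thesis using Span_finite_dimension[OF assms(1), of Us] Us by auto
qed

text \<open>All \<open>q\<close> elements of \<open>S\<close> are fixed, and \<open>X^q - X\<close>
  has at most \<open>q\<close> roots. Hence a finite field has at most one subfield of size
  \<open>q\<close>, and the image of the constants can be recognized as
  \<open>GF_sub\<close>.\<close>

lemma (in field) subfield_eq_fixed:
  assumes S: "subfield S R" and fin: "finite (carrier R)" and q: "card S = q"
  shows "S = {x \<in> carrier R. x [^] q = x}"
proof (rule card_seteq)
  interpret S: field "R\<lparr>carrier := S\<rparr>" using subfield_iff(2)[OF S] .
  have SR: "S \<subseteq> carrier R" using subfieldE(3)[OF S] .
  have finS: "finite S" using SR fin by (rule finite_subset)
  show "finite {x \<in> carrier R. x [^] q = x}" using fin by simp
  show "S \<subseteq> {x \<in> carrier R. x [^] q = x}"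
  proof
    fix x assume x: "x \<in> S"
    then have "x [^]\<^bsub>R\<lparr>carrier := S\<rparr>\<^esub> card S = x" using S.finite_field_pow_card finS by simp
    then show "x \<in> {x \<in> carrier R. x [^] q = x}" using x SR q by (auto simp: nat_pow_consistent[symmetric])
  qed
  have "card {\<zero>, \<one>} \<le> q" unfolding q[symmetric]
    by (rule card_mono[OF finS]) (use subringE(2,3)[OF subfieldE(1)[OF S]] in auto)
  then have q2: "q \<ge> 2" by simp
  \<comment> \<open>The root bound is stated for powers equal to \<open>\<one>\<close>, so
    \<open>\<zero>\<close> is counted separately from the at most \<open>q - 1\<close>
    others.\<close>
  have "{x \<in> carrier R. x [^] q = x} \<subseteq> insert \<zero> {x \<in> carrier R. x [^] (q - 1) = \<one>}"
  proof
    fix x assume "x \<in> {x \<in> carrier R. x [^] q = x}"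
    then have x: "x \<in> carrier R" "x [^] q = x" by auto
    have "x [^] Suc (q - 1) = x" using x q2 by simp
    then have "x [^] (q - 1) \<otimes> x = \<one> \<otimes> x" using x by simp
    then have "x = \<zero> \<or> x [^] (q - 1) = \<one>" using x m_rcancel[of x "x [^] (q - 1)" \<one>] by auto
    then show "x \<in> insert \<zero> {x \<in> carrier R. x [^] (q - 1) = \<one>}" using x by blast
  qed
  then have "card {x \<in> carrier R. x [^] q = x} \<le> card (insert \<zero> {x \<in> carrier R. x [^] (q - 1) = \<one>})"
    using fin by (intro card_mono) auto
  also have "\<dots> \<le> Suc (card {x \<in> carrier R. x [^] (q - 1) = \<one>})" using fin by (simp add: card_insert_if)
  also have "\<dots> \<le> q" using num_roots_le_deg[OF fin, of "q - 1"] q2 by simp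
  finally show "card {x \<in> carrier R. x [^] q = x} \<le> card S" using q by simp
qed

section \<open>Residue fields and their models \<open>GF\<close>\<close>

context function_field_place
begin

lemma ev_eq: "ev F P f = P +>\<^bsub>F\<lparr>carrier := V\<rparr>\<^esub> f"
  by (simp add: ev_def place_ring)

lemma residue_field_eq: "residue_field F P = F\<lparr>carrier := V\<rparr> Quot P"
  by (simp add: residue_field_def place_ring)

lemma residue_field_is_field: "field (residue_field F P)"
  unfolding residue_field_eq using maximalideal.quotient_is_field[OF P] subring_is_domain[OF V_subring]
  by (simp add: domain_def)

lemma ev_hom: "ev F P \<in> ring_hom (place_ring F P) (residue_field F P)"
proof -
  interpret M: maximalideal P "F\<lparr>carrier := V\<rparr>" by (rule P)
  have "ev F P = (+>\<^bsub>F\<lparr>carrier := V\<rparr>\<^esub>) P" by (simp add: ev_eq fun_eq_iff)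
  then show ?thesis using M.rcos_ring_hom by (simp add: place_ring residue_field_eq)
qed

lemma ev_surj: "ev F P ` V = carrier (residue_field F P)"
  by (auto simp: residue_field_eq FactRing_def A_RCOSETS_def' ev_eq)

lemma ev_K_subfield: "subfield (ev F P ` K) (residue_field F P)" and ev_K_inj: "inj_on (ev F P) K"
proof -
  interpret R: field "residue_field F P" by (rule residue_field_is_field)
  have rV: "ring (F\<lparr>carrier := V\<rparr>)" using subring_is_ring[OF V_subring] .
  interpret h: ring_hom_ring "F\<lparr>carrier := V\<rparr>" "residue_field F P" "ev F P"
    using ring_hom_ringI2[OF rV R.ring_axioms] ev_hom by (simp add: place_ring)
  have "subfield K (F\<lparr>carrier := V\<rparr>)"
  proof -
    have "field (F\<lparr>carrier := V\<rparr>\<lparr>carrier := K\<rparr>)" using subfield_iff(2)[OF K] by simp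
    then show ?thesis using h.R.subfield_iff(1)[of K] K_V by simp
  qed
  then show "inj_on (ev F P) K" "subfield (ev F P ` K) (residue_field F P)"
    using h.img_is_subfield R.one_not_zero by auto
qed

end

text \<open>\<open>GF m\<close> is a chosen field on the naturals, so a witness with natural numbers
  as elements is needed: the structure of \<open>R\<close> is carried over along an injection of its
  finite carrier.\<close>

lemma GF_exists:
  assumes "field (R :: ('c, 'd) ring_scheme)" "card (carrier R) = m" "finite (carrier R)"
  shows "field (GF m)" "card (carrier (GF m)) = m"
proof -
  interpret field R by (rule assms)
  obtain f :: "'c \<Rightarrow> nat" where f: "inj_on f (carrier R)"
    using assms(3) finite_imp_inj_to_nat_seg by blast
  have "field (image_ring f R) \<and> card (carrier (image_ring f R)) = m"
    using inj_imp_image_ring_is_field[OF f] card_image[OF f] assms(2) by (simp add: image_ring_carrier)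
  then have "field (GF m) \<and> card (carrier (GF m)) = m" unfolding GF_def by (rule someI)
  then show "field (GF m)" "card (carrier (GF m)) = m" by auto
qed

text \<open>The degree gives the residue field \<open>q ^ m\<close> elements, so uniqueness applies.
  Any isomorphism will do: it maps the image of \<open>K\<close> to a subfield of size
  \<open>q\<close>, and there is only one.\<close>

lemma (in function_field_place) residue_field_iso_GF:
  assumes q: "primepow q" "finite K" "card K = q" and deg: "has_degree F K P m"
  shows "field (GF (q ^ m))" "finite (carrier (GF (q ^ m)))" "subfield (GF_sub q m) (GF (q ^ m))"
    "\<exists>\<psi>. \<psi> \<in> ring_iso (residue_field F P) (GF (q ^ m)) \<and> \<psi> ` ev F P ` K = GF_sub q m"
proof -
  interpret R: field "residue_field F P" by (rule residue_field_is_field)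
  let ?S = "ev F P ` K"
  have cS: "card ?S = q" "finite ?S" using card_image[OF ev_K_inj] q by auto
  have cR: "finite (carrier (residue_field F P))" "card (carrier (residue_field F P)) = q ^ m"
    using R.card_dimension[OF ev_K_subfield cS(2)] deg cS by (auto simp: has_degree_def)
  note GF = GF_exists[OF residue_field_is_field cR(2,1)]
  show G: "field (GF (q ^ m))" by (rule GF)
  interpret G: field "GF (q ^ m)" by (rule G)
  have "q ^ m > 0" using primepow_gt_Suc_0[OF q(1)] by simp
  then show fin: "finite (carrier (GF (q ^ m)))" using GF(2) card_ge_0_finite by metis
  obtain p r where p: "Factorial_Ring.prime (p::nat)" "q = p ^ r" using q(1) by (auto simp: primepow_def)
  have "q ^ m = p ^ (r * m)" using p by (simp add: power_mult)
  then obtain \<psi> where \<psi>: "\<psi> \<in> ring_iso (residue_field F P) (GF (q ^ m))"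
    using finite_fields_isomorphic[OF residue_field_is_field G p(1)] cR(2) GF(2) by metis
  then have hom: "\<psi> \<in> ring_hom (residue_field F P) (GF (q ^ m))" and inj: "inj_on \<psi> (carrier (residue_field F P))"
    by (auto simp: ring_iso_def bij_betw_def)
  interpret h: ring_hom_ring "residue_field F P" "GF (q ^ m)" \<psi>
    using ring_hom_ringI2[OF R.ring_axioms G.ring_axioms hom] .
  have sf: "subfield (\<psi> ` ?S) (GF (q ^ m))" using h.img_is_subfield(2)[OF ev_K_subfield] by simp
  have "card (\<psi> ` ?S) = q"
    using cS card_image inj_on_subset[OF inj subfieldE(3)[OF ev_K_subfield]] by metis
  then have "\<psi> ` ?S = GF_sub q m"
    unfolding GF_sub_def using G.subfield_eq_fixed[OF sf fin] by simp
  then show "\<exists>\<psi>. \<psi> \<in> ring_iso (residue_field F P) (GF (q ^ m)) \<and> \<psi> ` ev F P ` K = GF_sub q m"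
    and "subfield (GF_sub q m) (GF (q ^ m))"
    using \<psi> sf by auto
qed

section \<open>Tensor decompositions\<close>

lemma (in abelian_monoid) finsum_cartesian:
  assumes "finite A" "finite B" "\<And>a b. a \<in> A \<Longrightarrow> b \<in> B \<Longrightarrow> f (a, b) \<in> carrier G"
  shows "(\<Oplus>x\<in>A \<times> B. f x) = (\<Oplus>a\<in>A. \<Oplus>b\<in>B. f (a, b))"
  using assms(1,3)
proof (induction A rule: finite_induct)
  case (insert a A)
  have eq: "insert a A \<times> B = Pair a ` B \<union> A \<times> B" by auto
  have "(\<Oplus>x\<in>insert a A \<times> B. f x) = (\<Oplus>x\<in>Pair a ` B. f x) \<oplus> (\<Oplus>x\<in>A \<times> B. f x)"
    unfolding eq using insert assms(2) by (intro finsum_Un_disjoint) auto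
  also have "(\<Oplus>x\<in>Pair a ` B. f x) = (\<Oplus>b\<in>B. f (a, b))"
    using insert by (intro finsum_reindex) (auto simp: inj_on_def)
  finally show ?case using insert by simp
qed simp

lemma (in cring) finsum_mult_finsum:
  assumes "finite A" "finite B" and f: "f \<in> A \<rightarrow> carrier R" and g: "g \<in> B \<rightarrow> carrier R"
  shows "finsum R f A \<otimes> finsum R g B = (\<Oplus>z\<in>A \<times> B. f (fst z) \<otimes> g (snd z))"
proof -
  have "finsum R f A \<otimes> finsum R g B = (\<Oplus>a\<in>A. f a \<otimes> finsum R g B)"
    using assms by (intro finsum_ldistr) auto
  also have "\<dots> = (\<Oplus>a\<in>A. \<Oplus>b\<in>B. f a \<otimes> g b)"
    using assms by (intro finsum_cong' finsum_rdistr) (auto simp: Pi_iff)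
  also have "\<dots> = (\<Oplus>z\<in>A \<times> B. f (fst z) \<otimes> g (snd z))"
    using assms by (subst finsum_cartesian) auto
  finally show ?thesis .
qed

lemma (in cring) finsum_diff_smult:
  assumes "finite T" "d \<in> carrier R"
    and "\<And>t. t \<in> T \<Longrightarrow> a t \<in> carrier R" "\<And>t. t \<in> T \<Longrightarrow> b t \<in> carrier R" "\<And>t. t \<in> T \<Longrightarrow> w t \<in> carrier R"
  shows "(\<Oplus>t\<in>T. (a t \<ominus> d \<otimes> b t) \<otimes> w t) = (\<Oplus>t\<in>T. a t \<otimes> w t) \<ominus> d \<otimes> (\<Oplus>t\<in>T. b t \<otimes> w t)"
proof -
  have "(\<Oplus>t\<in>T. (a t \<ominus> d \<otimes> b t) \<otimes> w t) = (\<Oplus>t\<in>T. a t \<otimes> w t \<oplus> \<ominus> d \<otimes> (b t \<otimes> w t))"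
    using assms by (intro finsum_cong') (auto simp: a_minus_def l_distr l_minus m_assoc)
  also have "\<dots> = (\<Oplus>t\<in>T. a t \<otimes> w t) \<oplus> (\<Oplus>t\<in>T. \<ominus> d \<otimes> (b t \<otimes> w t))"
    using assms by (intro finsum_addf) auto
  also have "(\<Oplus>t\<in>T. \<ominus> d \<otimes> (b t \<otimes> w t)) = \<ominus> d \<otimes> (\<Oplus>t\<in>T. b t \<otimes> w t)"
    using assms by (intro finsum_rdistr[symmetric]) auto
  finally show ?thesis using assms by (simp add: a_minus_def l_minus finsum_closed Pi_iff)
qed

text \<open>\<open>Rel\<close> behaves like the graph of a \<open>K\<close>-linear map on a subspace
  of \<open>K^T\<close>, and such a map extends to \<open>K^T\<close>; \<open>w t\<close> is its
  value at the unit vector of \<open>t\<close>. By induction on \<open>T\<close>, a vector with a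
  nonzero entry at \<open>t\<close> fixes \<open>w t\<close>, and without one any value is
  admissible.\<close>

lemma (in field) linear_relation_solution:
  assumes K: "subfield K R" and T: "finite T"
    and closed: "\<And>\<alpha> v \<beta> w c. Rel \<alpha> v \<Longrightarrow> Rel \<beta> w \<Longrightarrow> c \<in> K \<Longrightarrow> Rel (\<lambda>t. \<alpha> t \<ominus> c \<otimes> \<beta> t) (v \<ominus> c \<otimes> w)"
    and dom: "\<And>\<alpha> v. Rel \<alpha> v \<Longrightarrow> \<alpha> \<in> T \<rightarrow> K \<and> v \<in> carrier R"
    and func: "\<And>\<alpha> v. Rel \<alpha> v \<Longrightarrow> \<forall>t \<in> T. \<alpha> t = \<zero> \<Longrightarrow> v = \<zero>"
  shows "\<exists>w \<in> T \<rightarrow> carrier R. \<forall>\<alpha> v. Rel \<alpha> v \<longrightarrow> v = (\<Oplus>t\<in>T. \<alpha> t \<otimes> w t)"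
  using T closed dom func
proof (induction T arbitrary: Rel rule: finite_induct)
  case empty
  then show ?case by auto
next
  case (insert t T)
  have KR: "K \<subseteq> carrier R" using subfieldE(3)[OF K] .
  have dK: "\<alpha> s \<in> K" "\<alpha> s \<in> carrier R" "v \<in> carrier R" if "Rel \<alpha> v" "s \<in> insert t T" for \<alpha> v s
    using insert.prems(2)[OF that(1)] that(2) KR by auto
  define Rel' where "Rel' \<alpha> v \<longleftrightarrow> Rel \<alpha> v \<and> \<alpha> t = \<zero>" for \<alpha> v
  have "\<exists>w \<in> T \<rightarrow> carrier R. \<forall>\<alpha> v. Rel' \<alpha> v \<longrightarrow> v = (\<Oplus>t\<in>T. \<alpha> t \<otimes> w t)"
  proof (rule insert.IH)
    fix \<alpha> v \<beta> w c assume "Rel' \<alpha> v" "Rel' \<beta> w" "c \<in> K"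
    then show "Rel' (\<lambda>t. \<alpha> t \<ominus> c \<otimes> \<beta> t) (v \<ominus> c \<otimes> w)"
      using insert.prems(1) KR by (auto simp: Rel'_def a_minus_def)
  next
    fix \<alpha> v assume "Rel' \<alpha> v"
    then show "\<alpha> \<in> T \<rightarrow> K \<and> v \<in> carrier R" using insert.prems(2) by (auto simp: Rel'_def)
  next
    fix \<alpha> v assume "Rel' \<alpha> v" "\<forall>t \<in> T. \<alpha> t = \<zero>"
    then show "v = \<zero>" using insert.prems(3) by (auto simp: Rel'_def)
  qed
  then obtain w where w: "w \<in> T \<rightarrow> carrier R" and sol: "\<And>\<alpha> v. Rel' \<alpha> v \<Longrightarrow> v = (\<Oplus>t\<in>T. \<alpha> t \<otimes> w t)"
    by blast
  have ext: "(\<Oplus>s\<in>insert t T. \<alpha> s \<otimes> (w(t := u)) s) = \<alpha> t \<otimes> u \<oplus> (\<Oplus>s\<in>T. \<alpha> s \<otimes> w s)"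
    if "Rel \<alpha> v" "u \<in> carrier R" for \<alpha> v u
  proof -
    have "(\<Oplus>s\<in>T. \<alpha> s \<otimes> (w(t := u)) s) = (\<Oplus>s\<in>T. \<alpha> s \<otimes> w s)"
      using insert.hyps w dK[OF that(1)] by (intro finsum_cong') (auto simp: Pi_iff)
    moreover have "(\<lambda>s. \<alpha> s \<otimes> (w(t := u)) s) \<in> T \<rightarrow> carrier R"
      using insert.hyps w dK[OF that(1)] by (auto simp: Pi_iff)
    ultimately show ?thesis using insert.hyps that dK[OF that(1)] by (subst finsum_insert) auto
  qed
  have sumc: "(\<Oplus>s\<in>T. \<alpha> s \<otimes> w s) \<in> carrier R" if "Rel \<alpha> v" for \<alpha> v
    using w dK[OF that] by (intro finsum_closed) (auto simp: Pi_iff)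
  show ?case
  proof (cases "\<exists>\<beta> v. Rel \<beta> v \<and> \<beta> t \<noteq> \<zero>")
    case False
    have "v = (\<Oplus>s\<in>insert t T. \<alpha> s \<otimes> (w(t := \<zero>)) s)" if r: "Rel \<alpha> v" for \<alpha> v
    proof -
      have "\<alpha> t = \<zero>" using False r by blast
      then show ?thesis using ext[OF r zero_closed] sol[of \<alpha> v] r sumc[OF r] by (simp add: Rel'_def)
    qed
    then show ?thesis using w by (intro bexI[of _ "w(t := \<zero>)"]) auto
  next
    case True
    then obtain \<beta> v0 where \<beta>: "Rel \<beta> v0" "\<beta> t \<noteq> \<zero>" by blast
    note \<beta>c = dK[OF \<beta>(1)] and sb = sumc[OF \<beta>(1)]
    have bt: "\<beta> t \<in> carrier R" "\<beta> t \<in> K" "v0 \<in> carrier R" using \<beta>c by auto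
    note ib = nonzero_inv[OF bt(1) \<beta>(2)]
    \<comment> \<open>The value at \<open>t\<close> that makes the formula true for
      \<open>\<beta>\<close>.\<close>
    define u where "u = inv (\<beta> t) \<otimes> (v0 \<ominus> (\<Oplus>s\<in>T. \<beta> s \<otimes> w s))"
    have u: "u \<in> carrier R" using ib bt sb by (simp add: u_def)
    have "v = (\<Oplus>s\<in>insert t T. \<alpha> s \<otimes> (w(t := u)) s)" if r: "Rel \<alpha> v" for \<alpha> v
    proof -
      have at: "\<alpha> t \<in> carrier R" "\<alpha> t \<in> K" "v \<in> carrier R" using dK[OF r] by auto
      \<comment> \<open>Subtracting \<open>c\<close> times \<open>\<beta>\<close> clears the entry
        at \<open>t\<close>, so that the solution for \<open>Rel'\<close> applies.\<close>
      define c where "c = \<alpha> t \<otimes> inv (\<beta> t)"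
      have c: "c \<in> K" "c \<in> carrier R"
        using at bt \<beta>(2) subfield_m_inv(1)[OF K, of "\<beta> t"] subringE(6)[OF subfieldE(1)[OF K]] KR
        by (auto simp: c_def)
      have "c \<otimes> \<beta> t = \<alpha> t" using at bt ib by (simp add: c_def m_assoc)
      then have r': "Rel' (\<lambda>s. \<alpha> s \<ominus> c \<otimes> \<beta> s) (v \<ominus> c \<otimes> v0)"
        using insert.prems(1)[OF r \<beta>(1) c(1)] at by (simp add: Rel'_def r_neg a_minus_def)
      have "(\<Oplus>s\<in>T. (\<alpha> s \<ominus> c \<otimes> \<beta> s) \<otimes> w s) =
          (\<Oplus>s\<in>T. \<alpha> s \<otimes> w s) \<ominus> c \<otimes> (\<Oplus>s\<in>T. \<beta> s \<otimes> w s)"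
        using w dK[OF r] \<beta>c c insert.hyps by (intro finsum_diff_smult) (auto simp: Pi_iff)
      then have "v \<ominus> c \<otimes> v0 = (\<Oplus>s\<in>T. \<alpha> s \<otimes> w s) \<oplus> \<ominus> c \<otimes> (\<Oplus>s\<in>T. \<beta> s \<otimes> w s)"
        using sol[OF r'] c sb by (simp add: a_minus_def l_minus)
      then have "v = (\<Oplus>s\<in>T. \<alpha> s \<otimes> w s) \<oplus> \<ominus> c \<otimes> (\<Oplus>s\<in>T. \<beta> s \<otimes> w s) \<oplus> c \<otimes> v0"
        using at c bt by (metis (no_types, lifting) a_minus_def a_assoc l_neg m_closed r_zero a_inv_closed)
      also have "\<dots> = c \<otimes> (v0 \<ominus> (\<Oplus>s\<in>T. \<beta> s \<otimes> w s)) \<oplus> (\<Oplus>s\<in>T. \<alpha> s \<otimes> w s)"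
      proof -
        have "A \<oplus> \<ominus> c \<otimes> B \<oplus> c \<otimes> v0 = c \<otimes> (v0 \<ominus> B) \<oplus> A" if "A \<in> carrier R" "B \<in> carrier R" for A B
          using c(2) bt(3) that by algebra
        then show ?thesis using sb sumc[OF r] by blast
      qed
      also have "c \<otimes> (v0 \<ominus> (\<Oplus>s\<in>T. \<beta> s \<otimes> w s)) = \<alpha> t \<otimes> u"
        using at ib sb bt by (simp add: c_def u_def m_assoc)
      finally show ?thesis using ext[OF r u] by simp
    qed
    then show ?thesis using w u by (intro bexI[of _ "w(t := u)"]) auto
  qed
qed

lemma (in field) tensor_decompositionI:
  assumes T: "finite T" "card T = s"
    and K: "K \<subseteq> carrier R"
    and a: "\<And>t j. t \<in> T \<Longrightarrow> j \<in> {1..k} \<Longrightarrow> linear_form R K (a t j)" and c: "\<And>t. t \<in> T \<Longrightarrow> c t \<in> carrier R"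
    and eq: "\<And>x. x \<in> {1..k} \<rightarrow> carrier R \<Longrightarrow>
      finprod R x {1..k} = finsum R (\<lambda>t. finprod R (\<lambda>j. a t j (x j)) {1..k} \<otimes> c t) T"
  shows "tensor_decomposition R K k s"
proof -
  obtain h where h: "bij_betw h {1..s} T" using T by (metis ex_bij_betw_nat_finite_1)
  have hT: "h i \<in> T" if "i \<in> {1..s}" for i using h that by (auto simp: bij_betw_def)
  have "finprod R x {1..k} = finsum R (\<lambda>i. finprod R (\<lambda>j. a (h i) j (x j)) {1..k} \<otimes> c (h i)) {1..s}"
    if x: "x \<in> {1..k} \<rightarrow> carrier R" for x
  proof -
    have "finprod R (\<lambda>j. a t j (x j)) {1..k} \<in> carrier R" if "t \<in> T" for t
    proof (rule finprod_closed)
      show "(\<lambda>j. a t j (x j)) \<in> {1..k} \<rightarrow> carrier R"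
        using a[OF that] K x unfolding linear_form_def by (fastforce simp: Pi_iff)
    qed
    then have "(\<lambda>t. finprod R (\<lambda>j. a t j (x j)) {1..k} \<otimes> c t) \<in> h ` {1..s} \<rightarrow> carrier R"
      using c hT by auto
    then have "finsum R (\<lambda>t. finprod R (\<lambda>j. a t j (x j)) {1..k} \<otimes> c t) (h ` {1..s}) =
      finsum R (\<lambda>i. finprod R (\<lambda>j. a (h i) j (x j)) {1..k} \<otimes> c (h i)) {1..s}"
      using h by (intro finsum_reindex) (auto simp: bij_betw_def)
    then show ?thesis using eq[OF x] h by (simp add: bij_betw_def)
  qed
  then show ?thesis unfolding tensor_decomposition_def
    using a c hT by (intro exI[of _ "\<lambda>i. a (h i)"] exI[of _ "\<lambda>i. c (h i)"]) auto
qed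

text \<open>\<open>mu\<close> is a least number, which is attained only once some decomposition is
  known to exist. Expanding each factor in coordinates gives one; every further factor multiplies
  the number of summands by the dimension \<open>n\<close>.\<close>

lemma (in field) tensor_decomposition_exists:
  assumes fin: "finite (carrier R)" and K: "subfield K R" and k: "k \<ge> 1"
  shows "\<exists>s. tensor_decomposition R K k s"
proof -
  have KR: "K \<subseteq> carrier R" using subfieldE(3)[OF K] .
  obtain n where n: "dimension n K (carrier R)" using finite_imp_finite_dimension[OF K fin] by blast
  from dimension_coordinates[OF K n] obtain b \<alpha> where H:
    "\<forall>i<n. b i \<in> carrier R \<and> \<alpha> i \<in> carrier R \<rightarrow> K \<and>
      (\<forall>x \<in> carrier R. \<forall>y \<in> carrier R. \<alpha> i (x \<oplus> y) = \<alpha> i x \<oplus> \<alpha> i y) \<and>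
      (\<forall>c \<in> K. \<forall>x \<in> carrier R. \<alpha> i (c \<otimes> x) = c \<otimes> \<alpha> i x)"
    "\<forall>x \<in> carrier R. x = (\<Oplus>i\<in>{..<n}. \<alpha> i x \<otimes> b i)"
    by (elim exE conjE) (rule that)
  have \<alpha>: "linear_form R K (\<alpha> i)" "b i \<in> carrier R" if "i < n" for i
    using H(1) that by (auto simp: linear_form_def)
  have \<alpha>c: "\<alpha> i y \<in> carrier R" if "i < n" "y \<in> carrier R" for i y
    using \<alpha>(1)[OF that(1)] that KR by (auto simp: linear_form_def)
  show ?thesis
    using k
  proof (induction k rule: dec_induct)
    case base
    have "tensor_decomposition R K 1 n"
    proof (rule tensor_decompositionI[OF _ _ KR, where T = "{..<n}" and a = "\<lambda>i j. \<alpha> i" and c = b])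
      fix x assume x: "x \<in> {1..1::nat} \<rightarrow> carrier R"
      then have xc: "x 1 \<in> carrier R" by auto
      have "finprod R x {1..1} = x 1" using xc by simp
      also have "\<dots> = (\<Oplus>i\<in>{..<n}. \<alpha> i (x 1) \<otimes> b i)" using H(2) xc by (rule bspec)
      also have "\<dots> = (\<Oplus>i\<in>{..<n}. finprod R (\<lambda>j. \<alpha> i (x j)) {1..1} \<otimes> b i)"
        using \<alpha> \<alpha>c xc by (intro finsum_cong') auto
      finally show "finprod R x {1..1} = (\<Oplus>i\<in>{..<n}. finprod R (\<lambda>j. \<alpha> i (x j)) {1..1} \<otimes> b i)" .
    qed (use \<alpha> in auto)
    then show ?case by blast
  next
    case (step k)
    then obtain s where "tensor_decomposition R K k s" by blast
    then obtain a c where a: "\<forall>i\<in>{1..s}. \<forall>j\<in>{1..k}. linear_form R K (a i j)" and c: "\<forall>i\<in>{1..s}. c i \<in> carrier R"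
      and eq: "\<forall>x\<in>{1..k} \<rightarrow> carrier R.
        finprod R x {1..k} = (\<Oplus>i\<in>{1..s}. finprod R (\<lambda>j. a i j (x j)) {1..k} \<otimes> c i)"
      unfolding tensor_decomposition_def by (elim exE conjE) (rule that)
    let ?a = "\<lambda>z j. if j = Suc k then \<alpha> (snd z) else a (fst z) j"
    have "tensor_decomposition R K (Suc k) (s * n)"
    proof (rule tensor_decompositionI[OF _ _ KR, where T = "{1..s} \<times> {..<n}" and a = ?a
        and c = "\<lambda>z. c (fst z) \<otimes> b (snd z)"])
      fix x assume x: "x \<in> {1..Suc k} \<rightarrow> carrier R"
      have xs: "x (Suc k) \<in> carrier R" "x \<in> {1..k} \<rightarrow> carrier R" using x by auto
      have ac: "a t j (x j) \<in> carrier R" if "t \<in> {1..s}" "j \<in> {1..k}" for t j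
        using a that xs(2) KR by (auto simp: linear_form_def Pi_iff)
      define p where "p t = finprod R (\<lambda>j. a t j (x j)) {1..k}" for t
      have pc: "p t \<in> carrier R" if "t \<in> {1..s}" for t
        unfolding p_def using ac[OF that] by (intro finprod_closed) auto
      have Suc: "{1..Suc k} = insert (Suc k) {1..k}" by auto
      have f: "finprod R (\<lambda>j. ?a z j (x j)) {1..Suc k} = \<alpha> (snd z) (x (Suc k)) \<otimes> p (fst z)"
        if z: "z \<in> {1..s} \<times> {..<n}" for z
      proof -
        have t: "fst z \<in> {1..s}" and i: "snd z < n" using z by auto
        have "finprod R (\<lambda>j. ?a z j (x j)) {1..k} = p (fst z)"
          unfolding p_def using ac[OF t] by (intro finprod_cong') auto
        then show ?thesis unfolding Suc using ac[OF t] \<alpha>c[OF i] xs by (subst finprod_insert) auto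
      qed
      have "finprod R x {1..Suc k} = finprod R x {1..k} \<otimes> x (Suc k)"
        unfolding Suc using xs by (subst finprod_insert) (auto simp: m_comm)
      also have "\<dots> = (\<Oplus>t\<in>{1..s}. p t \<otimes> c t) \<otimes> (\<Oplus>i\<in>{..<n}. \<alpha> i (x (Suc k)) \<otimes> b i)"
        unfolding p_def using bspec[OF eq xs(2)] bspec[OF H(2) xs(1)] by (rule arg_cong2)
      also have "\<dots> = (\<Oplus>z\<in>{1..s} \<times> {..<n}. p (fst z) \<otimes> c (fst z) \<otimes> (\<alpha> (snd z) (x (Suc k)) \<otimes> b (snd z)))"
        using pc c \<alpha>c[OF _ xs(1)] \<alpha>(2) by (intro finsum_mult_finsum) auto
      also have "\<dots> = (\<Oplus>z\<in>{1..s} \<times> {..<n}. finprod R (\<lambda>j. ?a z j (x j)) {1..Suc k} \<otimes> (c (fst z) \<otimes> b (snd z)))"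
      proof (intro finsum_cong' refl)
        fix z assume z: "z \<in> {1..s} \<times> {..<n}"
        then have "fst z \<in> {1..s}" "snd z < n" by auto
        then show "p (fst z) \<otimes> c (fst z) \<otimes> (\<alpha> (snd z) (x (Suc k)) \<otimes> b (snd z)) =
            finprod R (\<lambda>j. ?a z j (x j)) {1..Suc k} \<otimes> (c (fst z) \<otimes> b (snd z))"
          unfolding f[OF z] using pc c \<alpha>c[OF _ xs(1)] \<alpha>(2) by (simp add: m_ac)
      qed (use f pc c \<alpha>c[OF _ xs(1)] \<alpha>(2) in auto)
      finally show "finprod R x {1..Suc k} = (\<Oplus>z\<in>{1..s} \<times> {..<n}.
          finprod R (\<lambda>j. ?a z j (x j)) {1..Suc k} \<otimes> (c (fst z) \<otimes> b (snd z)))" .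
    next
      fix z j assume "z \<in> {1..s} \<times> {..<n}" "j \<in> {1..Suc k}"
      then show "linear_form R K (?a z j)" using a \<alpha> by (auto simp: le_Suc_eq)
    qed (use c \<alpha> in auto)
    then show ?case by blast
  qed
qed

section \<open>Interpolation\<close>

lemma free_values_mono:
  assumes "(S, u) \<in> free_values L K k ps" "set ps \<subseteq> set ps'"
  shows "(S, u) \<in> free_values L K k ps'"
  using assms by (induction rule: free_values.induct) (auto intro: free_values.intros)

text \<open>\<open>ps\<close> runs first. Its results only enlarge the stock of free values, so
  every multiplication of \<open>qs\<close> stays legal.\<close>

lemma bilinear_program_append:
  assumes "bilinear_program L K k qs" "bilinear_program L K k ps"
  shows "bilinear_program L K k (qs @ ps)"
  using assms
proof (induction rule: bilinear_program.induct)
  case (multiply qs S u T v)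
  then show ?case
    using bilinear_program.multiply[of L K k "qs @ ps" S u T v]
      free_values_mono[of _ _ L K k qs "qs @ ps"] by auto
qed simp

lemma bilinear_program_multiply_many:
  fixes s :: nat
  assumes "bilinear_program L K k ps" "S \<inter> T = {}"
    and "\<And>t. t \<in> {1..s} \<Longrightarrow> (S, f t) \<in> free_values L K k ps \<and> (T, g t) \<in> free_values L K k ps"
  shows "\<exists>qs. bilinear_program L K k (qs @ ps) \<and> length qs = s \<and>
    (\<forall>t \<in> {1..s}. (S \<union> T, \<lambda>x. f t x \<otimes>\<^bsub>L\<^esub> g t x) \<in> set qs)"
  using assms(3)
proof (induction s)
  case 0
  then show ?case using assms(1) by (intro exI[of _ "[]"]) simp
next
  case (Suc s)
  then obtain qs where qs: "bilinear_program L K k (qs @ ps)" "length qs = s"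
    "\<forall>t \<in> {1..s}. (S \<union> T, \<lambda>x. f t x \<otimes>\<^bsub>L\<^esub> g t x) \<in> set qs" by force
  let ?q = "(S \<union> T, \<lambda>x. f (Suc s) x \<otimes>\<^bsub>L\<^esub> g (Suc s) x)"
  have "bilinear_program L K k (?q # qs @ ps)"
    using Suc.prems[of "Suc s"] by (intro bilinear_program.multiply qs assms(2)) (auto intro: free_values_mono)
  then show ?case using qs by (intro exI[of _ "?q # qs"]) (auto simp: le_Suc_eq)
qed

text \<open>An empty sum would need some value of type \<open>S\<close> to start from. Agreement is
  claimed on \<open>Z\<close> only, where the terms lie in the carrier and \<open>finsum\<close>
  splits off a term.\<close>

lemma free_values_finsum:
  assumes L: "field L" and "finite A" "A \<noteq> {}"
    and "\<And>t. t \<in> A \<Longrightarrow> d t \<in> K \<and> (S, u t) \<in> free_values L K k ps"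
    and "\<And>t x. t \<in> A \<Longrightarrow> x \<in> Z \<Longrightarrow> d t \<in> carrier L \<and> u t x \<in> carrier L"
  shows "\<exists>U. (S, U) \<in> free_values L K k ps \<and> (\<forall>x \<in> Z. U x = finsum L (\<lambda>t. d t \<otimes>\<^bsub>L\<^esub> u t x) A)"
  using assms(2-)
proof (induction A rule: finite_ne_induct)
  case (singleton t)
  interpret field L by (rule L)
  show ?case
    using singleton by (intro exI[of _ "\<lambda>x. d t \<otimes>\<^bsub>L\<^esub> u t x"]) (auto intro: free_values.smult)
next
  case (insert t A)
  interpret field L by (rule L)
  obtain U where U: "(S, U) \<in> free_values L K k ps" "\<forall>x \<in> Z. U x = finsum L (\<lambda>t. d t \<otimes>\<^bsub>L\<^esub> u t x) A"
    using insert by auto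
  have "(S, \<lambda>x. d t \<otimes>\<^bsub>L\<^esub> u t x \<oplus>\<^bsub>L\<^esub> U x) \<in> free_values L K k ps"
    using insert U by (intro free_values.add free_values.smult) auto
  then show ?case using insert U by (intro exI[of _ "\<lambda>x. d t \<otimes>\<^bsub>L\<^esub> u t x \<oplus>\<^bsub>L\<^esub> U x"]) (auto simp: Pi_iff)
qed

text \<open>\<open>\<eta> i\<close> identifies the base field \<open>K\<close> of \<open>L\<close> with that of \<open>R i\<close>. In the application
  \<open>\<theta> i x\<close> is the value at the \<open>i\<close>-th place of a preimage of \<open>x\<close>, and \<open>recombine\<close> expresses that a
  product in \<open>L\<close> depends linearly on the tuple of the products in the \<open>R i\<close>.\<close>

locale field_interpolation = field L for L :: "('a, 'b) ring_scheme" (structure) +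
  fixes K :: "'a set" and k :: nat and I :: "'i set" and R :: "'i \<Rightarrow> ('c, 'd) ring_scheme"
    and KR :: "'i \<Rightarrow> 'c set" and \<eta> :: "'i \<Rightarrow> 'a \<Rightarrow> 'c" and \<theta> :: "'i \<Rightarrow> 'a \<Rightarrow> 'c"
  assumes K: "subfield K L" and finite_I: "finite I"
    and R: "i \<in> I \<Longrightarrow> field (R i)" and KR: "i \<in> I \<Longrightarrow> KR i \<subseteq> carrier (R i)"
    and \<eta>_bij: "i \<in> I \<Longrightarrow> bij_betw (\<eta> i) K (KR i)"
    and \<eta>_add: "i \<in> I \<Longrightarrow> c \<in> K \<Longrightarrow> d \<in> K \<Longrightarrow> \<eta> i (c \<oplus> d) = \<eta> i c \<oplus>\<^bsub>R i\<^esub> \<eta> i d"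
    and \<eta>_mult: "i \<in> I \<Longrightarrow> c \<in> K \<Longrightarrow> d \<in> K \<Longrightarrow> \<eta> i (c \<otimes> d) = \<eta> i c \<otimes>\<^bsub>R i\<^esub> \<eta> i d"
    and \<eta>_one: "i \<in> I \<Longrightarrow> \<eta> i \<one> = \<one>\<^bsub>R i\<^esub>"
    and \<theta>_closed: "i \<in> I \<Longrightarrow> x \<in> carrier L \<Longrightarrow> \<theta> i x \<in> carrier (R i)"
    and \<theta>_add: "i \<in> I \<Longrightarrow> x \<in> carrier L \<Longrightarrow> y \<in> carrier L \<Longrightarrow> \<theta> i (x \<oplus> y) = \<theta> i x \<oplus>\<^bsub>R i\<^esub> \<theta> i y"
    and \<theta>_smult: "i \<in> I \<Longrightarrow> c \<in> K \<Longrightarrow> x \<in> carrier L \<Longrightarrow> \<theta> i (c \<otimes> x) = \<eta> i c \<otimes>\<^bsub>R i\<^esub> \<theta> i x"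
    and recombine: "\<And>(T :: nat set) c. finite T \<Longrightarrow> (\<And>i t. i \<in> I \<Longrightarrow> t \<in> T \<Longrightarrow> c i t \<in> carrier (R i)) \<Longrightarrow>
      \<exists>w \<in> T \<rightarrow> carrier L. \<forall>x \<in> {1..k} \<rightarrow> carrier L. \<forall>\<alpha> \<in> T \<rightarrow> K.
        (\<forall>i \<in> I. finprod (R i) (\<lambda>l. \<theta> i (x l)) {1..k} = finsum (R i) (\<lambda>t. \<eta> i (\<alpha> t) \<otimes>\<^bsub>R i\<^esub> c i t) T) \<longrightarrow>
        finprod L x {1..k} = finsum L (\<lambda>t. \<alpha> t \<otimes> w t) T"
begin

lemma K_carrier: "c \<in> K \<Longrightarrow> c \<in> carrier L" using subfieldE(3)[OF K] by auto

lemmas K_closed = subringE(2,3,6,7)[OF subfieldE(1)[OF K]]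

lemma K_finprod: "(\<And>j. j \<in> A \<Longrightarrow> f j \<in> K) \<Longrightarrow> finprod L f A \<in> K"
proof (induction A rule: infinite_finite_induct)
  case (insert a A)
  then have "f \<in> A \<rightarrow> carrier L" "f a \<in> carrier L" using K_carrier by auto
  then show ?case using insert K_closed by simp
qed (use K_closed in auto)

abbreviation inputs :: "(nat \<Rightarrow> 'a) set" where "inputs \<equiv> {1..k} \<rightarrow> carrier L"

text \<open>Only the first \<open>m\<close> factors, since programs build up the product one factor
  at a time. The functions \<open>u t\<close> are valued on the side of \<open>L\<close>, so that
  one family can serve all places, and only the constants \<open>c t\<close> belong to
  \<open>R i\<close>.\<close>

definition product_formula :: "'i \<Rightarrow> nat \<Rightarrow> 't set \<Rightarrow> ('t \<Rightarrow> (nat \<Rightarrow> 'a) \<Rightarrow> 'a) \<Rightarrow> ('t \<Rightarrow> 'c) \<Rightarrow> bool" where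
  "product_formula i m T u c \<longleftrightarrow> (\<forall>t \<in> T. c t \<in> carrier (R i)) \<and> (\<forall>x \<in> inputs.
     finprod (R i) (\<lambda>l. \<theta> i (x l)) {1..m} = finsum (R i) (\<lambda>t. \<eta> i (u t x) \<otimes>\<^bsub>R i\<^esub> c t) T)"

lemma free_values_in_K:
  assumes "(S, u) \<in> free_values L K k ps" "\<forall>(S, u) \<in> set ps. \<forall>x \<in> inputs. u x \<in> K"
  shows "\<forall>x \<in> inputs. u x \<in> K"
  using assms
proof (induction rule: free_values.induct)
  case (input j a)
  then show ?case by (auto simp: linear_form_def Pi_iff)
qed (auto intro: K_closed)

lemma program_in_K:
  assumes "bilinear_program L K k ps"
  shows "\<forall>(S, u) \<in> set ps. \<forall>x \<in> inputs. u x \<in> K"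
  using assms
proof (induction rule: bilinear_program.induct)
  case (multiply ps S u T v)
  then show ?case using free_values_in_K[of _ _ ps] K_closed by fastforce
qed simp

context
  fixes i assumes i: "i \<in> I"
begin

interpretation R: field "R i" by (rule R[OF i])

definition base_inv :: "'c \<Rightarrow> 'a" where "base_inv = inv_into K (\<eta> i)"

lemma \<eta>_closed: "c \<in> K \<Longrightarrow> \<eta> i c \<in> KR i" and \<eta>_carrier: "c \<in> K \<Longrightarrow> \<eta> i c \<in> carrier (R i)"
  and base_inv_closed: "d \<in> KR i \<Longrightarrow> base_inv d \<in> K"
  and base_inv_\<eta>: "c \<in> K \<Longrightarrow> base_inv (\<eta> i c) = c" and \<eta>_base_inv: "d \<in> KR i \<Longrightarrow> \<eta> i (base_inv d) = d"
  using \<eta>_bij[OF i] KR[OF i]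
  by (auto simp: bij_betw_def base_inv_def inv_into_into f_inv_into_f)

lemma base_inv_add: "a \<in> KR i \<Longrightarrow> b \<in> KR i \<Longrightarrow> base_inv (a \<oplus>\<^bsub>R i\<^esub> b) = base_inv a \<oplus> base_inv b"
  using \<eta>_add[OF i, of "base_inv a" "base_inv b"] base_inv_\<eta>[of "base_inv a \<oplus> base_inv b"]
  by (simp add: base_inv_closed \<eta>_base_inv K_closed)

lemma base_inv_mult: "a \<in> KR i \<Longrightarrow> b \<in> KR i \<Longrightarrow> base_inv (a \<otimes>\<^bsub>R i\<^esub> b) = base_inv a \<otimes> base_inv b"
  using \<eta>_mult[OF i, of "base_inv a" "base_inv b"] base_inv_\<eta>[of "base_inv a \<otimes> base_inv b"]
  by (simp add: base_inv_closed \<eta>_base_inv K_closed)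

lemma \<eta>_finprod: "(\<And>j. j \<in> A \<Longrightarrow> f j \<in> K) \<Longrightarrow> finite A \<Longrightarrow> \<eta> i (finprod L f A) = finprod (R i) (\<lambda>j. \<eta> i (f j)) A"
proof (induction A rule: infinite_finite_induct)
  case (insert a A)
  then have "f \<in> A \<rightarrow> carrier L" "f a \<in> carrier L" using K_carrier by auto
  then show ?case using insert K_finprod[of A f] \<eta>_carrier \<eta>_mult[OF i] by auto
qed (auto simp: \<eta>_one[OF i])

lemma \<eta>_zero: "\<eta> i \<zero> = \<zero>\<^bsub>R i\<^esub>"
  using \<eta>_add[OF i K_closed(1,1)] \<eta>_carrier[OF K_closed(1)] by simp

lemma linear_form_pullback:
  assumes a: "linear_form (R i) (KR i) a"
  shows "linear_form L K (\<lambda>x. base_inv (a (\<theta> i x)))"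
proof -
  have "a y \<in> KR i" if "y \<in> carrier (R i)" for y using a that by (auto simp: linear_form_def)
  then show ?thesis
    using a \<theta>_closed[OF i] \<theta>_add[OF i] \<theta>_smult[OF i] \<eta>_closed base_inv_closed base_inv_add base_inv_mult base_inv_\<eta>
    by (auto simp: linear_form_def)
qed

lemma linear_form_zero:
  assumes a: "linear_form (R i) (KR i) a"
  shows "a \<zero>\<^bsub>R i\<^esub> = \<zero>\<^bsub>R i\<^esub>"
proof -
  have "a (\<eta> i \<zero> \<otimes>\<^bsub>R i\<^esub> \<zero>\<^bsub>R i\<^esub>) = \<eta> i \<zero> \<otimes>\<^bsub>R i\<^esub> a \<zero>\<^bsub>R i\<^esub>" "a \<zero>\<^bsub>R i\<^esub> \<in> carrier (R i)"
    using a \<eta>_closed[OF K_closed(1)] KR[OF i] by (auto simp: linear_form_def Pi_iff)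
  then show ?thesis by (simp add: \<eta>_zero)
qed

text \<open>A form applied to a partial product becomes a fixed \<open>K\<close>-combination of the
  values \<open>\<alpha> t\<close> already computed, which costs no multiplication.\<close>

lemma linear_form_combination:
  assumes a: "linear_form (R i) (KR i) a" and "finite A"
    and "\<And>t. t \<in> A \<Longrightarrow> \<alpha> t \<in> K" "\<And>t. t \<in> A \<Longrightarrow> c t \<in> carrier (R i)"
  shows "base_inv (a (finsum (R i) (\<lambda>t. \<eta> i (\<alpha> t) \<otimes>\<^bsub>R i\<^esub> c t) A)) = finsum L (\<lambda>t. base_inv (a (c t)) \<otimes> \<alpha> t) A"
  using assms(2-)
proof (induction A rule: finite_induct)
  case empty
  then show ?case using linear_form_zero[OF a] base_inv_\<eta>[OF K_closed(1)] \<eta>_zero by simp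
next
  case (insert t A)
  have aK: "a y \<in> KR i" if "y \<in> carrier (R i)" for y using a that by (auto simp: linear_form_def)
  have c: "(\<lambda>t. \<eta> i (\<alpha> t) \<otimes>\<^bsub>R i\<^esub> c t) \<in> A \<rightarrow> carrier (R i)" "\<eta> i (\<alpha> t) \<in> KR i" "\<eta> i (\<alpha> t) \<in> carrier (R i)" "c t \<in> carrier (R i)"
    using insert \<eta>_carrier \<eta>_closed by auto
  have c': "(\<lambda>t. base_inv (a (c t)) \<otimes> \<alpha> t) \<in> A \<rightarrow> carrier L" "base_inv (a (c t)) \<in> carrier L" "\<alpha> t \<in> carrier L"
    using insert aK base_inv_closed K_carrier by auto
  let ?s = "finsum (R i) (\<lambda>t. \<eta> i (\<alpha> t) \<otimes>\<^bsub>R i\<^esub> c t) A"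
  have s: "?s \<in> carrier (R i)" using c by simp
  have "a (\<eta> i (\<alpha> t) \<otimes>\<^bsub>R i\<^esub> c t \<oplus>\<^bsub>R i\<^esub> ?s) = \<eta> i (\<alpha> t) \<otimes>\<^bsub>R i\<^esub> a (c t) \<oplus>\<^bsub>R i\<^esub> a ?s"
    using a c s by (simp add: linear_form_def)
  then have "base_inv (a (\<eta> i (\<alpha> t) \<otimes>\<^bsub>R i\<^esub> c t \<oplus>\<^bsub>R i\<^esub> ?s)) = base_inv (\<eta> i (\<alpha> t) \<otimes>\<^bsub>R i\<^esub> a (c t)) \<oplus> base_inv (a ?s)"
    using base_inv_add[of "\<eta> i (\<alpha> t) \<otimes>\<^bsub>R i\<^esub> a (c t)" "a ?s"] aK s c
      \<eta>_closed[of "\<alpha> t \<otimes> base_inv (a (c t))"] \<eta>_mult[OF i, of "\<alpha> t" "base_inv (a (c t))"]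
      \<eta>_base_inv base_inv_closed K_closed insert by simp
  also have "base_inv (\<eta> i (\<alpha> t) \<otimes>\<^bsub>R i\<^esub> a (c t)) = base_inv (a (c t)) \<otimes> \<alpha> t"
    using base_inv_mult[of "\<eta> i (\<alpha> t)" "a (c t)"] c aK base_inv_\<eta> insert c' by (simp add: m_comm)
  finally show ?case using insert c c' by simp
qed

text \<open>Take for \<open>c t\<close> the sum of the \<open>c' s\<close> with
  \<open>\<tau> s = t\<close>. Each place has its own index set \<open>S\<close>, but
  \<open>recombine\<close> needs one \<open>T\<close> for all; indices outside the image of
  \<open>\<tau>\<close> get coefficient 0.\<close>

lemma regroup:
  assumes T: "finite T" and S: "finite S" and \<tau>: "\<And>s. s \<in> S \<Longrightarrow> \<tau> s \<in> T"
    and \<alpha>: "\<And>t x. t \<in> T \<Longrightarrow> x \<in> Z \<Longrightarrow> \<alpha> t x \<in> K" and c': "\<And>s. s \<in> S \<Longrightarrow> c' s \<in> carrier (R i)"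
  shows "\<exists>c. (\<forall>t \<in> T. c t \<in> carrier (R i)) \<and> (\<forall>x \<in> Z.
    finsum (R i) (\<lambda>s. \<eta> i (\<alpha> (\<tau> s) x) \<otimes>\<^bsub>R i\<^esub> c' s) S = finsum (R i) (\<lambda>t. \<eta> i (\<alpha> t x) \<otimes>\<^bsub>R i\<^esub> c t) T)"
  using S \<tau> c'
proof (induction S rule: finite_induct)
  case empty
  have "finsum (R i) (\<lambda>t. \<eta> i (\<alpha> t x) \<otimes>\<^bsub>R i\<^esub> \<zero>\<^bsub>R i\<^esub>) T = \<zero>\<^bsub>R i\<^esub>" if "x \<in> Z" for x
    using \<alpha> that \<eta>_carrier by (intro R.add.finprod_one_eqI) auto
  then show ?case by (intro exI[of _ "\<lambda>_. \<zero>\<^bsub>R i\<^esub>"]) simp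
next
  case (insert s S)
  then obtain c where c: "\<forall>t \<in> T. c t \<in> carrier (R i)" and eq: "\<forall>x \<in> Z.
    finsum (R i) (\<lambda>s. \<eta> i (\<alpha> (\<tau> s) x) \<otimes>\<^bsub>R i\<^esub> c' s) S = finsum (R i) (\<lambda>t. \<eta> i (\<alpha> t x) \<otimes>\<^bsub>R i\<^esub> c t) T"
    by auto
  define e where "e t = (if \<tau> s = t then c' s else \<zero>\<^bsub>R i\<^esub>)" for t
  have e: "e t \<in> carrier (R i)" for t using insert by (auto simp: e_def)
  have "finsum (R i) (\<lambda>s. \<eta> i (\<alpha> (\<tau> s) x) \<otimes>\<^bsub>R i\<^esub> c' s) (insert s S) =
    finsum (R i) (\<lambda>t. \<eta> i (\<alpha> t x) \<otimes>\<^bsub>R i\<^esub> (e t \<oplus>\<^bsub>R i\<^esub> c t)) T" if x: "x \<in> Z" for x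
  proof -
    have \<alpha>c: "\<eta> i (\<alpha> t x) \<in> carrier (R i)" if "t \<in> T" for t using \<alpha> x that \<eta>_carrier by simp
    have "finsum (R i) (\<lambda>t. \<eta> i (\<alpha> t x) \<otimes>\<^bsub>R i\<^esub> (e t \<oplus>\<^bsub>R i\<^esub> c t)) T =
      finsum (R i) (\<lambda>t. \<eta> i (\<alpha> t x) \<otimes>\<^bsub>R i\<^esub> e t \<oplus>\<^bsub>R i\<^esub> \<eta> i (\<alpha> t x) \<otimes>\<^bsub>R i\<^esub> c t) T"
      using \<alpha>c e c by (intro R.finsum_cong') (auto simp: R.r_distr)
    also have "\<dots> = finsum (R i) (\<lambda>t. \<eta> i (\<alpha> t x) \<otimes>\<^bsub>R i\<^esub> e t) T \<oplus>\<^bsub>R i\<^esub>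
        finsum (R i) (\<lambda>t. \<eta> i (\<alpha> t x) \<otimes>\<^bsub>R i\<^esub> c t) T"
      using \<alpha>c e c by (intro R.finsum_addf) auto
    also have "finsum (R i) (\<lambda>t. \<eta> i (\<alpha> t x) \<otimes>\<^bsub>R i\<^esub> e t) T =
        finsum (R i) (\<lambda>t. if \<tau> s = t then \<eta> i (\<alpha> t x) \<otimes>\<^bsub>R i\<^esub> c' s else \<zero>\<^bsub>R i\<^esub>) T"
      using \<alpha>c insert by (intro R.finsum_cong') (auto simp: e_def)
    also have "\<dots> = \<eta> i (\<alpha> (\<tau> s) x) \<otimes>\<^bsub>R i\<^esub> c' s"
      using \<alpha>c insert T by (intro R.finsum_singleton) auto
    also have "finsum (R i) (\<lambda>t. \<eta> i (\<alpha> t x) \<otimes>\<^bsub>R i\<^esub> c t) T = finsum (R i) (\<lambda>s. \<eta> i (\<alpha> (\<tau> s) x) \<otimes>\<^bsub>R i\<^esub> c' s) S"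
      using eq x by simp
    also have "\<eta> i (\<alpha> (\<tau> s) x) \<otimes>\<^bsub>R i\<^esub> c' s \<oplus>\<^bsub>R i\<^esub> finsum (R i) (\<lambda>s. \<eta> i (\<alpha> (\<tau> s) x) \<otimes>\<^bsub>R i\<^esub> c' s) S =
        finsum (R i) (\<lambda>s. \<eta> i (\<alpha> (\<tau> s) x) \<otimes>\<^bsub>R i\<^esub> c' s) (insert s S)"
      using insert \<alpha>c by (subst R.finsum_insert) auto
    finally show ?thesis by simp
  qed
  then show ?case using e c by (intro exI[of _ "\<lambda>t. e t \<oplus>\<^bsub>R i\<^esub> c t"]) auto
qed

lemma product_formula_reindex:
  assumes "product_formula i m S u c'" "finite T" "finite S" "\<And>s. s \<in> S \<Longrightarrow> \<tau> s \<in> T"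
    and \<alpha>: "\<And>t x. t \<in> T \<Longrightarrow> x \<in> inputs \<Longrightarrow> \<alpha> t x \<in> K"
    and u: "\<And>s x. s \<in> S \<Longrightarrow> x \<in> inputs \<Longrightarrow> u s x = \<alpha> (\<tau> s) x"
  shows "\<exists>c. product_formula i m T \<alpha> c"
proof -
  have c': "c' s \<in> carrier (R i)" if "s \<in> S" for s using assms(1) that by (simp add: product_formula_def)
  have "finsum (R i) (\<lambda>s. \<eta> i (u s x) \<otimes>\<^bsub>R i\<^esub> c' s) S = finsum (R i) (\<lambda>s. \<eta> i (\<alpha> (\<tau> s) x) \<otimes>\<^bsub>R i\<^esub> c' s) S"
    if "x \<in> inputs" for x
    using that u c' \<alpha> assms(4) \<eta>_carrier by (intro R.finsum_cong') auto
  then show ?thesis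
    using regroup[of T S \<tau> inputs \<alpha> c', OF assms(2-4) \<alpha> c'] assms(1) by (simp add: product_formula_def)
qed

text \<open>One factor at a time: the coordinates of the product of \<open>m\<close> factors are free values of type
  \<open>{1..m}\<close>, and \<open>s\<close> multiplications bring in the next factor.\<close>

lemma bilinear_program_product:
  assumes dec: "tensor_decomposition (R i) (KR i) 2 s" and m: "1 \<le> m" "Suc m \<le> k"
  shows "\<exists>ps u c. bilinear_program L K k ps \<and> length ps = m * s \<and>
    (\<forall>t \<in> {1..s}. ({1..Suc m}, u t) \<in> set ps) \<and> product_formula i (Suc m) {1..s} u c"
proof -
  obtain a c where a: "\<forall>t\<in>{1..s}. \<forall>j\<in>{1..2::nat}. linear_form (R i) (KR i) (a t j)"
    and c: "\<forall>t\<in>{1..s}. c t \<in> carrier (R i)"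
    and eq: "\<forall>x\<in>{1..2::nat} \<rightarrow> carrier (R i). finprod (R i) x {1..2} =
      finsum (R i) (\<lambda>t. finprod (R i) (\<lambda>j. a t j (x j)) {1..2} \<otimes>\<^bsub>R i\<^esub> c t) {1..s::nat}"
    using dec unfolding tensor_decomposition_def by (elim exE conjE) (rule that)
  have a12: "linear_form (R i) (KR i) (a t 1)" "linear_form (R i) (KR i) (a t (Suc 1))" if "t \<in> {1..s}" for t
    using a that by auto
  have aK: "a t j y \<in> KR i" "a t j y \<in> carrier (R i)" if "t \<in> {1..s}" "j \<in> {1, Suc 1}" "y \<in> carrier (R i)" for t j y
    using a12[OF that(1)] that KR[OF i] by (auto simp: linear_form_def)
  define A where "A t y = base_inv (a t 1 y)" for t y
  define B where "B t y = base_inv (a t (Suc 1) y)" for t y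
  have AB: "A t y \<in> K" "B t y \<in> K" if "t \<in> {1..s}" "y \<in> carrier (R i)" for t y
    using aK[OF that(1) _ that(2)] base_inv_closed by (auto simp: A_def B_def)
  have prod2: "y \<otimes>\<^bsub>R i\<^esub> z = finsum (R i) (\<lambda>t. \<eta> i (A t y \<otimes> B t z) \<otimes>\<^bsub>R i\<^esub> c t) {1..s}"
    if yz: "y \<in> carrier (R i)" "z \<in> carrier (R i)" for y z
  proof -
    let ?x = "\<lambda>j. if j = (1::nat) then y else z"
    have two: "{1..2::nat} = {1, Suc 1}" by auto
    have "y \<otimes>\<^bsub>R i\<^esub> z = finprod (R i) ?x {1..2}" unfolding two using yz by simp
    also have "\<dots> = finsum (R i) (\<lambda>t. finprod (R i) (\<lambda>j. a t j (?x j)) {1..2} \<otimes>\<^bsub>R i\<^esub> c t) {1..s}"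
      using yz by (intro eq[rule_format]) auto
    also have "\<dots> = finsum (R i) (\<lambda>t. \<eta> i (A t y \<otimes> B t z) \<otimes>\<^bsub>R i\<^esub> c t) {1..s}"
    proof (intro R.finsum_cong' refl)
      fix t assume t: "t \<in> {1..s}"
      have "\<eta> i (A t y \<otimes> B t z) = a t 1 y \<otimes>\<^bsub>R i\<^esub> a t (Suc 1) z"
        using \<eta>_mult[OF i AB(1)[OF t yz(1)] AB(2)[OF t yz(2)]] \<eta>_base_inv aK[OF t] yz by (simp add: A_def B_def)
      moreover have "finprod (R i) (\<lambda>j. a t j (?x j)) {1..2} = a t 1 y \<otimes>\<^bsub>R i\<^esub> a t (Suc 1) z"
        unfolding two using aK[OF t] yz by simp
      ultimately show "finprod (R i) (\<lambda>j. a t j (?x j)) {1..2} \<otimes>\<^bsub>R i\<^esub> c t = \<eta> i (A t y \<otimes> B t z) \<otimes>\<^bsub>R i\<^esub> c t"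
        by simp
    next
      show "(\<lambda>t. \<eta> i (A t y \<otimes> B t z) \<otimes>\<^bsub>R i\<^esub> c t) \<in> {1..s} \<rightarrow> carrier (R i)"
        using AB yz c \<eta>_carrier K_closed by auto
    qed
    finally show ?thesis .
  qed
  have formA: "linear_form L K (\<lambda>x. A t (\<theta> i x))" and formB: "linear_form L K (\<lambda>x. B t (\<theta> i x))" if "t \<in> {1..s}" for t
    unfolding A_def B_def using linear_form_pullback a12 that by auto
  have \<theta>x: "\<theta> i (x l) \<in> carrier (R i)" if "x \<in> inputs" "l \<in> {1..k}" for x l
    using \<theta>_closed[OF i] that by (auto simp: Pi_iff)
  have prod_Suc: "finprod (R i) (\<lambda>l. \<theta> i (x l)) {1..Suc j} = finprod (R i) (\<lambda>l. \<theta> i (x l)) {1..j} \<otimes>\<^bsub>R i\<^esub> \<theta> i (x (Suc j))"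
    "finprod (R i) (\<lambda>l. \<theta> i (x l)) {1..j} \<in> carrier (R i)"
    if "x \<in> inputs" "Suc j \<le> k" for x j
  proof -
    have f: "(\<lambda>l. \<theta> i (x l)) \<in> {1..j} \<rightarrow> carrier (R i)" using \<theta>x[OF that(1)] that(2) by auto
    then show c: "finprod (R i) (\<lambda>l. \<theta> i (x l)) {1..j} \<in> carrier (R i)" by simp
    have S: "{1..Suc j} = insert (Suc j) {1..j}" by auto
    show "finprod (R i) (\<lambda>l. \<theta> i (x l)) {1..Suc j} = finprod (R i) (\<lambda>l. \<theta> i (x l)) {1..j} \<otimes>\<^bsub>R i\<^esub> \<theta> i (x (Suc j))"
      unfolding S using f c \<theta>x[OF that(1), of "Suc j"] that(2) by (subst R.finprod_insert) (auto simp: R.m_comm)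
  qed
  have add_factor: "\<exists>qs. bilinear_program L K k (qs @ ps) \<and> length qs = s \<and>
      (\<forall>t \<in> {1..s}. ({1..Suc j}, \<lambda>x. f t x \<otimes> B t (\<theta> i (x (Suc j)))) \<in> set qs)"
    if "bilinear_program L K k ps" "Suc j \<le> k" "\<And>t. t \<in> {1..s} \<Longrightarrow> ({1..j}, f t) \<in> free_values L K k ps" for ps j f
  proof -
    have "{1..Suc j} = {1..j} \<union> {Suc j}" by auto
    then show ?thesis
      using bilinear_program_multiply_many[OF that(1), of "{1..j}" "{Suc j}" s f "\<lambda>t x. B t (\<theta> i (x (Suc j)))"]
        free_values.input[of "Suc j" k L K _ ps, OF _ formB] that by auto
  qed
  \<comment> \<open>The constants \<open>c\<close> stay outside the induction: every round expands a
    product of two elements by the same decomposition.\<close>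
  have "\<exists>ps u. bilinear_program L K k ps \<and> length ps = m * s \<and>
    (\<forall>t \<in> {1..s}. ({1..Suc m}, u t) \<in> set ps) \<and> product_formula i (Suc m) {1..s} u c"
    using m
  proof (induction m rule: dec_induct)
    case base
    have "({1..1}, \<lambda>x. A t (\<theta> i (x 1))) \<in> free_values L K k []" if "t \<in> {1..s}" for t
      using free_values.input[of 1 k L K "\<lambda>x. A t (\<theta> i x)" "[]"] formA[OF that] base by simp
    from add_factor[of "[]" 1 "\<lambda>t x. A t (\<theta> i (x 1))", OF bilinear_program.start base this]
    obtain qs where qs: "bilinear_program L K k qs" "length qs = s"
      "\<forall>t \<in> {1..s}. ({1..Suc 1}, \<lambda>x. A t (\<theta> i (x 1)) \<otimes> B t (\<theta> i (x (Suc 1)))) \<in> set qs" by auto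
    have "finprod (R i) (\<lambda>l. \<theta> i (x l)) {1..Suc 1} =
        finsum (R i) (\<lambda>t. \<eta> i (A t (\<theta> i (x 1)) \<otimes> B t (\<theta> i (x (Suc 1)))) \<otimes>\<^bsub>R i\<^esub> c t) {1..s}" if x: "x \<in> inputs" for x
    proof -
      have c1: "\<theta> i (x 1) \<in> carrier (R i)" "\<theta> i (x (Suc 1)) \<in> carrier (R i)" using \<theta>x[OF x] base by auto
      have "finprod (R i) (\<lambda>l. \<theta> i (x l)) {1..1} = \<theta> i (x 1)" using c1 by simp
      then show ?thesis using prod_Suc(1)[OF x base] prod2[OF c1] by simp
    qed
    then show ?case
      using qs by (intro exI[of _ qs] exI[of _ "\<lambda>t x. A t (\<theta> i (x 1)) \<otimes> B t (\<theta> i (x (Suc 1)))"])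
        (simp add: product_formula_def c)
  next
    case (step m)
    then obtain ps u where ps: "bilinear_program L K k ps" "length ps = m * s"
      and u: "\<forall>t \<in> {1..s}. ({1..Suc m}, u t) \<in> set ps"
      and pr: "\<forall>x \<in> inputs. finprod (R i) (\<lambda>l. \<theta> i (x l)) {1..Suc m} = finsum (R i) (\<lambda>t. \<eta> i (u t x) \<otimes>\<^bsub>R i\<^esub> c t) {1..s}"
      by (auto simp: product_formula_def)
    have uK: "u t x \<in> K" if "t \<in> {1..s}" "x \<in> inputs" for t x
      using program_in_K[OF ps(1)] u that by fastforce
    let ?y = "\<lambda>x. finprod (R i) (\<lambda>l. \<theta> i (x l)) {1..Suc m}"
    \<comment> \<open>The partial product is a combination of the \<open>c t'\<close> with
      coefficients \<open>u t' x\<close>, so its image under \<open>A t\<close> is a linear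
      combination of results of type \<open>{1..Suc m}\<close>.\<close>
    have "\<exists>U. ({1..Suc m}, U) \<in> free_values L K k ps \<and> (\<forall>x \<in> inputs. U x = A t (?y x))" if t: "t \<in> {1..s}" for t
    proof -
      have "\<exists>U. ({1..Suc m}, U) \<in> free_values L K k ps \<and>
          (\<forall>x \<in> inputs. U x = finsum L (\<lambda>t'. A t (c t') \<otimes> u t' x) {1..s})"
        by (rule free_values_finsum[OF field_axioms])
          (use t AB c uK K_carrier u in \<open>auto intro: free_values.product\<close>)
      moreover have "A t (?y x) = finsum L (\<lambda>t'. A t (c t') \<otimes> u t' x) {1..s}" if x: "x \<in> inputs" for x
        using linear_form_combination[OF a12(1)[OF t], of "{1..s}" "\<lambda>t. u t x" c] uK x c pr by (simp add: A_def)
      ultimately show ?thesis by fastforce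
    qed
    then obtain U where U: "\<And>t. t \<in> {1..s} \<Longrightarrow> ({1..Suc m}, U t) \<in> free_values L K k ps"
      and Uy: "\<And>t x. t \<in> {1..s} \<Longrightarrow> x \<in> inputs \<Longrightarrow> U t x = A t (?y x)" by metis
    obtain qs where qs: "bilinear_program L K k (qs @ ps)" "length qs = s"
      "\<forall>t \<in> {1..s}. ({1..Suc (Suc m)}, \<lambda>x. U t x \<otimes> B t (\<theta> i (x (Suc (Suc m))))) \<in> set qs"
      using add_factor[of ps "Suc m" U, OF ps(1) step.prems U]
      by blast
    have "finprod (R i) (\<lambda>l. \<theta> i (x l)) {1..Suc (Suc m)} =
        finsum (R i) (\<lambda>t. \<eta> i (U t x \<otimes> B t (\<theta> i (x (Suc (Suc m))))) \<otimes>\<^bsub>R i\<^esub> c t) {1..s}" if x: "x \<in> inputs" for x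
    proof -
      have z: "\<theta> i (x (Suc (Suc m))) \<in> carrier (R i)" using \<theta>x[OF x] step.prems by auto
      note y = prod_Suc[OF x step.prems]
      have "finprod (R i) (\<lambda>l. \<theta> i (x l)) {1..Suc (Suc m)} =
        finsum (R i) (\<lambda>t. \<eta> i (A t (?y x) \<otimes> B t (\<theta> i (x (Suc (Suc m))))) \<otimes>\<^bsub>R i\<^esub> c t) {1..s}"
        unfolding y(1) using prod2[OF y(2) z] .
      also have "\<dots> = finsum (R i) (\<lambda>t. \<eta> i (U t x \<otimes> B t (\<theta> i (x (Suc (Suc m))))) \<otimes>\<^bsub>R i\<^esub> c t) {1..s}"
        using Uy x AB y(2) z c \<eta>_carrier K_closed by (intro R.finsum_cong') auto
      finally show ?thesis .
    qed
    then show ?case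
      using qs ps(2) by (intro exI[of _ "qs @ ps"] exI[of _ "\<lambda>t x. U t x \<otimes> B t (\<theta> i (x (Suc (Suc m))))"])
        (auto simp: product_formula_def c)
  qed
  then show ?thesis by blast
qed

end

lemma recombine_products:
  assumes T: "finite (T :: nat set)" and \<alpha>: "\<And>t x. t \<in> T \<Longrightarrow> x \<in> inputs \<Longrightarrow> \<alpha> t x \<in> K"
    and ex: "\<And>i. i \<in> I \<Longrightarrow> \<exists>d. product_formula i k T \<alpha> d"
  shows "\<exists>w \<in> T \<rightarrow> carrier L. \<forall>x \<in> inputs. finprod L x {1..k} = finsum L (\<lambda>t. \<alpha> t x \<otimes> w t) T"
proof -
  have "\<forall>i\<in>I. \<exists>d. product_formula i k T \<alpha> d" using ex by blast
  from bchoice[OF this] obtain d where d: "\<forall>i\<in>I. product_formula i k T \<alpha> (d i)" by blast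
  have "d i t \<in> carrier (R i)" if "i \<in> I" "t \<in> T" for i t using d that by (simp add: product_formula_def)
  from recombine[OF T, of d, OF this] obtain w where w: "w \<in> T \<rightarrow> carrier L"
    and rec: "\<forall>x \<in> inputs. \<forall>\<alpha> \<in> T \<rightarrow> K.
        (\<forall>i \<in> I. finprod (R i) (\<lambda>l. \<theta> i (x l)) {1..k} = finsum (R i) (\<lambda>t. \<eta> i (\<alpha> t) \<otimes>\<^bsub>R i\<^esub> d i t) T) \<longrightarrow>
        finprod L x {1..k} = finsum L (\<lambda>t. \<alpha> t \<otimes> w t) T" by blast
  have "finprod L x {1..k} = finsum L (\<lambda>t. \<alpha> t x \<otimes> w t) T" if x: "x \<in> inputs" for x
  proof -
    have \<alpha>T: "(\<lambda>t. \<alpha> t x) \<in> T \<rightarrow> K" using \<alpha> x by auto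
    have "\<forall>i \<in> I. finprod (R i) (\<lambda>l. \<theta> i (x l)) {1..k} = finsum (R i) (\<lambda>t. \<eta> i (\<alpha> t x) \<otimes>\<^bsub>R i\<^esub> d i t) T"
      using d x by (simp add: product_formula_def)
    then show ?thesis by (rule rec[THEN bspec, OF x, THEN bspec, OF \<alpha>T, THEN mp])
  qed
  then show ?thesis using w by blast
qed

lemma tensor_decomposition_interpolation:
  assumes dec: "\<And>i. i \<in> I \<Longrightarrow> tensor_decomposition (R i) (KR i) k (s i)"
  shows "tensor_decomposition L K k (\<Sum>i\<in>I. s i)"
proof -
  define D where "D i a c \<longleftrightarrow> (\<forall>t\<in>{1..s i}. \<forall>j\<in>{1..k}. linear_form (R i) (KR i) (a t j)) \<and>
      (\<forall>t\<in>{1..s i}. c t \<in> carrier (R i)) \<and>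
      (\<forall>x\<in>{1..k} \<rightarrow> carrier (R i). finprod (R i) x {1..k} =
        finsum (R i) (\<lambda>t. finprod (R i) (\<lambda>j. a t j (x j)) {1..k} \<otimes>\<^bsub>R i\<^esub> c t) {1..s i})" for i a c
  have "\<forall>i\<in>I. \<exists>a. \<exists>c. D i a c" using dec unfolding tensor_decomposition_def D_def by blast
  from bchoice[OF this] obtain a where "\<forall>i\<in>I. \<exists>c. D i (a i) c" by blast
  from bchoice[OF this] obtain c where D: "\<forall>i\<in>I. D i (a i) (c i)" by blast
  have a: "linear_form (R i) (KR i) (a i t j)" if "i \<in> I" "t \<in> {1..s i}" "j \<in> {1..k}" for i t j
    using D that by (simp add: D_def)
  have c: "c i t \<in> carrier (R i)" if "i \<in> I" "t \<in> {1..s i}" for i t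
    using D that by (simp add: D_def)
  have eq: "finprod (R i) x {1..k} =
        finsum (R i) (\<lambda>t. finprod (R i) (\<lambda>j. a i t j (x j)) {1..k} \<otimes>\<^bsub>R i\<^esub> c i t) {1..s i}"
    if "i \<in> I" "x \<in> {1..k} \<rightarrow> carrier (R i)" for i x
    using D that unfolding D_def by blast
  let ?T0 = "SIGMA i:I. {1..s i}"
  define T where "T = {1..(\<Sum>i\<in>I. s i)}"
  have "finite ?T0" "card ?T0 = (\<Sum>i\<in>I. s i)" using finite_I by auto
  \<comment> \<open>\<open>recombine\<close> is about sets of naturals, so the pairs of a place and
    a summand are numbered by \<open>h\<close>.\<close>
  then obtain h where h: "bij_betw h T ?T0" unfolding T_def using ex_bij_betw_nat_finite_1 by metis
  define A where "A t j y = base_inv (fst (h t)) (a (fst (h t)) (snd (h t)) j (\<theta> (fst (h t)) y))" for t j y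
  have hT: "fst (h t) \<in> I" "snd (h t) \<in> {1..s (fst (h t))}" if "t \<in> T" for t
  proof -
    have "h t \<in> ?T0" using h that by (auto simp: bij_betw_def)
    then show "fst (h t) \<in> I" "snd (h t) \<in> {1..s (fst (h t))}" by auto
  qed
  have A: "linear_form L K (A t j)" if "t \<in> T" "j \<in> {1..k}" for t j
    unfolding A_def using linear_form_pullback hT[OF that(1)] a that(2) by blast
  have finT: "finite T" by (simp add: T_def)
  define \<alpha> where "\<alpha> t x = finprod L (\<lambda>j. A t j (x j)) {1..k}" for t x
  have AK: "A t j (x j) \<in> K" if "t \<in> T" "j \<in> {1..k}" "x \<in> inputs" for t j x
    using A[OF that(1,2)] that by (auto simp: linear_form_def Pi_iff)
  have \<alpha>K: "\<alpha> t x \<in> K" if "t \<in> T" "x \<in> inputs" for t x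
    unfolding \<alpha>_def using AK that by (intro K_finprod) auto
  have ex: "\<exists>d. product_formula i k T \<alpha> d" if i: "i \<in> I" for i
  proof -
    interpret R: field "R i" by (rule R[OF i])
    \<comment> \<open>The number given to summand \<open>t\<close> at place
      \<open>i\<close>.\<close>
    define \<tau> where "\<tau> t = inv_into T h (i, t)" for t
    have \<tau>: "\<tau> t \<in> T" "h (\<tau> t) = (i, t)" if "t \<in> {1..s i}" for t
      using h that i by (auto simp: \<tau>_def bij_betw_def inv_into_into f_inv_into_f)
    have "finprod (R i) (\<lambda>l. \<theta> i (x l)) {1..k} =
        finsum (R i) (\<lambda>t. \<eta> i (\<alpha> (\<tau> t) x) \<otimes>\<^bsub>R i\<^esub> c i t) {1..s i}" if x: "x \<in> inputs" for x
    proof -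
      have \<theta>x: "(\<lambda>l. \<theta> i (x l)) \<in> {1..k} \<rightarrow> carrier (R i)" using \<theta>_closed[OF i] x by auto
      have "finprod (R i) (\<lambda>j. a i t j (\<theta> i (x j))) {1..k} = \<eta> i (\<alpha> (\<tau> t) x)" if t: "t \<in> {1..s i}" for t
      proof -
        have "\<eta> i (\<alpha> (\<tau> t) x) = finprod (R i) (\<lambda>j. \<eta> i (A (\<tau> t) j (x j))) {1..k}"
          unfolding \<alpha>_def using AK \<tau>[OF t] x by (intro \<eta>_finprod[OF i]) auto
        also have "\<dots> = finprod (R i) (\<lambda>j. a i t j (\<theta> i (x j))) {1..k}"
        proof (intro R.finprod_cong' refl)
          have aK: "a i t j (\<theta> i (x j)) \<in> KR i" if "j \<in> {1..k}" for j
            using a[OF i t that] \<theta>x that by (auto simp: linear_form_def Pi_iff)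
          then show "(\<lambda>j. a i t j (\<theta> i (x j))) \<in> {1..k} \<rightarrow> carrier (R i)" using KR[OF i] by auto
          fix j assume "j \<in> {1..k}"
          then show "\<eta> i (A (\<tau> t) j (x j)) = a i t j (\<theta> i (x j))"
            using aK \<tau>[OF t] \<eta>_base_inv[OF i] by (simp add: A_def)
        qed
        finally show ?thesis by simp
      qed
      then have "finsum (R i) (\<lambda>t. finprod (R i) (\<lambda>j. a i t j (\<theta> i (x j))) {1..k} \<otimes>\<^bsub>R i\<^esub> c i t) {1..s i} =
          finsum (R i) (\<lambda>t. \<eta> i (\<alpha> (\<tau> t) x) \<otimes>\<^bsub>R i\<^esub> c i t) {1..s i}"
        using c[OF i] \<tau> \<alpha>K x \<eta>_carrier[OF i] by (intro R.finsum_cong') auto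
      then show ?thesis using eq[OF i \<theta>x] by simp
    qed
    then have "product_formula i k {1..s i} (\<lambda>t. \<alpha> (\<tau> t)) (c i)" using c[OF i] by (simp add: product_formula_def)
    then show ?thesis by (rule product_formula_reindex[OF i _ finT _ \<tau>(1) \<alpha>K]) auto
  qed
  have "\<exists>w \<in> T \<rightarrow> carrier L. \<forall>x \<in> inputs. finprod L x {1..k} = finsum L (\<lambda>t. \<alpha> t x \<otimes> w t) T"
    by (rule recombine_products[OF finT \<alpha>K ex])
  then obtain w where w: "w \<in> T \<rightarrow> carrier L"
    and rec: "\<forall>x \<in> inputs. finprod L x {1..k} = finsum L (\<lambda>t. \<alpha> t x \<otimes> w t) T"
    by (elim bexE) (rule that)
  show ?thesis
  proof (rule tensor_decompositionI[OF finT _ subfieldE(3)[OF K], where a = A and c = w])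
    fix x assume x: "x \<in> inputs"
    have "finprod L x {1..k} = finsum L (\<lambda>t. \<alpha> t x \<otimes> w t) T"
      using rec x by (rule bspec)
    then show "finprod L x {1..k} = finsum L (\<lambda>t. finprod L (\<lambda>j. A t j (x j)) {1..k} \<otimes> w t) T"
      by (simp add: \<alpha>_def)
  qed (use A w T_def in auto)
qed

lemma bilinear_computable_interpolation:
  assumes k: "k \<ge> 2" and dec: "\<And>i. i \<in> I \<Longrightarrow> tensor_decomposition (R i) (KR i) 2 (s i)"
  shows "bilinear_computable L K k ((k - 1) * (\<Sum>i\<in>I. s i))"
proof -
  have "\<exists>ps. bilinear_program L K k ps \<and> length ps = (k - 1) * (\<Sum>i\<in>J. s i) \<and>
      (\<forall>i\<in>J. \<exists>u c. (\<forall>t \<in> {1..s i}. ({1..k}, u t) \<in> set ps) \<and> product_formula i k {1..s i} u c)"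
    if "J \<subseteq> I" for J
    using finite_subset[OF that finite_I] that
  proof (induction J rule: finite_induct)
    case empty
    then show ?case by (intro exI[of _ "[]"]) (simp add: bilinear_program.start)
  next
    case (insert i J)
    then obtain ps where ps: "bilinear_program L K k ps" "length ps = (k - 1) * (\<Sum>i\<in>J. s i)"
      and J: "\<forall>i\<in>J. \<exists>u c. (\<forall>t \<in> {1..s i}. ({1..k}, u t) \<in> set ps) \<and> product_formula i k {1..s i} u c"
      by auto
    have i: "i \<in> I" using insert by simp
    have Suc: "Suc (k - 1) = k" using k by simp
    have k1: "1 \<le> k - 1" "Suc (k - 1) \<le> k" using k by auto
    from bilinear_program_product[OF i dec[OF i] k1, unfolded Suc] obtain qs u c where qs: "bilinear_program L K k qs" "length qs = (k - 1) * s i"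
      "\<forall>t \<in> {1..s i}. ({1..k}, u t) \<in> set qs" "product_formula i k {1..s i} u c"
      by (elim exE conjE) (rule that)
    have "\<exists>u c. (\<forall>t \<in> {1..s j}. ({1..k}, u t) \<in> set (qs @ ps)) \<and> product_formula j k {1..s j} u c"
      if j: "j \<in> insert i J" for j
    proof (cases "j = i")
      case True
      then show ?thesis using qs by (intro exI[of _ u] exI[of _ c]) simp
    next
      case False
      then show ?thesis using J j by fastforce
    qed
    then show ?case
      using bilinear_program_append[OF qs(1) ps(1)] qs(2) ps(2) insert.hyps
      by (intro exI[of _ "qs @ ps"]) (auto simp: algebra_simps)
  qed
  from this[OF subset_refl] obtain ps where ps: "bilinear_program L K k ps" "length ps = (k - 1) * (\<Sum>i\<in>I. s i)"
    and pI: "\<And>i. i \<in> I \<Longrightarrow> \<exists>u c. (\<forall>t \<in> {1..s i}. ({1..k}, u t) \<in> set ps) \<and> product_formula i k {1..s i} u c"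
    by auto
  \<comment> \<open>Only results that involve all \<open>k\<close> inputs may enter the final
    combination; the other ones are partial products.\<close>
  define T where "T = {t. t < length ps \<and> fst (ps ! t) = {1..k}}"
  have finT: "finite T" by (simp add: T_def)
  define \<alpha> where "\<alpha> t x = snd (ps ! t) x" for t x
  have \<alpha>K: "\<alpha> t x \<in> K" if "t \<in> T" "x \<in> inputs" for t x
  proof -
    have "ps ! t \<in> set ps" using that by (simp add: T_def)
    then show ?thesis using program_in_K[OF ps(1)] that by (fastforce simp: \<alpha>_def split_beta)
  qed
  have ex: "\<exists>d. product_formula i k T \<alpha> d" if i: "i \<in> I" for i
  proof -
    obtain u c where u: "\<forall>t \<in> {1..s i}. ({1..k}, u t) \<in> set ps" and pf: "product_formula i k {1..s i} u c"
      using pI[OF i] by blast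
    have "\<forall>t\<in>{1..s i}. \<exists>j. j < length ps \<and> ps ! j = ({1..k}, u t)" using u by (simp add: in_set_conv_nth)
    then obtain \<tau> where \<tau>: "\<And>t. t \<in> {1..s i} \<Longrightarrow> \<tau> t < length ps \<and> ps ! \<tau> t = ({1..k}, u t)" by metis
    show ?thesis
      by (rule product_formula_reindex[OF i pf finT, of \<tau>]) (use \<tau> \<alpha>K in \<open>auto simp: T_def \<alpha>_def\<close>)
  qed
  have "\<exists>w \<in> T \<rightarrow> carrier L. \<forall>x \<in> inputs. finprod L x {1..k} = finsum L (\<lambda>t. \<alpha> t x \<otimes> w t) T"
    by (rule recombine_products[OF finT \<alpha>K ex])
  then obtain w where w: "w \<in> T \<rightarrow> carrier L"
    and rec: "\<forall>x \<in> inputs. finprod L x {1..k} = finsum L (\<lambda>t. \<alpha> t x \<otimes> w t) T"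
    by (elim bexE) (rule that)
  \<comment> \<open>\<open>bilinear_computable\<close> asks for a coefficient in the carrier for
    every result, also for the partial products outside \<open>T\<close>.\<close>
  define c where "c t = (if t \<in> T then w t else \<zero>)" for t
  have "finprod L x {1..k} = finsum L (\<lambda>t. snd (ps ! t) x \<otimes> c t) T" if x: "x \<in> inputs" for x
  proof -
    have "finprod L x {1..k} = finsum L (\<lambda>t. \<alpha> t x \<otimes> w t) T"
      using rec x by (rule bspec)
    also have "\<dots> = finsum L (\<lambda>t. snd (ps ! t) x \<otimes> c t) T"
      using w \<alpha>K[OF _ x] K_carrier by (intro finsum_cong') (auto simp: c_def \<alpha>_def Pi_iff)
    finally show ?thesis .
  qed
  then show ?thesis unfolding bilinear_computable_def
    using ps w by (intro exI[of _ ps] exI[of _ c]) (auto simp: T_def c_def)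
qed

end

section \<open>Evaluation at places\<close>

text \<open>The target \<open>L\<close> is left open so that evaluation may take values in the
  residue field or in its model \<open>GF (q ^ m)\<close>.\<close>

locale evaluation = F: field F + L: field L
  for F :: "('a, 'b) ring_scheme" and L :: "('c, 'd) ring_scheme" +
  fixes K V :: "'a set" and e :: "'a \<Rightarrow> 'c"
  assumes V: "subring V F" and K: "subfield K F" and K_V: "K \<subseteq> V"
    and hom: "e \<in> ring_hom (F\<lparr>carrier := V\<rparr>) L"
begin

lemma V_carrier: "f \<in> V \<Longrightarrow> f \<in> carrier F" using subringE(1)[OF V] by auto

lemmas V_closed = subringE(2,3,5,6,7)[OF V]

lemma e_closed: "f \<in> V \<Longrightarrow> e f \<in> carrier L"
  and e_add: "f \<in> V \<Longrightarrow> g \<in> V \<Longrightarrow> e (f \<oplus>\<^bsub>F\<^esub> g) = e f \<oplus>\<^bsub>L\<^esub> e g"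
  and e_mult: "f \<in> V \<Longrightarrow> g \<in> V \<Longrightarrow> e (f \<otimes>\<^bsub>F\<^esub> g) = e f \<otimes>\<^bsub>L\<^esub> e g"
  and e_one: "e \<one>\<^bsub>F\<^esub> = \<one>\<^bsub>L\<^esub>"
  using ring_hom_memE[OF hom] by auto

lemma e_zero: "e \<zero>\<^bsub>F\<^esub> = \<zero>\<^bsub>L\<^esub>"
  using e_add[OF V_closed(1,1)] e_closed[OF V_closed(1)] by simp

lemma e_minus:
  assumes "f \<in> V" "g \<in> V" shows "e (f \<ominus>\<^bsub>F\<^esub> g) = e f \<ominus>\<^bsub>L\<^esub> e g"
proof -
  have "e g \<oplus>\<^bsub>L\<^esub> e (\<ominus>\<^bsub>F\<^esub> g) = \<zero>\<^bsub>L\<^esub>"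
    using e_add[OF assms(2) V_closed(3)[OF assms(2)]] e_zero assms V_carrier by (simp add: F.r_neg)
  then have "e (\<ominus>\<^bsub>F\<^esub> g) = \<ominus>\<^bsub>L\<^esub> e g"
    using e_closed assms V_closed(3) by (metis L.minus_equality L.a_comm)
  then show ?thesis using assms e_add V_closed(3) by (simp add: a_minus_def)
qed

lemma e_finprod:
  assumes "finite A" "f \<in> A \<rightarrow> V"
  shows "finprod F f A \<in> V" "e (finprod F f A) = finprod L (\<lambda>l. e (f l)) A"
proof -
  have "finprod F f A \<in> V \<and> e (finprod F f A) = finprod L (\<lambda>l. e (f l)) A"
    using assms
  proof (induction A rule: finite_induct)
    case (insert a A)
    have "f \<in> A \<rightarrow> carrier F" "f a \<in> carrier F" "f a \<in> V" using insert V_carrier by auto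
    then show ?case using insert V_closed e_mult e_closed by (simp add: Pi_iff)
  qed (auto simp: e_one V_closed)
  then show "finprod F f A \<in> V" "e (finprod F f A) = finprod L (\<lambda>l. e (f l)) A" by auto
qed

lemma e_finsum:
  assumes "finite A" "f \<in> A \<rightarrow> V"
  shows "finsum F f A \<in> V" "e (finsum F f A) = finsum L (\<lambda>l. e (f l)) A"
proof -
  have "finsum F f A \<in> V \<and> e (finsum F f A) = finsum L (\<lambda>l. e (f l)) A"
    using assms
  proof (induction A rule: finite_induct)
    case (insert a A)
    have "f \<in> A \<rightarrow> carrier F" "f a \<in> carrier F" "f a \<in> V" using insert V_carrier by auto
    then show ?case using insert V_closed e_add e_closed by (simp add: Pi_iff)
  qed (auto simp: e_zero V_closed)
  then show "finsum F f A \<in> V" "e (finsum F f A) = finsum L (\<lambda>l. e (f l)) A" by auto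
qed

lemma e_K_inj: "inj_on e K" and e_K_subfield: "subfield (e ` K) L"
proof -
  have rV: "ring (F\<lparr>carrier := V\<rparr>)" using F.subring_is_ring[OF V] .
  interpret h: ring_hom_ring "F\<lparr>carrier := V\<rparr>" L e
    using ring_hom_ringI2[OF rV L.ring_axioms hom] .
  have "field (F\<lparr>carrier := V\<rparr>\<lparr>carrier := K\<rparr>)" using F.subfield_iff(2)[OF K] by simp
  then have "subfield K (F\<lparr>carrier := V\<rparr>)" using h.R.subfield_iff(1)[of K] K_V by simp
  then show "inj_on e K" "subfield (e ` K) L" using h.img_is_subfield L.one_not_zero by auto
qed

text \<open>The constant in \<open>K\<close> with a prescribed value. Going back to \<open>K\<close>
  at \<open>Q\<close> and then evaluating at another place identifies the base fields of the two
  residue fields.\<close>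

definition const_of :: "'c \<Rightarrow> 'a" where "const_of = inv_into K e"

lemma const_of_closed: "c \<in> e ` K \<Longrightarrow> const_of c \<in> K" and e_const_of: "c \<in> e ` K \<Longrightarrow> e (const_of c) = c"
  and const_of_e: "a \<in> K \<Longrightarrow> const_of (e a) = a"
  using e_K_inj by (auto simp: const_of_def inv_into_into f_inv_into_f)

lemma const_of_add: "c \<in> e ` K \<Longrightarrow> d \<in> e ` K \<Longrightarrow> const_of (c \<oplus>\<^bsub>L\<^esub> d) = const_of c \<oplus>\<^bsub>F\<^esub> const_of d"
  and const_of_mult: "c \<in> e ` K \<Longrightarrow> d \<in> e ` K \<Longrightarrow> const_of (c \<otimes>\<^bsub>L\<^esub> d) = const_of c \<otimes>\<^bsub>F\<^esub> const_of d"
proof -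
  assume c: "c \<in> e ` K" "d \<in> e ` K"
  then have k: "const_of c \<in> K" "const_of d \<in> K" using const_of_closed by auto
  then have v: "const_of c \<in> V" "const_of d \<in> V" using K_V by auto
  show "const_of (c \<oplus>\<^bsub>L\<^esub> d) = const_of c \<oplus>\<^bsub>F\<^esub> const_of d"
    using const_of_e[of "const_of c \<oplus>\<^bsub>F\<^esub> const_of d"] e_add[OF v] e_const_of c k subringE(7)[OF subfieldE(1)[OF K]] by simp
  show "const_of (c \<otimes>\<^bsub>L\<^esub> d) = const_of c \<otimes>\<^bsub>F\<^esub> const_of d"
    using const_of_e[of "const_of c \<otimes>\<^bsub>F\<^esub> const_of d"] e_mult[OF v] e_const_of c k subringE(6)[OF subfieldE(1)[OF K]] by simp
qed

lemma const_of_one: "const_of \<one>\<^bsub>L\<^esub> = \<one>\<^bsub>F\<^esub>"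
  using const_of_e[of "\<one>\<^bsub>F\<^esub>"] e_one subringE(3)[OF subfieldE(1)[OF K]] by simp

text \<open>Lift a basis of \<open>L\<close> to \<open>A\<close> and use the coordinates, moved back
  to \<open>K\<close>, as coefficients. With a linear choice of preimages, linear forms on the other
  residue fields pull back to linear forms on \<open>L\<close>.\<close>

lemma linear_section:
  assumes fin: "finite (carrier L)" and A: "A \<subseteq> V" and zero: "\<zero>\<^bsub>F\<^esub> \<in> A"
    and add: "\<And>f g. f \<in> A \<Longrightarrow> g \<in> A \<Longrightarrow> f \<oplus>\<^bsub>F\<^esub> g \<in> A"
    and smult: "\<And>c f. c \<in> K \<Longrightarrow> f \<in> A \<Longrightarrow> c \<otimes>\<^bsub>F\<^esub> f \<in> A" and onto: "e ` A = carrier L"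
  shows "\<exists>\<sigma>. (\<forall>x \<in> carrier L. \<sigma> x \<in> A \<and> e (\<sigma> x) = x) \<and>
    (\<forall>x \<in> carrier L. \<forall>y \<in> carrier L. \<sigma> (x \<oplus>\<^bsub>L\<^esub> y) = \<sigma> x \<oplus>\<^bsub>F\<^esub> \<sigma> y) \<and>
    (\<forall>c \<in> e ` K. \<forall>x \<in> carrier L. \<sigma> (c \<otimes>\<^bsub>L\<^esub> x) = const_of c \<otimes>\<^bsub>F\<^esub> \<sigma> x)"
proof -
  obtain n where n: "L.dimension n (e ` K) (carrier L)"
    using L.finite_imp_finite_dimension[OF e_K_subfield fin] by blast
  from L.dimension_coordinates[OF e_K_subfield n] obtain b \<alpha> where H:
    "\<forall>i<n. b i \<in> carrier L \<and> \<alpha> i \<in> carrier L \<rightarrow> e ` K \<and>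
      (\<forall>x \<in> carrier L. \<forall>y \<in> carrier L. \<alpha> i (x \<oplus>\<^bsub>L\<^esub> y) = \<alpha> i x \<oplus>\<^bsub>L\<^esub> \<alpha> i y) \<and>
      (\<forall>c \<in> e ` K. \<forall>x \<in> carrier L. \<alpha> i (c \<otimes>\<^bsub>L\<^esub> x) = c \<otimes>\<^bsub>L\<^esub> \<alpha> i x)"
    "\<forall>x \<in> carrier L. x = (\<Oplus>\<^bsub>L\<^esub>i\<in>{..<n}. \<alpha> i x \<otimes>\<^bsub>L\<^esub> b i)"
    by (elim exE conjE) (rule that)
  have b: "b i \<in> carrier L" and \<alpha>: "x \<in> carrier L \<Longrightarrow> \<alpha> i x \<in> e ` K"
    and \<alpha>_add: "x \<in> carrier L \<Longrightarrow> y \<in> carrier L \<Longrightarrow> \<alpha> i (x \<oplus>\<^bsub>L\<^esub> y) = \<alpha> i x \<oplus>\<^bsub>L\<^esub> \<alpha> i y"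
    and \<alpha>_smult: "c \<in> e ` K \<Longrightarrow> x \<in> carrier L \<Longrightarrow> \<alpha> i (c \<otimes>\<^bsub>L\<^esub> x) = c \<otimes>\<^bsub>L\<^esub> \<alpha> i x" if "i < n" for i c x y
    using H(1) that by (auto simp: Pi_iff)
  have "\<forall>i\<in>{..<n}. \<exists>f. f \<in> A \<and> e f = b i"
  proof
    fix i assume "i \<in> {..<n}"
    then have "b i \<in> e ` A" using b onto by simp
    then show "\<exists>f. f \<in> A \<and> e f = b i" by auto
  qed
  from bchoice[OF this] obtain f where f: "\<forall>i\<in>{..<n}. f i \<in> A \<and> e (f i) = b i" by blast
  define g where "g x i = const_of (\<alpha> i x) \<otimes>\<^bsub>F\<^esub> f i" for x i
  define \<sigma> where "\<sigma> x = finsum F (g x) {..<n}" for x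
  have gA: "g x i \<in> A" if "x \<in> carrier L" "i < n" for x i
    using that f \<alpha> const_of_closed smult by (simp add: g_def)
  have cK: "const_of (\<alpha> i x) \<in> K" if "x \<in> carrier L" "i < n" for x i using \<alpha> const_of_closed that by simp
  have KF: "c \<in> carrier F" if "c \<in> K" for c using that K_V V_carrier by auto
  have fF: "f i \<in> carrier F" if "i < n" for i using f that A V_carrier by auto
  have gF: "g x \<in> {..<n} \<rightarrow> carrier F" if "x \<in> carrier L" for x using gA[OF that] A V_carrier by auto
  have sum_A: "finsum F h B \<in> A" if "finite B" "h \<in> B \<rightarrow> A" for h and B :: "nat set"
    using that
  proof (induction B rule: finite_induct)
    case (insert a B)
    then have "h \<in> B \<rightarrow> carrier F" "h a \<in> carrier F" using A V_carrier by auto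
    then show ?case using insert add by (simp add: Pi_iff)
  qed (simp add: zero)
  have "\<sigma> x \<in> A" if "x \<in> carrier L" for x unfolding \<sigma>_def using gA[OF that] by (intro sum_A) auto
  moreover have "e (\<sigma> x) = x" if x: "x \<in> carrier L" for x
  proof -
    have "e (\<sigma> x) = finsum L (\<lambda>i. e (g x i)) {..<n}"
      unfolding \<sigma>_def using gA[OF x] A by (intro e_finsum(2)) auto
    also have "\<dots> = (\<Oplus>\<^bsub>L\<^esub>i\<in>{..<n}. \<alpha> i x \<otimes>\<^bsub>L\<^esub> b i)"
    proof (rule L.finsum_cong')
      show "(\<lambda>i. \<alpha> i x \<otimes>\<^bsub>L\<^esub> b i) \<in> {..<n} \<rightarrow> carrier L" 
        using b \<alpha> x subfieldE(3)[OF e_K_subfield] by (auto simp: subset_iff)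
      fix i assume "i \<in> {..<n}"
      then have i: "i < n" by simp
      have "const_of (\<alpha> i x) \<in> V" "f i \<in> V" "e (f i) = b i" using cK[OF x i] K_V f i A by auto
      then show "e (g x i) = \<alpha> i x \<otimes>\<^bsub>L\<^esub> b i"
        unfolding g_def using e_mult e_const_of \<alpha>[OF i x] by simp
    qed simp
    also have "\<dots> = x" using H(2) x by simp
    finally show ?thesis .
  qed
  moreover have "\<sigma> (x \<oplus>\<^bsub>L\<^esub> y) = \<sigma> x \<oplus>\<^bsub>F\<^esub> \<sigma> y" if xy: "x \<in> carrier L" "y \<in> carrier L" for x y
  proof -
    have "\<sigma> (x \<oplus>\<^bsub>L\<^esub> y) = finsum F (\<lambda>i. g x i \<oplus>\<^bsub>F\<^esub> g y i) {..<n}"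
      unfolding \<sigma>_def
    proof (rule F.finsum_cong')
      fix i assume "i \<in> {..<n}"
      then have i: "i < n" by simp
      show "g (x \<oplus>\<^bsub>L\<^esub> y) i = g x i \<oplus>\<^bsub>F\<^esub> g y i"
        unfolding g_def using const_of_add \<alpha>_add[OF i xy] \<alpha>[OF i] xy cK[OF _ i] KF fF[OF i] by (simp add: F.l_distr)
    qed (use gF xy in auto)
    then show ?thesis using gF xy by (simp add: \<sigma>_def F.finsum_addf)
  qed
  moreover have "\<sigma> (c \<otimes>\<^bsub>L\<^esub> x) = const_of c \<otimes>\<^bsub>F\<^esub> \<sigma> x" if c: "c \<in> e ` K" "x \<in> carrier L" for c x
  proof -
    have "\<sigma> (c \<otimes>\<^bsub>L\<^esub> x) = finsum F (\<lambda>i. const_of c \<otimes>\<^bsub>F\<^esub> g x i) {..<n}"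
      unfolding \<sigma>_def
    proof (rule F.finsum_cong')
      fix i assume "i \<in> {..<n}"
      then have i: "i < n" by simp
      show "g (c \<otimes>\<^bsub>L\<^esub> x) i = const_of c \<otimes>\<^bsub>F\<^esub> g x i"
        unfolding g_def using const_of_mult \<alpha>_smult[OF i c] \<alpha>[OF i] c cK[OF _ i] KF const_of_closed fF[OF i] by (simp add: F.m_assoc)
    next
      show "(\<lambda>i. const_of c \<otimes>\<^bsub>F\<^esub> g x i) \<in> {..<n} \<rightarrow> carrier F"
        using gF[OF c(2)] const_of_closed[OF c(1)] KF by (simp add: Pi_iff)
    qed simp
    then show ?thesis using gF c const_of_closed KF by (simp add: \<sigma>_def F.finsum_rdistr)
  qed
  ultimately show ?thesis by blast
qed

end

text \<open>Compose \<open>ev\<close> with an isomorphism onto \<open>GF (q ^ m)\<close>; as it is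
  bijective, equality of values and surjectivity carry over.\<close>

lemma place_evaluation:
  assumes ff: "function_field F K" and q: "primepow q" "finite K" "card K = q"
    and Pl: "P \<in> places F K" "has_degree F K P m"
  shows "finite (carrier (GF (q ^ m)))" "\<exists>e. evaluation F (GF (q ^ m)) K (carrier (place_ring F P)) e \<and> e ` K = GF_sub q m \<and>
    (\<forall>f \<in> carrier (place_ring F P). \<forall>g \<in> carrier (place_ring F P). e f = e g \<longleftrightarrow> ev F P f = ev F P g) \<and>
    (\<forall>A \<subseteq> carrier (place_ring F P). ev F P ` A = carrier (residue_field F P) \<longrightarrow> e ` A = carrier (GF (q ^ m)))"
proof -
  obtain V where "function_field_place F K V P" using place_obtain[OF ff Pl(1)] .
  then interpret function_field_place F K V P .
  note G = residue_field_iso_GF[OF q Pl(2)]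
  show "finite (carrier (GF (q ^ m)))" by (rule G(2))
  obtain \<psi> where \<psi>: "\<psi> \<in> ring_iso (residue_field F P) (GF (q ^ m))" and K': "\<psi> ` ev F P ` K = GF_sub q m"
    using G(4) by blast
  have h: "\<psi> \<in> ring_hom (residue_field F P) (GF (q ^ m))" and bij: "bij_betw \<psi> (carrier (residue_field F P)) (carrier (GF (q ^ m)))"
    using \<psi> by (auto simp: ring_iso_def)
  have c: "carrier (place_ring F P) = V" by (simp add: place_ring)
  interpret G: field "GF (q ^ m)" by (rule G)
  define e where "e = \<psi> \<circ> ev F P"
  have "e \<in> ring_hom (place_ring F P) (GF (q ^ m))" unfolding e_def using ring_hom_trans[OF ev_hom h] .
  then have ev: "evaluation F (GF (q ^ m)) K (carrier (place_ring F P)) e"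
    unfolding evaluation_def evaluation_axioms_def
    using field_axioms G.field_axioms V_subring K K_V by (simp add: place_ring)
  have eK: "e ` K = GF_sub q m" using K' by (simp add: e_def image_comp)
  have evc: "ev F P f \<in> carrier (residue_field F P)" if "f \<in> V" for f using ev_surj that by blast
  have eq: "e f = e g \<longleftrightarrow> ev F P f = ev F P g" if "f \<in> V" "g \<in> V" for f g
    using bij evc that by (auto simp: e_def bij_betw_def inj_on_def)
  have "e ` A = carrier (GF (q ^ m))" if "ev F P ` A = carrier (residue_field F P)" for A
    using bij that unfolding e_def image_comp[symmetric] by (simp add: bij_betw_def)
  then show "\<exists>e. evaluation F (GF (q ^ m)) K (carrier (place_ring F P)) e \<and> e ` K = GF_sub q m \<and>
    (\<forall>f \<in> carrier (place_ring F P). \<forall>g \<in> carrier (place_ring F P). e f = e g \<longleftrightarrow> ev F P f = ev F P g) \<and>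
    (\<forall>A \<subseteq> carrier (place_ring F P). ev F P ` A = carrier (residue_field F P) \<longrightarrow> e ` A = carrier (GF (q ^ m)))"
    using eq by (intro exI[of _ e] conjI ev eK) (auto simp: c)
qed

lemma ev_finprod:
  assumes ff: "function_field F K" and P: "P \<in> places F K"
    and f: "finite A" "f \<in> A \<rightarrow> carrier (place_ring F P)"
  shows "ev F P (finprod F f A) = finprod (residue_field F P) (\<lambda>l. ev F P (f l)) A"
proof -
  obtain V where "function_field_place F K V P" using place_obtain[OF ff P] .
  then interpret function_field_place F K V P .
  have "evaluation F (residue_field F P) K V (ev F P)"
    unfolding evaluation_def evaluation_axioms_def
    using field_axioms residue_field_is_field V_subring K K_V ev_hom by (simp add: place_ring)
  then interpret evaluation F "residue_field F P" K V "ev F P" .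
  show ?thesis using f by (intro e_finprod) (simp_all add: place_ring)
qed

lemma riemann_roch_zero: "function_field F K \<Longrightarrow> \<zero>\<^bsub>F\<^esub> \<in> riemann_roch_space F K D"
proof -
  assume "function_field F K"
  then interpret field F by (simp add: function_field_def)
  show ?thesis by (simp add: riemann_roch_space_def)
qed

lemma riemann_roch_smult:
  assumes "function_field F K" "c \<in> K" "f \<in> riemann_roch_space F K D"
  shows "c \<otimes>\<^bsub>F\<^esub> f \<in> riemann_roch_space F K D"
  using riemann_roch_mult[OF assms(1), of c 0 f D] riemann_roch_constants assms by auto

lemma riemann_roch_diff_smult:
  assumes ff: "function_field F K" and "c \<in> K" "f \<in> riemann_roch_space F K D" "g \<in> riemann_roch_space F K D"
  shows "f \<ominus>\<^bsub>F\<^esub> c \<otimes>\<^bsub>F\<^esub> g \<in> riemann_roch_space F K D"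
proof -
  interpret field F using ff by (simp add: function_field_def)
  have K: "subfield K F" using ff by (simp add: function_field_def)
  have "c \<in> carrier F" "g \<in> carrier F" using assms subfieldE(3)[OF K] by (auto simp: riemann_roch_space_def)
  then have "f \<ominus>\<^bsub>F\<^esub> c \<otimes>\<^bsub>F\<^esub> g = f \<oplus>\<^bsub>F\<^esub> (\<ominus>\<^bsub>F\<^esub> c) \<otimes>\<^bsub>F\<^esub> g" by (simp add: a_minus_def l_minus)
  moreover have "\<ominus>\<^bsub>F\<^esub> c \<in> K" using assms(2) subringE(5)[OF subfieldE(1)[OF K]] by simp
  ultimately show ?thesis using riemann_roch_add[OF ff] riemann_roch_smult[OF ff] assms by simp
qed

theorem theorem1:
  fixes F :: "('a, 'b) ring_scheme" and K Q :: "'a set" and D :: "'a set \<Rightarrow>\<^sub>0 int"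
    and q k n d :: nat and N :: "nat \<Rightarrow> nat" and P :: "nat \<Rightarrow> nat \<Rightarrow> 'a set"
    and I :: "(nat \<times> nat) set"
  assumes "primepow q" and "k \<ge> 2"
    and "function_field F K" and "finite K" and "card K = q"
    and "Q \<in> places F K" and "has_degree F K Q n"
    and "D \<in> divisors F K"
    and "I = (SIGMA i:{1..d}. {1..N i})"
    and "\<And>i j. (i, j) \<in> I \<Longrightarrow> P i j \<in> places F K \<and> has_degree F K (P i j) i"
    and "inj_on (\<lambda>(i, j). P i j) I"
    and "Q \<notin> Poly_Mapping.keys D"
    and "\<And>i j. (i, j) \<in> I \<Longrightarrow> P i j \<notin> Poly_Mapping.keys D"
    and onto: "ev F Q ` riemann_roch_space F K D = carrier (residue_field F Q)"
    and inj: "inj_on (ev_family F I P) (riemann_roch_space F K (frag_cmul (int k) D))"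
  shows "(\<forall>x f. (\<forall>l \<in> {1..k}. x l \<in> carrier (residue_field F Q)) \<and>
            (\<forall>l \<in> {1..k}. f l \<in> riemann_roch_space F K D \<and> ev F Q (f l) = x l) \<longrightarrow>
          hadamard F I P k (\<lambda>l. ev_family F I P (f l))
            \<in> ev_family F I P ` riemann_roch_space F K (frag_cmul (int k) D) \<and>
          finprod (residue_field F Q) x {1..k} =
            ev F Q (the_inv_into (riemann_roch_space F K (frag_cmul (int k) D)) (ev_family F I P)
              (hadamard F I P k (\<lambda>l. ev_family F I P (f l)))))
    \<and> mu q k n \<le> (\<Sum>i = 1..d. N i * mu q k i)
    \<and> nu q k n \<le> (k - 1) * (\<Sum>i = 1..d. N i * mu q 2 i)"
proof -
  note q = assms(1) and k = assms(2) and ff = assms(3) and finK = assms(4) and cardK = assms(5)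
    and Q = assms(6,7) and I = assms(9) and Pl = assms(10) and keysQ = assms(12) and keysP = assms(13)
  interpret F: field F using ff by (simp add: function_field_def)
  let ?L = "GF (q ^ n)"
  let ?A = "riemann_roch_space F K D" and ?B = "riemann_roch_space F K (frag_cmul (int k) D)"
  have keys_sub: "Poly_Mapping.keys (frag_cmul (int k) D) \<subseteq> Poly_Mapping.keys D" by (rule keys_cmul)
  have AQ: "?A \<subseteq> carrier (place_ring F Q)" and BQ: "?B \<subseteq> carrier (place_ring F Q)"
    using riemann_roch_in_place_ring[OF ff _ Q(1)] keysQ keys_sub by blast+
  have AP: "?A \<subseteq> carrier (place_ring F (P i j))" and BP: "?B \<subseteq> carrier (place_ring F (P i j))"
    if "(i, j) \<in> I" for i j
    using riemann_roch_in_place_ring[OF ff, of _ _ "P i j"] Pl[OF that] keysP[OF that] keys_sub by blast+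
  have prodB: "finprod F f {1..k} \<in> ?B" if "\<And>l. l \<in> {1..k} \<Longrightarrow> f l \<in> ?A" for f
    using riemann_roch_prod[OF ff, of "{1..k}" f D] that by simp
  have part1: "hadamard F I P k (\<lambda>l. ev_family F I P (f l)) \<in> ev_family F I P ` ?B \<and>
      finprod (residue_field F Q) x {1..k} =
        ev F Q (the_inv_into ?B (ev_family F I P) (hadamard F I P k (\<lambda>l. ev_family F I P (f l))))"
    if x: "\<forall>l \<in> {1..k}. x l \<in> carrier (residue_field F Q)"
      and f: "\<forall>l \<in> {1..k}. f l \<in> ?A \<and> ev F Q (f l) = x l" for x f
  proof -
    let ?h = "finprod F f {1..k}"
    have hB: "?h \<in> ?B" using f by (intro prodB) auto
    have had: "hadamard F I P k (\<lambda>l. ev_family F I P (f l)) = ev_family F I P ?h"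
    proof
      fix ij
      show "hadamard F I P k (\<lambda>l. ev_family F I P (f l)) ij = ev_family F I P ?h ij"
      proof (cases "ij \<in> I")
        case True
        obtain i j where ij: "ij = (i, j)" by (cases ij)
        have "ev F (P i j) ?h = finprod (residue_field F (P i j)) (\<lambda>l. ev F (P i j) (f l)) {1..k}"
          using ev_finprod[OF ff, of "P i j" "{1..k}" f] Pl AP f True ij by blast
        then show ?thesis using True ij by (simp add: hadamard_def ev_family_def)
      qed (simp add: hadamard_def ev_family_def)
    qed
    obtain V where V: "function_field_place F K V Q" using place_obtain[OF ff Q(1)] .
    interpret V: function_field_place F K V Q by (rule V)
    interpret RQ: field "residue_field F Q" by (rule V.residue_field_is_field)
    have "finprod (residue_field F Q) x {1..k} = finprod (residue_field F Q) (\<lambda>l. ev F Q (f l)) {1..k}"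
      using f x by (intro RQ.finprod_cong') auto
    also have "\<dots> = ev F Q ?h"
      using ev_finprod[OF ff Q(1), of "{1..k}" f] AQ f by auto
    finally show ?thesis using hB the_inv_into_f_f[OF inj hB] by (simp add: had)
  qed
  obtain eQ where eQ: "evaluation F ?L K (carrier (place_ring F Q)) eQ" "eQ ` K = GF_sub q n"
    and eQ_onto: "\<forall>A \<subseteq> carrier (place_ring F Q). ev F Q ` A = carrier (residue_field F Q) \<longrightarrow> eQ ` A = carrier ?L"
    using place_evaluation(2)[OF ff q finK cardK Q] by (elim exE conjE) (rule that)
  interpret Q: evaluation F "?L" K "carrier (place_ring F Q)" eQ by (rule eQ)
  define GP where "GP ij = GF (q ^ fst ij)" for ij :: "nat \<times> nat"
  define OP where "OP ij = carrier (place_ring F (P (fst ij) (snd ij)))" for ij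
  define good where "good ij e \<longleftrightarrow> evaluation F (GP ij) K (OP ij) e \<and> e ` K = GF_sub q (fst ij) \<and>
      (\<forall>f \<in> OP ij. \<forall>g \<in> OP ij. e f = e g \<longleftrightarrow> ev F (P (fst ij) (snd ij)) f = ev F (P (fst ij) (snd ij)) g)" for ij e
  have "\<forall>ij \<in> I. \<exists>e. good ij e"
  proof
    fix ij assume ij: "ij \<in> I"
    then have "P (fst ij) (snd ij) \<in> places F K" "has_degree F K (P (fst ij) (snd ij)) (fst ij)"
      using Pl[of "fst ij" "snd ij"] by auto
    from place_evaluation(2)[OF ff q finK cardK this] show "\<exists>e. good ij e"
      unfolding good_def GP_def OP_def
      by (elim exE conjE) (intro exI conjI, assumption+)
  qed
  from bchoice[OF this] obtain e where e: "\<forall>ij \<in> I. good ij (e ij)" by blast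
  have eval: "evaluation F (GP ij) K (OP ij) (e ij)" and eK: "e ij ` K = GF_sub q (fst ij)"
    and e_eq: "f \<in> OP ij \<Longrightarrow> g \<in> OP ij \<Longrightarrow> e ij f = e ij g \<longleftrightarrow> ev F (P (fst ij) (snd ij)) f = ev F (P (fst ij) (snd ij)) g"
    if "ij \<in> I" for ij f g
    using e that by (auto simp: good_def)
  have AO: "f \<in> ?A \<Longrightarrow> f \<in> OP ij" and BO: "f \<in> ?B \<Longrightarrow> f \<in> OP ij" if "ij \<in> I" for ij f
    using AP[of "fst ij" "snd ij"] BP[of "fst ij" "snd ij"] that by (auto simp: OP_def)
  have "\<exists>\<sigma>. (\<forall>x \<in> carrier ?L. \<sigma> x \<in> ?A \<and> eQ (\<sigma> x) = x) \<and>
    (\<forall>x \<in> carrier ?L. \<forall>y \<in> carrier ?L. \<sigma> (x \<oplus>\<^bsub>?L\<^esub> y) = \<sigma> x \<oplus>\<^bsub>F\<^esub> \<sigma> y) \<and>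
    (\<forall>c \<in> eQ ` K. \<forall>x \<in> carrier ?L. \<sigma> (c \<otimes>\<^bsub>?L\<^esub> x) = Q.const_of c \<otimes>\<^bsub>F\<^esub> \<sigma> x)"
    by (rule Q.linear_section[OF place_evaluation(1)[OF ff q finK cardK Q] AQ riemann_roch_zero[OF ff]
      riemann_roch_add[OF ff] riemann_roch_smult[OF ff] eQ_onto[rule_format, OF AQ onto]])
  then obtain \<sigma> where S: "\<forall>x \<in> carrier ?L. \<sigma> x \<in> ?A \<and> eQ (\<sigma> x) = x"
    "\<forall>x \<in> carrier ?L. \<forall>y \<in> carrier ?L. \<sigma> (x \<oplus>\<^bsub>?L\<^esub> y) = \<sigma> x \<oplus>\<^bsub>F\<^esub> \<sigma> y"
    "\<forall>c \<in> GF_sub q n. \<forall>x \<in> carrier ?L. \<sigma> (c \<otimes>\<^bsub>?L\<^esub> x) = Q.const_of c \<otimes>\<^bsub>F\<^esub> \<sigma> x"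
    unfolding eQ(2) by (elim exE conjE) (rule that)
  have \<sigma>: "x \<in> carrier ?L \<Longrightarrow> \<sigma> x \<in> ?A" "x \<in> carrier ?L \<Longrightarrow> eQ (\<sigma> x) = x"
    and \<sigma>_add: "x \<in> carrier ?L \<Longrightarrow> y \<in> carrier ?L \<Longrightarrow>
      \<sigma> (x \<oplus>\<^bsub>?L\<^esub> y) = \<sigma> x \<oplus>\<^bsub>F\<^esub> \<sigma> y"
    and \<sigma>_smult: "c \<in> GF_sub q n \<Longrightarrow> x \<in> carrier ?L \<Longrightarrow>
      \<sigma> (c \<otimes>\<^bsub>?L\<^esub> x) = Q.const_of c \<otimes>\<^bsub>F\<^esub> \<sigma> x" for c x y
    using S by simp_all
  \<comment> \<open>The base fields are compared through \<open>K\<close>: from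
    \<open>GF_sub q n\<close> back to a constant, then to its value at the place
    \<open>ij\<close>.\<close>
  define \<eta> where "\<eta> ij c = e ij (Q.const_of c)" for ij c
  define \<theta> where "\<theta> ij x = e ij (\<sigma> x)" for ij x
  note cc = Q.const_of_closed[unfolded eQ(2)]
  have sub: "subfield (GF_sub q n) ?L" using Q.e_K_subfield eQ by simp
  have KO: "K \<subseteq> OP ij" if "ij \<in> I" for ij using evaluation.K_V[OF eval[OF that]] .
  have \<eta>_add: "\<eta> ij (c \<oplus>\<^bsub>?L\<^esub> c') = \<eta> ij c \<oplus>\<^bsub>GP ij\<^esub> \<eta> ij c'"
    and \<eta>_mult: "\<eta> ij (c \<otimes>\<^bsub>?L\<^esub> c') = \<eta> ij c \<otimes>\<^bsub>GP ij\<^esub> \<eta> ij c'"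
    if "ij \<in> I" "c \<in> GF_sub q n" "c' \<in> GF_sub q n" for ij c c'
    using that cc Q.const_of_add[unfolded eQ(2)] Q.const_of_mult[unfolded eQ(2)] KO[OF that(1)]
      evaluation.e_add[OF eval[OF that(1)]] evaluation.e_mult[OF eval[OF that(1)]]
    by (auto simp: \<eta>_def subset_iff)
  have \<eta>c: "\<eta> ij c \<in> carrier (GP ij)" if "ij \<in> I" "c \<in> GF_sub q n" for ij c
    unfolding \<eta>_def using evaluation.e_closed[OF eval[OF that(1)]] KO[OF that(1)] cc[OF that(2)] by blast
  interpret FI: field_interpolation "?L" "GF_sub q n" k I GP "\<lambda>ij. GF_sub q (fst ij)" \<eta> \<theta>
  proof (rule field_interpolation.intro[OF Q.L.field_axioms], rule field_interpolation_axioms.intro, goal_cases)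
    case 1
    show ?case using sub .
  next
    case 2
    show ?case unfolding I by simp
  next
    case (3 ij)
    then show ?case using eval by (simp add: evaluation_def)
  next
    case (4 ij)
    then show ?case using subfieldE(3)[OF evaluation.e_K_subfield[OF eval]] eK by simp
  next
    case (5 ij)
    interpret E: evaluation F "GP ij" K "OP ij" "e ij" by (rule eval[OF 5])
    have "bij_betw Q.const_of (GF_sub q n) K"
      using Q.e_K_inj eQ(2) unfolding Q.const_of_def by (metis bij_betw_inv_into inj_on_imp_bij_betw)
    moreover have "bij_betw (e ij) K (GF_sub q (fst ij))" using E.e_K_inj eK[OF 5] by (simp add: bij_betw_def)
    ultimately have "bij_betw (e ij \<circ> Q.const_of) (GF_sub q n) (GF_sub q (fst ij))" by (rule bij_betw_trans)
    moreover have "e ij \<circ> Q.const_of = \<eta> ij" by (simp add: \<eta>_def fun_eq_iff)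
    ultimately show ?case by simp
  next
    case (6 ij c c')
    then show ?case by (rule \<eta>_add)
  next
    case (7 ij c c')
    then show ?case by (rule \<eta>_mult)
  next
    case (8 ij)
    then show ?case using evaluation.e_one[OF eval] Q.const_of_one by (simp add: \<eta>_def)
  next
    case (9 ij x)
    then show ?case unfolding \<theta>_def using evaluation.e_closed[OF eval] AO \<sigma>(1) by blast
  next
    case (10 ij x y)
    then show ?case using evaluation.e_add[OF eval] AO \<sigma>(1) by (simp add: \<theta>_def \<sigma>_add)
  next
    case (11 ij c x)
    have "Q.const_of c \<in> OP ij" using cc KO 11 by blast
    then show ?case using evaluation.e_mult[OF eval] AO \<sigma>(1) 11 by (simp add: \<theta>_def \<eta>_def \<sigma>_smult)
  next
    case (12 T c)
    \<comment> \<open>\<open>\<alpha>\<close> is related to \<open>v\<close> if a single function in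
      \<open>L(kD)\<close> has, at every chosen place, the combination with coefficients
      \<open>\<alpha>\<close> as its value, and has the value \<open>v\<close> at \<open>Q\<close>.
      Not every \<open>\<alpha>\<close> need arise, so this is a partial map.\<close>
    define Rel where "Rel \<alpha> v \<longleftrightarrow> (\<exists>f \<in> ?B. \<alpha> \<in> T \<rightarrow> GF_sub q n \<and>
      (\<forall>ij \<in> I. e ij f = finsum (GP ij) (\<lambda>t. \<eta> ij (\<alpha> t) \<otimes>\<^bsub>GP ij\<^esub> c ij t) T) \<and> v = eQ f)" for \<alpha> v
    note Kr = subringE[OF subfieldE(1)[OF sub]]
    have "\<exists>w \<in> T \<rightarrow> carrier ?L. \<forall>\<alpha> v. Rel \<alpha> v \<longrightarrow> v = finsum ?L (\<lambda>t. \<alpha> t \<otimes>\<^bsub>?L\<^esub> w t) T"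
    proof (rule Q.L.linear_relation_solution[OF sub 12(1)])
      fix \<alpha> v \<beta> w a
      assume "Rel \<alpha> v" "Rel \<beta> w" and a: "a \<in> GF_sub q n"
      then obtain f g where f: "f \<in> ?B" "\<alpha> \<in> T \<rightarrow> GF_sub q n" "v = eQ f"
          "\<And>ij. ij \<in> I \<Longrightarrow> e ij f = finsum (GP ij) (\<lambda>t. \<eta> ij (\<alpha> t) \<otimes>\<^bsub>GP ij\<^esub> c ij t) T"
        and g: "g \<in> ?B" "\<beta> \<in> T \<rightarrow> GF_sub q n" "w = eQ g"
          "\<And>ij. ij \<in> I \<Longrightarrow> e ij g = finsum (GP ij) (\<lambda>t. \<eta> ij (\<beta> t) \<otimes>\<^bsub>GP ij\<^esub> c ij t) T"
        unfolding Rel_def by blast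
      let ?a = "Q.const_of a"
      let ?f = "f \<ominus>\<^bsub>F\<^esub> ?a \<otimes>\<^bsub>F\<^esub> g"
      let ?\<gamma> = "\<lambda>t. \<alpha> t \<ominus>\<^bsub>?L\<^esub> a \<otimes>\<^bsub>?L\<^esub> \<beta> t"
      have aK: "?a \<in> K" using cc a by simp
      have "?f \<in> ?B" using riemann_roch_diff_smult[OF ff aK f(1) g(1)] .
      moreover have "?\<gamma> \<in> T \<rightarrow> GF_sub q n" using a f(2) g(2) Kr by (auto simp: a_minus_def Pi_iff)
      moreover have "v \<ominus>\<^bsub>?L\<^esub> a \<otimes>\<^bsub>?L\<^esub> w = eQ ?f"
      proof -
        have "?a \<in> carrier (place_ring F Q)" "f \<in> carrier (place_ring F Q)" "g \<in> carrier (place_ring F Q)"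
          using aK Q.K_V f(1) g(1) BQ by auto
        then show ?thesis using Q.e_minus Q.e_mult Q.V_closed(4) Q.e_const_of[of a] a eQ(2) f(3) g(3) by simp
      qed
      moreover have "e ij ?f = finsum (GP ij) (\<lambda>t. \<eta> ij (?\<gamma> t) \<otimes>\<^bsub>GP ij\<^esub> c ij t) T" if ij: "ij \<in> I" for ij
      proof -
        interpret E: evaluation F "GP ij" K "OP ij" "e ij" by (rule eval[OF ij])
        have o: "?a \<in> OP ij" "f \<in> OP ij" "g \<in> OP ij" using aK KO[OF ij] BO[OF ij] f(1) g(1) by auto
        have \<alpha>c: "\<eta> ij (\<alpha> t) \<in> carrier (GP ij)" "\<eta> ij (\<beta> t) \<in> carrier (GP ij)" if "t \<in> T" for t
          using \<eta>c[OF ij] f(2) g(2) that by auto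
        have ac: "\<eta> ij a \<in> carrier (GP ij)" using \<eta>c[OF ij a] .
        have \<gamma>: "\<eta> ij (?\<gamma> t) = \<eta> ij (\<alpha> t) \<ominus>\<^bsub>GP ij\<^esub> \<eta> ij a \<otimes>\<^bsub>GP ij\<^esub> \<eta> ij (\<beta> t)" if t: "t \<in> T" for t
        proof -
          have tK: "\<alpha> t \<in> GF_sub q n" "\<beta> t \<in> GF_sub q n" "?\<gamma> t \<in> GF_sub q n" "a \<otimes>\<^bsub>?L\<^esub> \<beta> t \<in> GF_sub q n"
            using f(2) g(2) \<open>?\<gamma> \<in> T \<rightarrow> GF_sub q n\<close> t a Kr(6) by (simp_all add: Pi_iff)
          then have tc: "\<alpha> t \<in> carrier ?L" "a \<otimes>\<^bsub>?L\<^esub> \<beta> t \<in> carrier ?L" using Kr(1) by auto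
          have "?\<gamma> t \<oplus>\<^bsub>?L\<^esub> a \<otimes>\<^bsub>?L\<^esub> \<beta> t = \<alpha> t"
            using tc by (simp add: a_minus_def Q.L.a_assoc Q.L.l_neg)
          then have "\<eta> ij (\<alpha> t) = \<eta> ij (?\<gamma> t) \<oplus>\<^bsub>GP ij\<^esub> \<eta> ij a \<otimes>\<^bsub>GP ij\<^esub> \<eta> ij (\<beta> t)"
            using \<eta>_add[OF ij tK(3,4)] \<eta>_mult[OF ij a tK(2)] by simp
          then show ?thesis
            using \<eta>c[OF ij tK(3)] ac \<alpha>c[OF t] by (simp add: a_minus_def E.L.a_assoc E.L.r_neg)
        qed
        have "e ij ?f = e ij f \<ominus>\<^bsub>GP ij\<^esub> \<eta> ij a \<otimes>\<^bsub>GP ij\<^esub> e ij g"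
          using E.e_minus E.e_mult E.V_closed(4) o by (simp add: \<eta>_def)
        also have "\<dots> = finsum (GP ij) (\<lambda>t. (\<eta> ij (\<alpha> t) \<ominus>\<^bsub>GP ij\<^esub> \<eta> ij a \<otimes>\<^bsub>GP ij\<^esub> \<eta> ij (\<beta> t)) \<otimes>\<^bsub>GP ij\<^esub> c ij t) T"
          unfolding f(4)[OF ij] g(4)[OF ij] using 12 ij \<alpha>c ac by (intro E.L.finsum_diff_smult[symmetric]) auto
        also have "\<dots> = finsum (GP ij) (\<lambda>t. \<eta> ij (?\<gamma> t) \<otimes>\<^bsub>GP ij\<^esub> c ij t) T"
          using 12(2)[OF ij] \<alpha>c ac \<eta>c[OF ij] \<open>?\<gamma> \<in> T \<rightarrow> GF_sub q n\<close>
          by (intro E.L.finsum_cong') (auto simp: \<gamma> Pi_iff)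
        finally show ?thesis .
      qed
      ultimately show "Rel ?\<gamma> (v \<ominus>\<^bsub>?L\<^esub> a \<otimes>\<^bsub>?L\<^esub> w)" unfolding Rel_def by blast
    next
      fix \<alpha> v assume "Rel \<alpha> v"
      then show "\<alpha> \<in> T \<rightarrow> GF_sub q n \<and> v \<in> carrier ?L"
        unfolding Rel_def using Q.e_closed BQ by blast
    next
      \<comment> \<open>Single-valuedness is where injectivity enters: a function in
        \<open>L(kD)\<close> that vanishes at all chosen places is 0, hence so is its value at
        \<open>Q\<close>.\<close>
      fix \<alpha> v assume "Rel \<alpha> v" and z: "\<forall>t \<in> T. \<alpha> t = \<zero>\<^bsub>?L\<^esub>"
      then obtain f where f: "f \<in> ?B" "v = eQ f"
          "\<And>ij. ij \<in> I \<Longrightarrow> e ij f = finsum (GP ij) (\<lambda>t. \<eta> ij (\<alpha> t) \<otimes>\<^bsub>GP ij\<^esub> c ij t) T"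
        unfolding Rel_def by blast
      have zB: "\<zero>\<^bsub>F\<^esub> \<in> ?B" by (rule riemann_roch_zero[OF ff])
      have "ev F (P (fst ij) (snd ij)) f = ev F (P (fst ij) (snd ij)) \<zero>\<^bsub>F\<^esub>" if ij: "ij \<in> I" for ij
      proof -
        interpret E: evaluation F "GP ij" K "OP ij" "e ij" by (rule eval[OF ij])
        have "Q.const_of \<zero>\<^bsub>?L\<^esub> = \<zero>\<^bsub>F\<^esub>"
          using Q.const_of_e[of "\<zero>\<^bsub>F\<^esub>"] Q.e_zero subringE(2)[OF subfieldE(1)[OF Q.K]] by simp
        then have "\<eta> ij \<zero>\<^bsub>?L\<^esub> = \<zero>\<^bsub>GP ij\<^esub>" by (simp add: \<eta>_def E.e_zero)
        then have "e ij f = \<zero>\<^bsub>GP ij\<^esub>"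
          unfolding f(3)[OF ij] using z 12(2)[OF ij] by (intro E.L.add.finprod_one_eqI) auto
        then have "e ij f = e ij \<zero>\<^bsub>F\<^esub>" by (simp add: E.e_zero)
        then show ?thesis using e_eq[OF ij BO[OF ij f(1)] BO[OF ij zB]] by simp
      qed
      then have "ev_family F I P f = ev_family F I P \<zero>\<^bsub>F\<^esub>"
        by (auto simp: ev_family_def fun_eq_iff restrict_def)
      then have "f = \<zero>\<^bsub>F\<^esub>" using inj_onD[OF inj] f(1) zB by blast
      then show "v = \<zero>\<^bsub>?L\<^esub>" using f(2) Q.e_zero by simp
    qed
    then obtain w where w: "w \<in> T \<rightarrow> carrier ?L"
      and rel: "\<And>\<alpha> v. Rel \<alpha> v \<Longrightarrow> v = finsum ?L (\<lambda>t. \<alpha> t \<otimes>\<^bsub>?L\<^esub> w t) T" by blast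
    show ?case
    proof (intro bexI[OF _ w] ballI impI)
      fix x \<alpha> assume x: "x \<in> {1..k} \<rightarrow> carrier ?L" and \<alpha>: "\<alpha> \<in> T \<rightarrow> GF_sub q n"
        and eq: "\<forall>ij \<in> I. finprod (GP ij) (\<lambda>l. \<theta> ij (x l)) {1..k} = finsum (GP ij) (\<lambda>t. \<eta> ij (\<alpha> t) \<otimes>\<^bsub>GP ij\<^esub> c ij t) T"
      \<comment> \<open>The witness for \<open>Rel\<close>: its value at the place \<open>ij\<close>
        is the product of the \<open>\<theta> ij (x l)\<close>, and its value at \<open>Q\<close> is
        the product of the \<open>x l\<close>.\<close>
      let ?h = "finprod F (\<lambda>l. \<sigma> (x l)) {1..k}"
      have \<sigma>x: "\<sigma> (x l) \<in> ?A" if "l \<in> {1..k}" for l using \<sigma>(1) x that by (simp add: Pi_iff)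
      have "?h \<in> ?B" using \<sigma>x by (rule prodB)
      moreover have "e ij ?h = finprod (GP ij) (\<lambda>l. \<theta> ij (x l)) {1..k}" if ij: "ij \<in> I" for ij
        unfolding \<theta>_def using \<sigma>x AO[OF ij] by (intro evaluation.e_finprod(2)[OF eval[OF ij]]) auto
      moreover have "eQ ?h = finprod ?L x {1..k}"
      proof -
        have "eQ ?h = finprod ?L (\<lambda>l. eQ (\<sigma> (x l))) {1..k}"
          using \<sigma>x AQ by (intro Q.e_finprod(2)) auto
        also have "\<dots> = finprod ?L x {1..k}"
          using \<sigma>(2) x by (intro Q.L.finprod_cong') (auto simp: Pi_iff)
        finally show ?thesis .
      qed
      ultimately have "Rel \<alpha> (finprod ?L x {1..k})" unfolding Rel_def using \<alpha> eq by (intro bexI[of _ ?h]) auto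
      then show "finprod ?L x {1..k} = finsum ?L (\<lambda>t. \<alpha> t \<otimes>\<^bsub>?L\<^esub> w t) T" by (rule rel)
    qed
  qed
  have dec: "tensor_decomposition (GP ij) (GF_sub q (fst ij)) k' (mu q k' (fst ij))" if ij: "ij \<in> I" and "k' \<ge> 1" for ij k'
  proof -
    have "P (fst ij) (snd ij) \<in> places F K" "has_degree F K (P (fst ij) (snd ij)) (fst ij)"
      using Pl[of "fst ij" "snd ij"] ij by auto
    from place_evaluation(1)[OF ff q finK cardK this] have "finite (carrier (GP ij))" by (simp add: GP_def)
    moreover have "subfield (GF_sub q (fst ij)) (GP ij)"
      using evaluation.e_K_subfield[OF eval[OF ij]] eK[OF ij] by simp
    ultimately have "\<exists>s. tensor_decomposition (GP ij) (GF_sub q (fst ij)) k' s"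
      using field.tensor_decomposition_exists[OF FI.R[OF ij]] that(2) by blast
    then show ?thesis unfolding mu_def GP_def by (rule LeastI_ex)
  qed
  have sum: "(\<Sum>ij\<in>I. mu q k' (fst ij)) = (\<Sum>i = 1..d. N i * mu q k' i)" for k'
  proof -
    have "(\<Sum>ij\<in>I. mu q k' (fst ij)) = (\<Sum>i\<in>{1..d}. \<Sum>j\<in>{1..N i}. mu q k' i)"
      unfolding I by (subst sum.Sigma) (auto simp: split_beta)
    then show ?thesis by simp
  qed
  have "mu q k n \<le> (\<Sum>i = 1..d. N i * mu q k i)"
    using FI.tensor_decomposition_interpolation[of "\<lambda>ij. mu q k (fst ij)"] dec k
    unfolding sum mu_def[of q k n] by (intro Least_le) auto
  moreover have "nu q k n \<le> (k - 1) * (\<Sum>i = 1..d. N i * mu q 2 i)"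
    using FI.bilinear_computable_interpolation[OF k, of "\<lambda>ij. mu q 2 (fst ij)"] dec
    unfolding sum nu_def by (intro Least_le) auto
  ultimately show ?thesis using part1 by blast
qed

end
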